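(* For any density matrix $\rho\in\mathbb{D}$ and any class of operations $\mathcal{O}\in\{\mathrm{MIO},\mathrm{DIO},\mathrm{SIO},\mathrm{IO}\}$, the maximal achievable fidelity of assisted distillation (with target dimension $m\in\mathbb{N}$) and the rate of one-shot assisted distillation (with allowed error $\varepsilon$) are given by $$F_{A,\mathcal{O}}(\rho,m)=\max_{\omega\in\mathcal{M}_m}F(\rho,\omega),$$ $$C_{A,\mathcal{O}}^{(1),\varepsilon}(\rho)=\left\lfloor-\log\min_{\omega\in\mathcal{B}_\varepsilon(\rho)}\vartheta(\omega)\right\rfloor_{\log}.$$
   Context: $\mathcal{H}_d$ is a complex Hilbert space of finite dimension $d$ with a fixed orthonormal (reference) basis $\{|i\rangle\}_{i=1}^d$; $\mathbb{D}$ is the set of density matrices on $\mathcal{H}_d$. $\log$ is base 2, and $\lfloor x\rfloor_{\log}:=\log\lfloor 2^x\rfloor$. For a vector, $\||x\rangle\|_{\ell_p}$ is the $\ell_p$ norm of its coefficients in the reference basis. For a unit vector $|\psi\rangle$, $\psi:=|\psi\rangle\langle\psi|$. $\langle X,Y\rangle=\mathrm{Tr}(X^\dagger Y)$. $F(\rho,\sigma)=\|\sqrt\rho\sqrt\sigma\|_1^2$ (trace norm) is the squared fidelity. $\Delta$ denotes the dephasing map $\Delta(X)=\sum_i|i\rangle\langle i|X|i\rangle\langle i|$ in the reference basis of the relevant space; a state $\omega$ is incoherent if $\omega=\Delta(\omega)$. Free operations (quantum channels from operators on $\mathcal{H}_d$ to operators on an $m$-dimensional space with its own reference basis $\{|i\rangle\}_{i=1}^m$):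 MIO are channels mapping every incoherent state to an incoherent state; DIO are channels $\mathscr{E}$ that commute with dephasing, $\Delta[\mathscr{E}(\rho)]=\mathscr{E}[\Delta(\rho)]$; IO are channels having a Kraus decomposition $\{K_\ell\}$ with every $K_\ell$ incoherent, i.e. $K_\ell\sigma K_\ell^\dagger$ is, up to normalization, an incoherent state for every incoherent $\sigma$; SIO are channels having a Kraus decomposition $\{K_\ell\}$ in which all $K_\ell$ and all $K_\ell^\dagger$ are incoherent in this sense. $|\Psi_m\rangle=\sum_{i=1}^m\frac1{\sqrt m}|i\rangle$ is the $m$-dimensional maximally coherent state. The fidelity of assisted distillation is $$F_{A,\mathcal{O}}(\rho,m):=\max\Big\{\Big\langle\sum_ip_i\Lambda_i(\psi_i),\Psi_m\Big\rangle : \rho=\sum_ip_i\psi_i,\ \Lambda_i\in\mathcal{O}\ \forall i\Big\},$$ where the maximum is over all pure-state convex decompositions of $\rho$ and all choices of $\Lambda_i$. The one-shot assisted distillation rate with allowed error $\varepsilon$ is $$C_{A,\mathcal{O}}^{(1),\varepsilon}(\rho):=\log\max\{m\in\mathbb{N}: F_{A,\mathcal{O}}(\rho,m)\ge1-\varepsilon\}.$$ $\mathcal{M}_m:=\mathrm{conv}\{|\omega\rangle\langle\omega| : |\omega\rangle\in\mathcal{H}_d,\ \||\omega\rangle\|_{\ell_\infty}\le\frac1{\sqrt m},\ \||\omega\rangle\|_{\ell_2}=1\}$. For $\omega\in\mathbb{D}$, $$\vartheta(\omega):=\min\Big\{\max_i\||\psi_i\rangle\|_{\ell_\infty}^2 :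 \omega=\sum_ip_i\psi_i\Big\},$$ the minimum being over pure-state convex decompositions of $\omega$. $\mathcal{B}_\varepsilon(\rho):=\{\omega\in\mathbb{D}: F(\rho,\omega)\ge1-\varepsilon\}$.
   Formalization: The first formula is stated for 1 ≤ m ≤ d, since M_m is empty for m > d. The rate formula, false if m > d is allowed with large ε (e.g. d = 1, ε = 1/2), is stated with target dimensions m ≤ d for every ε ≥ 0, and with all m for 0 ≤ ε < 1/(d+1). *)

theory Defs
  imports Complex_Main "Jordan_Normal_Form.Schur_Decomposition"
begin

text \<open>The reference basis of a \<open>d\<close>-dimensional space is indexed by \<open>0, \<dots>, d - 1\<close>; vectors and
  operators are given by their coefficients in it.\<close>

subsection \<open>Maxima and minima\<close>

text \<open>A \<open>max\<close> (\<open>min\<close>) over a set \<open>S\<close> of reals is written \<open>Sup S\<close> (\<open>Inf S\<close>); that it is attained is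
  expressed by the following predicates.\<close>

definition has_max :: "'a::order set \<Rightarrow> bool" where
  "has_max S \<longleftrightarrow> (\<exists>x\<in>S. \<forall>y\<in>S. y \<le> x)"

definition has_min :: "'a::order set \<Rightarrow> bool" where
  "has_min S \<longleftrightarrow> (\<exists>x\<in>S. \<forall>y\<in>S. x \<le> y)"

subsection \<open>Vectors and operators\<close>

definition linf_norm :: "complex vec \<Rightarrow> real" where
  "linf_norm v = Max ((\<lambda>i. cmod (v $ i)) ` {..<dim_vec v})"

definition l2_norm :: "complex vec \<Rightarrow> real" where
  "l2_norm v = sqrt (\<Sum>i<dim_vec v. (cmod (v $ i))\<^sup>2)"

definition unit_ket :: "nat \<Rightarrow> complex vec \<Rightarrow> bool" where
  "unit_ket d \<psi> \<longleftrightarrow> \<psi> \<in> carrier_vec d \<and> l2_norm \<psi> = 1"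

definition ket_bra :: "complex vec \<Rightarrow> complex mat" where
  "ket_bra \<psi> = mat (dim_vec \<psi>) (dim_vec \<psi>) (\<lambda>(i, j). \<psi> $ i * cnj (\<psi> $ j))"

definition mat_trace :: "complex mat \<Rightarrow> complex" where
  "mat_trace A = (\<Sum>i<dim_row A. A $$ (i, i))"

definition hs_inner :: "complex mat \<Rightarrow> complex mat \<Rightarrow> complex" where
  "hs_inner X Y = mat_trace (mat_adjoint X * Y)"

text \<open>Sums of matrices are taken entrywise, since \<^typ>\<open>complex mat\<close> does not fix the dimensions.\<close>

definition mat_sum :: "nat \<Rightarrow> nat \<Rightarrow> (nat \<Rightarrow> complex mat) \<Rightarrow> complex mat" where
  "mat_sum n N A = mat n n (\<lambda>(i, j). \<Sum>k<N. A k $$ (i, j))"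

definition mat_comb :: "nat \<Rightarrow> nat \<Rightarrow> (nat \<Rightarrow> real) \<Rightarrow> (nat \<Rightarrow> complex mat) \<Rightarrow> complex mat" where
  "mat_comb n N p A = mat_sum n N (\<lambda>k. complex_of_real (p k) \<cdot>\<^sub>m A k)"

definition prob_weights :: "nat \<Rightarrow> (nat \<Rightarrow> real) \<Rightarrow> bool" where
  "prob_weights N p \<longleftrightarrow> (\<forall>k<N. 0 \<le> p k) \<and> (\<Sum>k<N. p k) = 1"

definition mat_conv :: "nat \<Rightarrow> complex mat set \<Rightarrow> complex mat set" where
  "mat_conv n S = {mat_comb n N p A | N p A. prob_weights N p \<and> (\<forall>k<N. A k \<in> S)}"

text \<open>The order on \<^typ>\<open>complex\<close> is the one in which \<open>0 \<le> z\<close> says that \<open>z\<close> is real and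
  nonnegative; hence the following matrices are automatically Hermitian.\<close>

definition psd :: "nat \<Rightarrow> complex mat \<Rightarrow> bool" where
  "psd n A \<longleftrightarrow> A \<in> carrier_mat n n \<and> (\<forall>v\<in>carrier_vec n. 0 \<le> (A *\<^sub>v v) \<bullet>c v)"

definition psd_sqrt :: "complex mat \<Rightarrow> complex mat" where
  "psd_sqrt A = (THE B. psd (dim_row A) B \<and> B * B = A)"

definition trace_norm :: "complex mat \<Rightarrow> real" where
  "trace_norm X = Re (mat_trace (psd_sqrt (mat_adjoint X * X)))"

definition density :: "nat \<Rightarrow> complex mat set" where
  "density d = {\<rho>. psd d \<rho> \<and> mat_trace \<rho> = 1}"

definition fidelity :: "complex mat \<Rightarrow> complex mat \<Rightarrow> real" where
  "fidelity \<rho> \<sigma> = (trace_norm (psd_sqrt \<rho> * psd_sqrt \<sigma>))\<^sup>2"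

definition pure_decomposition ::
  "nat \<Rightarrow> complex mat \<Rightarrow> nat \<Rightarrow> (nat \<Rightarrow> real) \<Rightarrow> (nat \<Rightarrow> complex vec) \<Rightarrow> bool" where
  "pure_decomposition d \<rho> N p \<psi> \<longleftrightarrow>
     prob_weights N p \<and> (\<forall>k<N. unit_ket d (\<psi> k)) \<and> \<rho> = mat_comb d N p (\<lambda>k. ket_bra (\<psi> k))"

subsection \<open>Free operations\<close>

definition dephase :: "complex mat \<Rightarrow> complex mat" where
  "dephase X = mat (dim_row X) (dim_col X) (\<lambda>(i, j). if i = j then X $$ (i, i) else 0)"

definition incoherent_states :: "nat \<Rightarrow> complex mat set" where
  "incoherent_states d = {\<omega> \<in> density d. \<omega> = dephase \<omega>}"

text \<open>\<open>ampliation k d m E\<close> is \<open>id\<^sub>k \<otimes> E\<close>: a \<open>kd \<times> kd\<close> matrix is regarded as a \<open>k \<times> k\<close> array of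
  \<open>d \<times> d\<close> blocks, and \<open>E\<close> is applied to each block.\<close>

definition mat_block :: "nat \<Rightarrow> complex mat \<Rightarrow> nat \<Rightarrow> nat \<Rightarrow> complex mat" where
  "mat_block d X a b = mat d d (\<lambda>(i, j). X $$ (a * d + i, b * d + j))"

definition ampliation ::
  "nat \<Rightarrow> nat \<Rightarrow> nat \<Rightarrow> (complex mat \<Rightarrow> complex mat) \<Rightarrow> complex mat \<Rightarrow> complex mat" where
  "ampliation k d m E X =
     mat (k * m) (k * m) (\<lambda>(i, j). E (mat_block d X (i div m) (j div m)) $$ (i mod m, j mod m))"

definition completely_positive :: "nat \<Rightarrow> nat \<Rightarrow> (complex mat \<Rightarrow> complex mat) \<Rightarrow> bool" where
  "completely_positive d m E \<longleftrightarrow> (\<forall>k X. psd (k * d) X \<longrightarrow> psd (k * m) (ampliation k d m E X))"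

text \<open>Only the values of a channel on \<^term>\<open>carrier_mat d d\<close> are relevant.\<close>

definition channels :: "nat \<Rightarrow> nat \<Rightarrow> (complex mat \<Rightarrow> complex mat) set" where
  "channels d m = {E.
     (\<forall>X\<in>carrier_mat d d. E X \<in> carrier_mat m m) \<and>
     (\<forall>X\<in>carrier_mat d d. \<forall>Y\<in>carrier_mat d d. E (X + Y) = E X + E Y) \<and>
     (\<forall>c. \<forall>X\<in>carrier_mat d d. E (c \<cdot>\<^sub>m X) = c \<cdot>\<^sub>m E X) \<and>
     (\<forall>X\<in>carrier_mat d d. mat_trace (E X) = mat_trace X) \<and>
     completely_positive d m E}"

definition kraus_decomposition ::
  "nat \<Rightarrow> nat \<Rightarrow> (complex mat \<Rightarrow> complex mat) \<Rightarrow> nat \<Rightarrow> (nat \<Rightarrow> complex mat) \<Rightarrow> bool" where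
  "kraus_decomposition d m E N K \<longleftrightarrow>
     (\<forall>l<N. K l \<in> carrier_mat m d) \<and>
     (\<forall>X\<in>carrier_mat d d. E X = mat_sum m N (\<lambda>l. K l * X * mat_adjoint (K l)))"

text \<open>The normalization \<open>c\<close> may vanish: an outcome of probability zero is allowed.\<close>

definition incoherent_op :: "nat \<Rightarrow> nat \<Rightarrow> complex mat \<Rightarrow> bool" where
  "incoherent_op d m K \<longleftrightarrow> K \<in> carrier_mat m d \<and>
     (\<forall>\<sigma>\<in>incoherent_states d. \<exists>c\<ge>0. \<exists>\<tau>\<in>incoherent_states m.
        K * \<sigma> * mat_adjoint K = complex_of_real c \<cdot>\<^sub>m \<tau>)"

definition MIO :: "nat \<Rightarrow> nat \<Rightarrow> (complex mat \<Rightarrow> complex mat) set" where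
  "MIO d m = {E \<in> channels d m. \<forall>\<sigma>\<in>incoherent_states d. E \<sigma> \<in> incoherent_states m}"

definition DIO :: "nat \<Rightarrow> nat \<Rightarrow> (complex mat \<Rightarrow> complex mat) set" where
  "DIO d m = {E \<in> channels d m. \<forall>\<rho>\<in>density d. dephase (E \<rho>) = E (dephase \<rho>)}"

definition IO :: "nat \<Rightarrow> nat \<Rightarrow> (complex mat \<Rightarrow> complex mat) set" where
  "IO d m = {E \<in> channels d m. \<exists>N K. kraus_decomposition d m E N K \<and>
     (\<forall>l<N. incoherent_op d m (K l))}"

definition SIO :: "nat \<Rightarrow> nat \<Rightarrow> (complex mat \<Rightarrow> complex mat) set" where
  "SIO d m = {E \<in> channels d m. \<exists>N K. kraus_decomposition d m E N K \<and>
     (\<forall>l<N. incoherent_op d m (K l) \<and> incoherent_op m d (mat_adjoint (K l)))}"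

subsection \<open>Assisted distillation\<close>

definition max_coherent :: "nat \<Rightarrow> complex vec" where
  "max_coherent m = vec m (\<lambda>i. complex_of_real (1 / sqrt (real m)))"

text \<open>In this section \<open>Ops d m\<close> is the set of free operations from dimension \<open>d\<close> to dimension \<open>m\<close>.\<close>

definition assisted_values ::
  "(nat \<Rightarrow> nat \<Rightarrow> (complex mat \<Rightarrow> complex mat) set) \<Rightarrow> nat \<Rightarrow> complex mat \<Rightarrow> nat \<Rightarrow> real set" where
  "assisted_values Ops d \<rho> m =
     {Re (hs_inner (mat_comb m N p (\<lambda>i. \<Lambda> i (ket_bra (\<psi> i)))) (ket_bra (max_coherent m)))
      | N p \<psi> \<Lambda>. pure_decomposition d \<rho> N p \<psi> \<and> (\<forall>i<N. \<Lambda> i \<in> Ops d m)}"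

definition assisted_fidelity ::
  "(nat \<Rightarrow> nat \<Rightarrow> (complex mat \<Rightarrow> complex mat) set) \<Rightarrow> nat \<Rightarrow> complex mat \<Rightarrow> nat \<Rightarrow> real" where
  "assisted_fidelity Ops d \<rho> m = Sup (assisted_values Ops d \<rho> m)"

text \<open>\<open>D\<close> is the set of target dimensions under consideration.\<close>

definition achievable_dims ::
  "nat set \<Rightarrow> (nat \<Rightarrow> nat \<Rightarrow> (complex mat \<Rightarrow> complex mat) set) \<Rightarrow> nat \<Rightarrow> complex mat \<Rightarrow> real \<Rightarrow> nat set"
  where "achievable_dims D Ops d \<rho> \<epsilon> = {m \<in> D. assisted_fidelity Ops d \<rho> m \<ge> 1 - \<epsilon>}"

definition assisted_rate ::
  "nat set \<Rightarrow> (nat \<Rightarrow> nat \<Rightarrow> (complex mat \<Rightarrow> complex mat) set) \<Rightarrow> nat \<Rightarrow> complex mat \<Rightarrow> real \<Rightarrow> real"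
  where "assisted_rate D Ops d \<rho> \<epsilon> = log 2 (real (Max (achievable_dims D Ops d \<rho> \<epsilon>)))"

definition flat_states :: "nat \<Rightarrow> nat \<Rightarrow> complex mat set" where
  "flat_states d m = mat_conv d {ket_bra \<omega> | \<omega>. unit_ket d \<omega> \<and> linf_norm \<omega> \<le> 1 / sqrt (real m)}"

definition theta_values :: "nat \<Rightarrow> complex mat \<Rightarrow> real set" where
  "theta_values d \<omega> = {Max ((\<lambda>i. (linf_norm (\<psi> i))\<^sup>2) ` {..<N}) | N p \<psi>.
     pure_decomposition d \<omega> N p \<psi>}"

definition theta :: "nat \<Rightarrow> complex mat \<Rightarrow> real" where
  "theta d \<omega> = Inf (theta_values d \<omega>)"

definition fidelity_ball :: "nat \<Rightarrow> real \<Rightarrow> complex mat \<Rightarrow> complex mat set" where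
  "fidelity_ball d \<epsilon> \<rho> = {\<omega> \<in> density d. fidelity \<rho> \<omega> \<ge> 1 - \<epsilon>}"

definition floor_log :: "real \<Rightarrow> real" where
  "floor_log x = log 2 (real_of_int \<lfloor>2 powr x\<rfloor>)"

end

theory Submission
  imports Defs "HOL-Analysis.Function_Topology" "HOL-Analysis.L2_Norm"
begin

text \<open>A state \<open>\<omega> = W W\<dagger>\<close> is identified with the decomposition into the (unnormalised) columns of
  \<open>W\<close>. For a pure state and target dimension \<open>m\<close>, the optimal fidelity for all four classes of
  operations is the maximum of \<open>(\<Sum>\<^sub>i r\<^sub>i |\<psi>\<^sub>i|)\<^sup>2\<close> over \<open>r \<ge> 0\<close> with \<open>r\<^sub>i\<^sup>2 \<le> 1/m\<close> and
  \<open>\<Sum>\<^sub>i r\<^sub>i\<^sup>2 = 1\<close>: the bound for MIO is the Cauchy-Schwarz inequality for \<open>E\<dagger>(\<Psi>\<^sub>m)\<close>, and it is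
  attained by a channel in SIO and DIO, since \<open>m r\<^sup>2\<close> lies in the hypersimplex and hence is a convex
  combination of indicators of \<open>m\<close>-subsets. By Uhlmann's theorem, \<open>F(\<rho>, W W\<dagger>)\<^sup>1\<^sup>/\<^sup>2\<close> is the maximum of
  \<open>Re Tr(P\<dagger> W)\<close> over \<open>P P\<dagger> \<le> \<rho>\<close>; comparing the columns of \<open>P\<close> and \<open>W\<close> with the Cauchy-Schwarz
  inequality turns the average over pure-state decompositions of \<open>\<rho>\<close> into the fidelity with a flat
  state. Attainment follows by compactness, the number of columns being bounded by Caratheodory's
  theorem. The rate formula holds because \<open>\<vartheta>(\<omega>) \<le> 1/m\<close> means that \<open>\<omega>\<close> is flat.\<close>

subsection \<open>Adjoints and traces\<close>

text \<open>Fidelity is not handled as a continuous function of the state. Each extremal problem is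
  posed for triples \<open>(W, P, t)\<close>: a factor \<open>W\<close> of the state, a factor
  \<open>P\<close> with \<open>P P\<dagger> \<le> \<rho>\<close>, and a flatness bound
  \<open>t\<close>. Fidelity enters only through \<open>Re Tr(P\<dagger> W)\<close>, a polynomial in
  real and imaginary parts of entries. Unnormalised columns are what makes this work: weights and
  kets merge into one matrix, zero columns are legal, and flatness becomes a homogeneous inequality
  without division, so the admissible triples form a compact set.

  Asking for \<open>P P\<dagger> \<le> \<rho>\<close> instead of equality lets the optimal
  \<open>P\<close> be the square root of \<open>\<rho>\<close> times a contraction of the same shape
  as \<open>W\<close>. When a genuine decomposition of \<open>\<rho>\<close> is wanted, the missing
  part is appended as further columns, which can only raise the value.

  A unit vector with all squared moduli at most \<open>1/m\<close> exists only for
  \<open>m \<le> d\<close>. For larger \<open>m\<close> there is no flat state to compare with, and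
  a crude bound \<open>d/m\<close> on the assisted fidelity takes over; it is the origin of the
  threshold \<open>1/(d + 1)\<close>.\<close>

notation mat_adjoint ("_\<dagger>" [1000] 999)

lemma dim_adjoint [simp]: "dim_row (A\<dagger>) = dim_col A" "dim_col (A\<dagger>) = dim_row A"
  by (simp_all only: mat_adjoint_def mat_of_rows_carrier length_map cols_length)

lemma adjoint_carrier [simp, intro]: "A \<in> carrier_mat n m \<Longrightarrow> A\<dagger> \<in> carrier_mat m n"
  by (intro carrier_matI) auto

lemma adjoint_index [simp]:
  fixes A :: "complex mat"
  assumes "i < dim_col A" "j < dim_row A"
  shows "A\<dagger> $$ (i, j) = cnj (A $$ (j, i))"
  using assms by (simp add: mat_adjoint_def mat_of_rows_def)

declare index_mult_mat(1) [simp del]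

text \<open>Plain finite sums replace the scalar product of a row and a column, whose simp rule has
  just been removed; exchange of summation is then directly available.\<close>

lemma mult_index:
  assumes "A \<in> carrier_mat n m" "B \<in> carrier_mat m p" "i < n" "j < p"
  shows "(A * B) $$ (i, j) = (\<Sum>k<m. A $$ (i, k) * B $$ (k, j))"
  using assms by (auto simp: index_mult_mat(1) scalar_prod_def lessThan_atLeast0)

lemma mult_square_carrier [simp]:
  "A \<in> carrier_mat n n \<Longrightarrow> B \<in> carrier_mat n n \<Longrightarrow> A * B \<in> carrier_mat n n"
  by (rule mult_carrier_mat)

lemma adjoint_adjoint [simp]: "(A\<dagger>)\<dagger> = (A :: complex mat)"
  by (rule eq_matI) auto

lemma adjoint_mult:
  fixes A :: "complex mat"
  assumes "A \<in> carrier_mat n m" "B \<in> carrier_mat m p"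
  shows "(A * B)\<dagger> = B\<dagger> * A\<dagger>"
  using assms by (intro eq_matI) (auto simp: mult_index[of _ n m _ p] mult_index[of _ p m _ n] mult_ac intro!: sum.cong)

lemma adjoint_one [simp]: "(1\<^sub>m n)\<dagger> = (1\<^sub>m n :: complex mat)"
  by (rule eq_matI) auto

lemma adjoint_minus:
  fixes A :: "complex mat"
  assumes "A \<in> carrier_mat n m" "B \<in> carrier_mat n m"
  shows "(A - B)\<dagger> = A\<dagger> - B\<dagger>"
  using assms by (intro eq_matI) auto

lemma inner_adjoint:
  fixes M :: "complex mat"
  assumes "M \<in> carrier_mat n m" "x \<in> carrier_vec m" "v \<in> carrier_vec n"
  shows "(M *\<^sub>v x) \<bullet>c v = x \<bullet>c (M\<dagger> *\<^sub>v v)"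
proof -
  have "(M *\<^sub>v x) \<bullet>c v = (\<Sum>i<n. \<Sum>j<m. M $$ (i, j) * x $ j * cnj (v $ i))"
    using assms by (simp add: scalar_prod_def lessThan_atLeast0 sum_distrib_right)
  also have "\<dots> = (\<Sum>j<m. \<Sum>i<n. M $$ (i, j) * x $ j * cnj (v $ i))"
    by (rule sum.swap)
  also have "\<dots> = x \<bullet>c (M\<dagger> *\<^sub>v v)"
    using assms by (simp add: scalar_prod_def lessThan_atLeast0 sum_distrib_left mult_ac)
  finally show ?thesis .
qed

lemma mat_trace_mult:
  assumes "A \<in> carrier_mat n m" "B \<in> carrier_mat m n"
  shows "mat_trace (A * B) = (\<Sum>i<n. \<Sum>k<m. A $$ (i, k) * B $$ (k, i))"
  using assms by (auto simp: mat_trace_def mult_index[OF assms] intro!: sum.cong)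

lemma mat_trace_comm:
  assumes "A \<in> carrier_mat n m" "B \<in> carrier_mat m n"
  shows "mat_trace (A * B) = mat_trace (B * A)"
  unfolding mat_trace_mult[OF assms] mat_trace_mult[OF assms(2,1)]
  by (subst sum.swap) (simp add: mult_ac)

lemma mat_trace_gram:
  assumes "W \<in> carrier_mat d N"
  shows "mat_trace (W * W\<dagger>) = complex_of_real (\<Sum>k<N. \<Sum>i<d. (cmod (W $$ (i, k)))\<^sup>2)"
proof -
  have "mat_trace (W * W\<dagger>) = (\<Sum>i<d. \<Sum>k<N. complex_of_real ((cmod (W $$ (i, k)))\<^sup>2))"
    using assms by (auto simp: mat_trace_mult[of W d N "W\<dagger>"] complex_norm_square
        simp del: of_real_power intro!: sum.cong)
  then show ?thesis by (subst sum.swap) simp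
qed

text \<open>Summand by summand this is \<open>|a - b|^2 \<ge> 0\<close>. It later bounds the
  diagonal of a product of two contractions.\<close>

lemma adjoint_mult_self_diag_le:
  fixes M N :: "complex mat"
  assumes "M \<in> carrier_mat n m" "N \<in> carrier_mat n m" "i < n"
  shows "2 * Re ((M * N\<dagger>) $$ (i, i)) \<le> Re ((M * M\<dagger>) $$ (i, i)) + Re ((N * N\<dagger>) $$ (i, i))"
proof -
  have *: "2 * Re (a * cnj b) \<le> Re (a * cnj a) + Re (b * cnj b)" for a b
  proof -
    have "0 \<le> (cmod (a - b))\<^sup>2" by simp
    also have "(cmod (a - b))\<^sup>2 = Re (a * cnj a) + Re (b * cnj b) - 2 * Re (a * cnj b)"
      by (simp only: cmod_power2) (simp add: power2_eq_square algebra_simps)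
    finally show ?thesis by simp
  qed
  have i: "(X * Y\<dagger>) $$ (i, i) = (\<Sum>k<m. X $$ (i, k) * cnj (Y $$ (i, k)))"
    if "X \<in> carrier_mat n m" "Y \<in> carrier_mat n m" for X Y
    using that assms(3) mult_index[of X n m "Y\<dagger>" n i i] by (auto intro!: sum.cong)
  show ?thesis
    unfolding i[OF assms(1,2)] i[OF assms(1,1)] i[OF assms(2,2)] Re_sum sum_distrib_left
      sum.distrib[symmetric]
    by (intro sum_mono *)
qed

subsection \<open>Positive semidefinite matrices\<close>

text \<open>The argument is a function instead of a vector, so quantification over it carries no
  dimension condition; only its values below \<open>n\<close> count.\<close>

definition qform :: "nat \<Rightarrow> complex mat \<Rightarrow> (nat \<Rightarrow> complex) \<Rightarrow> complex" where
  "qform n A v = (\<Sum>i<n. \<Sum>j<n. cnj (v i) * A $$ (i, j) * v j)"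

lemma inner_eq_qform:
  assumes "A \<in> carrier_mat n n" "v \<in> carrier_vec n"
  shows "(A *\<^sub>v v) \<bullet>c v = qform n A (vec_index v)"
  using assms by (simp add: qform_def scalar_prod_def lessThan_atLeast0 sum_distrib_right sum_distrib_left mult_ac)

lemma psd_iff_qform: "psd n A \<longleftrightarrow> A \<in> carrier_mat n n \<and> (\<forall>v. 0 \<le> qform n A v)"
proof (intro iffI conjI allI)
  fix v assume psd: "psd n A"
  then have "0 \<le> (A *\<^sub>v vec n v) \<bullet>c vec n v"
    by (simp add: psd_def)
  also have "\<dots> = qform n A (vec_index (vec n v))"
    using psd by (intro inner_eq_qform) (auto simp: psd_def)
  also have "\<dots> = qform n A v" by (simp add: qform_def)
  finally show "0 \<le> qform n A v" .
qed (auto simp: psd_def inner_eq_qform)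

lemma psd_carrier: "psd n A \<Longrightarrow> A \<in> carrier_mat n n"
  by (simp add: psd_def)

lemma psd_congruence:
  assumes "psd n A" "M \<in> carrier_mat m n"
  shows "psd m (M * A * M\<dagger>)"
proof -
  have A: "A \<in> carrier_mat n n" using assms(1) by (rule psd_carrier)
  have "0 \<le> ((M * A * M\<dagger>) *\<^sub>v v) \<bullet>c v" if v: "v \<in> carrier_vec m" for v
  proof -
    have c: "M\<dagger> *\<^sub>v v \<in> carrier_vec n"
      using assms(2) v by (intro mult_mat_vec_carrier[of _ n m]) auto
    have "(M * A * M\<dagger>) *\<^sub>v v = M *\<^sub>v (A *\<^sub>v (M\<dagger> *\<^sub>v v))"
      using A assms(2) v c
      by (simp add: assoc_mult_mat_vec[of _ m n _ m] assoc_mult_mat_vec[of _ m n _ n])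
    also have "\<dots> \<bullet>c v = (A *\<^sub>v (M\<dagger> *\<^sub>v v)) \<bullet>c (M\<dagger> *\<^sub>v v)"
      using A assms(2) v c by (intro inner_adjoint) auto
    also have "0 \<le> \<dots>" using assms(1) c by (simp add: psd_def)
    finally show ?thesis .
  qed
  then show ?thesis using assms A by (auto simp: psd_def)
qed

lemma psd_one: "psd n (1\<^sub>m n)"
  by (auto simp: psd_def)

lemma psd_gram:
  assumes "W \<in> carrier_mat n m"
  shows "psd n (W * W\<dagger>)"
  using psd_congruence[OF psd_one assms] assms by simp

lemma qform_add:
  assumes "A \<in> carrier_mat n n" "B \<in> carrier_mat n n"
  shows "qform n (A + B) v = qform n A v + qform n B v"
  using assms by (simp add: qform_def sum.distrib distrib_left distrib_right)

lemma qform_minus: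
  assumes "A \<in> carrier_mat n n" "B \<in> carrier_mat n n"
  shows "qform n (A - B) v = qform n A v - qform n B v"
  using assms by (simp add: qform_def sum_subtractf left_diff_distrib right_diff_distrib)

lemma psd_add: "psd n A \<Longrightarrow> psd n B \<Longrightarrow> psd n (A + B)"
  by (auto simp: psd_iff_qform qform_add)

lemma qform_unit:
  assumes "i < n"
  shows "qform n A (\<lambda>k. if k = i then 1 else 0) = A $$ (i, i)"
  using assms unfolding qform_def
  by (simp add: if_distrib[of cnj] if_distrib[of "\<lambda>x. x * _"] if_distrib[of "\<lambda>x. _ * x"] cong: if_cong)

lemma psd_diag_nonneg: "psd n A \<Longrightarrow> i < n \<Longrightarrow> 0 \<le> A $$ (i, i)"
  by (metis psd_iff_qform qform_unit)

text \<open>Test vectors \<open>e_i + c e_j\<close> isolate an off-diagonal pair: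
  \<open>c = 1\<close> and the imaginary unit give Hermiticity, \<open>c = -1\<close> the bound by
  the diagonal.\<close>

lemma qform_pair:
  assumes "i < n" "j < n" "i \<noteq> j"
  shows "qform n A (\<lambda>k. if k = i then 1 else if k = j then c else 0) =
    A $$ (i, i) + c * A $$ (i, j) + cnj c * A $$ (j, i) + cnj c * c * A $$ (j, j)"
proof -
  have *: "(\<Sum>k<n. (if k = i then 1 else if k = j then a else 0) * f k) = f i + a * f j"
    for a :: complex and f
  proof -
    have "(\<Sum>k<n. (if k = i then 1 else if k = j then a else 0) * f k) =
      (\<Sum>k<n. (if k = i then f i else 0) + (if k = j then a * f j else 0))"
      using assms by (intro sum.cong) auto
    then show ?thesis using assms by (simp add: sum.distrib)
  qed
  have "qform n A (\<lambda>k. if k = i then 1 else if k = j then c else 0) =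
    (\<Sum>l<n. (if l = i then 1 else if l = j then cnj c else 0) *
      (\<Sum>k<n. (if k = i then 1 else if k = j then c else 0) * A $$ (l, k)))"
    unfolding qform_def by (auto simp: sum_distrib_left intro!: sum.cong)
  then show ?thesis unfolding * by (simp add: algebra_simps)
qed

lemma psd_adjoint:
  assumes "psd n A"
  shows "A\<dagger> = A"
proof -
  note A = psd_carrier[OF assms]
  have "cnj (A $$ (j, i)) = A $$ (i, j)" if ij: "i < n" "j < n" for i j
  proof (cases "i = j")
    case True
    then show ?thesis using psd_diag_nonneg[OF assms ij(1)] by (auto simp: complex_eq_iff less_eq_complex_def)
  next
    case False
    have "0 \<le> qform n A (\<lambda>k. if k = i then 1 else if k = j then c else 0)" for c
      using assms by (simp add: psd_iff_qform)
    \<comment> \<open>Reality of the form for \<open>c = 1\<close> makes the imaginary parts of the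
      two entries opposite; reality for the imaginary unit makes their real parts equal.\<close>
    from this[of 1] this[of \<i>] show ?thesis
      using psd_diag_nonneg[OF assms ij(1)] psd_diag_nonneg[OF assms ij(2)]
      by (auto simp: qform_pair[OF ij False] complex_eq_iff less_eq_complex_def)
  qed
  then show ?thesis using A by (intro eq_matI) auto
qed

lemma psd_offdiag_le:
  assumes "psd n A" "i < n" "j < n"
  shows "2 * Re (A $$ (i, j)) \<le> Re (A $$ (i, i)) + Re (A $$ (j, j))"
proof (cases "i = j")
  case False
  have "0 \<le> qform n A (\<lambda>k. if k = i then 1 else if k = j then -1 else 0)"
    using assms by (simp add: psd_iff_qform)
  moreover have "Re (A $$ (j, i)) = Re (A $$ (i, j))"
    using arg_cong[OF psd_adjoint[OF assms(1)], of "\<lambda>M. Re (M $$ (i, j))"]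
      psd_carrier[OF assms(1)] assms by simp
  ultimately show ?thesis
    by (auto simp: qform_pair[OF assms(2,3) False] less_eq_complex_def)
qed auto

subsection \<open>The spectral theorem\<close>

definition unitary :: "nat \<Rightarrow> complex mat \<Rightarrow> bool" where
  "unitary n U \<longleftrightarrow> U \<in> carrier_mat n n \<and> U\<dagger> * U = 1\<^sub>m n \<and> U * U\<dagger> = 1\<^sub>m n"

text \<open>This is \<open>U diag(f) U\<dagger>\<close>. Keeping \<open>f\<close> a free function
  turns products, inverses and square roots into pointwise operations on \<open>f\<close>.\<close>

definition spectral_mat :: "nat \<Rightarrow> complex mat \<Rightarrow> (nat \<Rightarrow> real) \<Rightarrow> complex mat" where
  "spectral_mat n U f =
     mat n n (\<lambda>(i, j). \<Sum>k<n. U $$ (i, k) * complex_of_real (f k) * cnj (U $$ (j, k)))"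

lemma spectral_mat_carrier [simp]: "spectral_mat n U f \<in> carrier_mat n n"
  by (simp add: spectral_mat_def)

lemma unitary_carrier: "unitary n U \<Longrightarrow> U \<in> carrier_mat n n"
  by (simp add: unitary_def)

lemma unitaryI:
  assumes "U \<in> carrier_mat n n"
    and "\<And>i j. i < n \<Longrightarrow> j < n \<Longrightarrow> (\<Sum>k<n. cnj (U $$ (k, i)) * U $$ (k, j)) = (if i = j then 1 else 0)"
  shows "unitary n U"
proof -
  have "U\<dagger> * U = 1\<^sub>m n"
    using assms by (intro eq_matI) (auto simp: mult_index[of _ n n _ n])
  then show ?thesis
    using assms(1) mat_mult_left_right_inverse[of "U\<dagger>" n U] by (simp add: unitary_def)
qed

lemma unitary_cols:
  assumes "unitary n U" "i < n" "j < n"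
  shows "(\<Sum>k<n. cnj (U $$ (k, i)) * U $$ (k, j)) = (if i = j then 1 else 0)"
proof -
  have "(U\<dagger> * U) $$ (i, j) = (\<Sum>k<n. cnj (U $$ (k, i)) * U $$ (k, j))"
    using unitary_carrier[OF assms(1)] assms(2,3) by (simp add: mult_index[of _ n n _ n])
  moreover have "(U\<dagger> * U) $$ (i, j) = (if i = j then 1 else 0)"
    using assms by (simp add: unitary_def)
  ultimately show ?thesis by simp
qed

lemma unitary_rows:
  assumes "unitary n U" "i < n" "j < n"
  shows "(\<Sum>k<n. U $$ (i, k) * cnj (U $$ (j, k))) = (if i = j then 1 else 0)"
proof -
  have "(U * U\<dagger>) $$ (i, j) = (\<Sum>k<n. U $$ (i, k) * cnj (U $$ (j, k)))"
    using unitary_carrier[OF assms(1)] assms(2,3) by (simp add: mult_index[of _ n n _ n])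
  moreover have "(U * U\<dagger>) $$ (i, j) = (if i = j then 1 else 0)"
    using assms by (simp add: unitary_def)
  ultimately show ?thesis by simp
qed

lemma unitary_mult:
  assumes "unitary n U" "unitary n V"
  shows "unitary n (U * V)"
proof -
  have U: "U \<in> carrier_mat n n" and V: "V \<in> carrier_mat n n"
    using assms by (auto simp: unitary_def)
  have "(U * V)\<dagger> * (U * V) = V\<dagger> * ((U\<dagger> * U) * V)"
    unfolding adjoint_mult[OF U V] assoc_mult_mat[OF adjoint_carrier[OF U] U V]
    using U V by (intro assoc_mult_mat[of _ n n _ n _ n]) auto
  then have 1: "(U * V)\<dagger> * (U * V) = 1\<^sub>m n" using assms V by (simp add: unitary_def)
  then show ?thesis
    using U V mat_mult_left_right_inverse[of "(U * V)\<dagger>" n "U * V"] by (simp add: unitary_def)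
qed

lemma spectral_mat_mult_left:
  assumes "V \<in> carrier_mat n n" "U \<in> carrier_mat n n"
  shows "V * spectral_mat n U f * V\<dagger> = spectral_mat n (V * U) f"
proof (rule eq_matI)
  fix i j assume "i < dim_row (spectral_mat n (V * U) f)" "j < dim_col (spectral_mat n (V * U) f)"
  then have ij: "i < n" "j < n" by (auto simp: spectral_mat_def)
  have "(V * spectral_mat n U f * V\<dagger>) $$ (i, j) =
    (\<Sum>b<n. (\<Sum>a<n. V $$ (i, a) * (\<Sum>k<n. U $$ (a, k) * complex_of_real (f k) * cnj (U $$ (b, k)))) * cnj (V $$ (j, b)))"
    using assms ij by (auto simp: mult_index[of _ n n _ n] spectral_mat_def intro!: sum.cong)
  also have "\<dots> = (\<Sum>b<n. \<Sum>a<n. \<Sum>k<n. V $$ (i, a) * U $$ (a, k) * complex_of_real (f k) * cnj (U $$ (b, k)) * cnj (V $$ (j, b)))"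
    by (simp add: sum_distrib_left sum_distrib_right mult_ac)
  also have "\<dots> = (\<Sum>b<n. \<Sum>k<n. \<Sum>a<n. V $$ (i, a) * U $$ (a, k) * complex_of_real (f k) * cnj (U $$ (b, k)) * cnj (V $$ (j, b)))"
    by (intro sum.cong refl sum.swap)
  also have "\<dots> = (\<Sum>k<n. \<Sum>b<n. \<Sum>a<n. V $$ (i, a) * U $$ (a, k) * complex_of_real (f k) * cnj (U $$ (b, k)) * cnj (V $$ (j, b)))"
    by (rule sum.swap)
  also have "\<dots> = (\<Sum>k<n. \<Sum>a<n. \<Sum>b<n. V $$ (i, a) * U $$ (a, k) * complex_of_real (f k) * cnj (U $$ (b, k)) * cnj (V $$ (j, b)))"
    by (intro sum.cong refl sum.swap)
  also have "\<dots> = spectral_mat n (V * U) f $$ (i, j)"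
    using assms ij by (simp add: spectral_mat_def mult_index[of V n n U n] sum_distrib_left sum_distrib_right mult_ac)
  finally show "(V * spectral_mat n U f * V\<dagger>) $$ (i, j) = spectral_mat n (V * U) f $$ (i, j)" .
qed (use assms in \<open>auto simp: spectral_mat_def\<close>)

text \<open>Completing \<open>v\<close> to a basis and orthogonalising keeps \<open>v\<close> in
  first place; normalising the columns costs the factor \<open>c\<close>, the reciprocal norm of
  \<open>v\<close>.\<close>

lemma unitary_with_first_column:
  assumes v: "v \<in> carrier_vec n" "v \<noteq> 0\<^sub>v n"
  obtains U c where "unitary n U" "\<And>i. i < n \<Longrightarrow> U $$ (i, 0) = c * v $ i"
proof -
  interpret cof_vec_space n "TYPE(complex)" .
  define ws where "ws = gram_schmidt n (basis_completion v)"
  note bc = basis_completion[OF v]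
  note gs = gram_schmidt_result[OF bc(2,4,5) ws_def]
  have len: "length ws = n" using gs(4) bc(6) by simp
  have "n \<noteq> 0" using v by auto
  then obtain vs where "basis_completion v = v # vs"
    using bc(6,7) by (cases "basis_completion v") auto
  then have hd: "ws ! 0 = v"
    using gram_schmidt_hd[OF v(1), of vs] len \<open>n \<noteq> 0\<close> by (simp add: ws_def hd_conv_nth[symmetric] length_greater_0_conv[symmetric] del: length_greater_0_conv)
  have wsc: "ws ! i \<in> carrier_vec n" if "i < n" for i
    using gs(3) that len by auto
  define s where "s i = sqrt (\<Sum>k<n. (cmod (ws ! i $ k))\<^sup>2)" for i
  have ip: "ws ! i \<bullet>c ws ! j = (\<Sum>k<n. ws ! i $ k * cnj (ws ! j $ k))" if "i < n" "j < n" for i j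
    using wsc[OF that(1)] wsc[OF that(2)] by (simp add: scalar_prod_def lessThan_atLeast0)
  have orth: "(\<Sum>k<n. ws ! i $ k * cnj (ws ! j $ k)) = (if i = j then complex_of_real ((s i)\<^sup>2) else 0)"
    if "i < n" "j < n" for i j
  proof (cases "i = j")
    case True
    then show ?thesis by (auto simp: s_def sum_nonneg complex_norm_square simp del: of_real_power intro!: sum.cong)
  next
    case False
    then show ?thesis
      using corthogonalD[OF gs(2), of i j] that len by (simp add: ip)
  qed
  have s0: "s i \<noteq> 0" if "i < n" for i
    using corthogonalD[OF gs(2), of i i] that len orth[OF that that] ip[OF that that] by auto
  define U where "U = mat n n (\<lambda>(i, j). ws ! j $ i / complex_of_real (s j))"
  have "unitary n U"
  proof (rule unitaryI)
    show "U \<in> carrier_mat n n" by (simp add: U_def)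
    fix i j assume ij: "i < n" "j < n"
    have "(\<Sum>k<n. cnj (U $$ (k, i)) * U $$ (k, j)) =
      (\<Sum>k<n. ws ! j $ k * cnj (ws ! i $ k)) / (complex_of_real (s i) * complex_of_real (s j))"
      using ij by (simp add: U_def sum_divide_distrib mult_ac)
    also have "\<dots> = (if i = j then 1 else 0)"
      using orth[OF ij(2,1)] s0[OF ij(1)] by (auto simp: power2_eq_square)
    finally show "(\<Sum>k<n. cnj (U $$ (k, i)) * U $$ (k, j)) = (if i = j then 1 else 0)" .
  qed
  moreover have "U $$ (i, 0) = inverse (complex_of_real (s 0)) * v $ i" if "i < n" for i
    using that hd by (simp add: U_def divide_simps)
  ultimately show thesis by (rule that)
qed

lemma spectral_mat_adjoint [simp]: "(spectral_mat n U f)\<dagger> = spectral_mat n U f"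
  by (rule eq_matI) (auto simp: spectral_mat_def mult_ac)

text \<open>Deflation by induction on the dimension. With an eigenvector as first column of
  \<open>U\<close>, the first column of \<open>U\<dagger> A U\<close> is a multiple of the first
  basis vector, and Hermiticity clears the first row too; the remaining block falls to the induction
  hypothesis.\<close>

theorem hermitian_spectral:
  fixes A :: "complex mat"
  assumes "A \<in> carrier_mat n n" "A\<dagger> = A"
  shows "\<exists>U f. unitary n U \<and> A = spectral_mat n U f"
  using assms
proof (induction n arbitrary: A)
  case 0
  have "unitary 0 (1\<^sub>m 0)" by (simp add: unitary_def)
  moreover have "A = spectral_mat 0 (1\<^sub>m 0) (\<lambda>_. 0)"
    using 0 by (intro eq_matI) (auto simp: spectral_mat_def)
  ultimately show ?case by blast
next
  case (Suc n)
  have "degree (char_poly A) > 0"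
    using degree_monic_char_poly[OF Suc.prems(1)] by simp
  then obtain e where "poly (char_poly A) e = 0"
    using fundamental_theorem_of_algebra[of "char_poly A"] by (auto simp: constant_degree)
  then obtain v where v: "v \<in> carrier_vec (Suc n)" "v \<noteq> 0\<^sub>v (Suc n)" "A *\<^sub>v v = e \<cdot>\<^sub>v v"
    using eigenvalue_root_char_poly[OF Suc.prems(1)] Suc.prems(1)
    by (auto simp: eigenvalue_def eigenvector_def)
  obtain U c where U: "unitary (Suc n) U" "\<And>i. i < Suc n \<Longrightarrow> U $$ (i, 0) = c * v $ i"
    using unitary_with_first_column[OF v(1,2)] by metis
  note A = Suc.prems(1) and Uc = unitary_carrier[OF U(1)]
  define B where "B = U\<dagger> * A * U"
  have B: "B \<in> carrier_mat (Suc n) (Suc n)" using A Uc by (simp add: B_def)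
  have Bh: "B\<dagger> = B"
  proof -
    have "B\<dagger> = U\<dagger> * (U\<dagger> * A)\<dagger>"
      unfolding B_def using A Uc by (intro adjoint_mult[of _ _ "Suc n"]) auto
    also have "(U\<dagger> * A)\<dagger> = A\<dagger> * (U\<dagger>)\<dagger>"
      using A Uc by (intro adjoint_mult[of _ _ "Suc n"]) auto
    finally show ?thesis using A Uc Suc.prems(2)
      by (simp add: B_def assoc_mult_mat[of _ "Suc n" "Suc n" _ "Suc n" _ "Suc n"])
  qed
  have Bcnj: "cnj (B $$ (j, i)) = B $$ (i, j)" if "i < Suc n" "j < Suc n" for i j
    using arg_cong[OF Bh, of "\<lambda>M. M $$ (i, j)"] B that by simp
  have AU: "(A * U) $$ (k, 0) = e * U $$ (k, 0)" if "k < Suc n" for k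
  proof -
    have "(A * U) $$ (k, 0) = c * (A *\<^sub>v v) $ k"
      using A Uc v(1) that U(2)
      by (auto simp: index_mult_mat(1) scalar_prod_def sum_distrib_left mult_ac simp del: sum.op_ivl_Suc intro!: sum.cong)
    then show ?thesis using v U(2)[OF that] that by simp
  qed
  have B0: "B $$ (i, 0) = (if i = 0 then e else 0)" if "i < Suc n" for i
  proof -
    have "B = U\<dagger> * (A * U)"
      using A Uc by (simp add: B_def assoc_mult_mat[of _ "Suc n" "Suc n" _ "Suc n" _ "Suc n"])
    then have "B $$ (i, 0) = (\<Sum>k<Suc n. cnj (U $$ (k, i)) * (e * U $$ (k, 0)))"
      using A Uc that
      by (simp add: mult_index[of "U\<dagger>" "Suc n" "Suc n" "A * U" "Suc n"] AU del: sum.lessThan_Suc)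
    also have "\<dots> = e * (\<Sum>k<Suc n. cnj (U $$ (k, i)) * U $$ (k, 0))"
      by (simp add: sum_distrib_left mult_ac del: sum.lessThan_Suc)
    also have "\<dots> = (if i = 0 then e else 0)"
      using unitary_cols[OF U(1) that, of 0] by (simp del: sum.lessThan_Suc)
    finally show ?thesis .
  qed
  \<comment> \<open>The corner entry of the Hermitian matrix \<open>B\<close> is real, hence so is
    the eigenvalue.\<close>
  have "cnj e = e" using Bcnj[of 0 0] B0[of 0] by simp
  then have e: "complex_of_real (Re e) = e" by (simp add: complex_eq_iff)
  define C where "C = mat n n (\<lambda>(i, j). B $$ (Suc i, Suc j))"
  have "C\<dagger> = C"
    using Bcnj by (intro eq_matI) (auto simp: C_def)
  then obtain V f where V: "unitary n V" "C = spectral_mat n V f"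
    using Suc.IH[of C] by (auto simp: C_def)
  \<comment> \<open>The block matrix \<open>1 \<oplus> V\<close> leaves the eigenvector alone and
    diagonalises the lower block.\<close>
  define V' where "V' = mat (Suc n) (Suc n) (\<lambda>(i, j). case (i, j) of
    (0, 0) \<Rightarrow> 1 | (0, Suc _) \<Rightarrow> 0 | (Suc _, 0) \<Rightarrow> 0 | (Suc i, Suc j) \<Rightarrow> V $$ (i, j))"
  have V': "unitary (Suc n) V'"
  proof (rule unitaryI)
    show "V' \<in> carrier_mat (Suc n) (Suc n)" by (simp add: V'_def)
    fix i j assume ij: "i < Suc n" "j < Suc n"
    then show "(\<Sum>k<Suc n. cnj (V' $$ (k, i)) * V' $$ (k, j)) = (if i = j then 1 else 0)"
      using unitary_cols[OF V(1)]
      by (cases i; cases j) (auto simp: V'_def sum.lessThan_Suc_shift simp del: sum.lessThan_Suc)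
  qed
  have BV': "B = spectral_mat (Suc n) V' (case_nat (Re e) f)"
  proof (rule eq_matI)
    fix i j assume "i < dim_row (spectral_mat (Suc n) V' (case_nat (Re e) f))"
      "j < dim_col (spectral_mat (Suc n) V' (case_nat (Re e) f))"
    then have ij: "i < Suc n" "j < Suc n" by (auto simp: spectral_mat_def)
    have Cf: "B $$ (Suc i, Suc j) = spectral_mat n V f $$ (i, j)" if "i < n" "j < n" for i j
      using that by (simp add: V(2)[symmetric] C_def)
    show "B $$ (i, j) = spectral_mat (Suc n) V' (case_nat (Re e) f) $$ (i, j)"
      using ij B0[OF ij(1)] Bcnj[OF ij] B0[OF ij(2)] e
      by (cases i; cases j)
        (auto simp: V'_def spectral_mat_def sum.lessThan_Suc_shift Cf simp del: sum.lessThan_Suc)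
  qed (use B in \<open>auto simp: spectral_mat_def\<close>)
  have "U * B * U\<dagger> = (U * U\<dagger>) * A * (U * U\<dagger>)"
    using A Uc unfolding B_def
    by (simp add: assoc_mult_mat[of _ "Suc n" "Suc n" _ "Suc n" _ "Suc n"])
  also have "\<dots> = A" using U(1) A by (simp add: unitary_def)
  finally have "A = spectral_mat (Suc n) (U * V') (case_nat (Re e) f)"
    using spectral_mat_mult_left[OF Uc unitary_carrier[OF V']] BV' by simp
  then show ?case using unitary_mult[OF U(1) V'] by blast
qed

section \<open>Functional calculus and positive square roots\<close>

declare minus_carrier_mat [simp]

lemma spectral_mat_cong:
  "(\<And>k. k < n \<Longrightarrow> f k = g k) \<Longrightarrow> spectral_mat n U f = spectral_mat n U g"
  by (simp add: spectral_mat_def)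

lemma spectral_mat_mult:
  assumes "unitary n U"
  shows "spectral_mat n U f * spectral_mat n U g = spectral_mat n U (\<lambda>k. f k * g k)"
proof (rule eq_matI)
  fix i j assume "i < dim_row (spectral_mat n U (\<lambda>k. f k * g k))" "j < dim_col (spectral_mat n U (\<lambda>k. f k * g k))"
  then have ij: "i < n" "j < n" by (auto simp: spectral_mat_def)
  define t where "t k k' = U $$ (i, k) * complex_of_real (f k) * complex_of_real (g k') * cnj (U $$ (j, k'))" for k k'
  have "(spectral_mat n U f * spectral_mat n U g) $$ (i, j) =
    (\<Sum>l<n. (\<Sum>k<n. U $$ (i, k) * complex_of_real (f k) * cnj (U $$ (l, k))) *
       (\<Sum>k'<n. U $$ (l, k') * complex_of_real (g k') * cnj (U $$ (j, k'))))"
    using ij by (simp add: mult_index[of _ n n _ n] spectral_mat_def)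
  also have "\<dots> = (\<Sum>l<n. \<Sum>k<n. \<Sum>k'<n. t k k' * (cnj (U $$ (l, k)) * U $$ (l, k')))"
    unfolding sum_product t_def by (intro sum.cong refl) (simp add: mult_ac)
  also have "\<dots> = (\<Sum>k<n. \<Sum>l<n. \<Sum>k'<n. t k k' * (cnj (U $$ (l, k)) * U $$ (l, k')))"
    by (rule sum.swap)
  also have "\<dots> = (\<Sum>k<n. \<Sum>k'<n. \<Sum>l<n. t k k' * (cnj (U $$ (l, k)) * U $$ (l, k')))"
    by (intro sum.cong refl sum.swap)
  also have "\<dots> = (\<Sum>k<n. \<Sum>k'<n. t k k' * (if k = k' then 1 else 0))"
    by (intro sum.cong refl) (simp add: sum_distrib_left[symmetric] unitary_cols[OF assms])
  also have "\<dots> = (\<Sum>k<n. t k k)" by (simp add: if_distrib cong: if_cong)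
  also have "\<dots> = spectral_mat n U (\<lambda>k. f k * g k) $$ (i, j)"
    using ij by (simp add: spectral_mat_def t_def mult_ac)
  finally show "(spectral_mat n U f * spectral_mat n U g) $$ (i, j) = spectral_mat n U (\<lambda>k. f k * g k) $$ (i, j)" .
qed (auto simp: spectral_mat_def)

lemma spectral_mat_one: "unitary n U \<Longrightarrow> spectral_mat n U (\<lambda>_. 1) = 1\<^sub>m n"
  by (rule eq_matI) (auto simp: spectral_mat_def unitary_rows)

lemma spectral_mat_minus:
  "spectral_mat n U f - spectral_mat n U g = spectral_mat n U (\<lambda>k. f k - g k)"
  by (rule eq_matI) (auto simp: spectral_mat_def sum_subtractf[symmetric] algebra_simps intro!: sum.cong)

lemma psd_spectral_mat:
  assumes "\<And>k. k < n \<Longrightarrow> 0 \<le> f k"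
  shows "psd n (spectral_mat n U f)"
proof -
  define W where "W = mat n n (\<lambda>(i, k). U $$ (i, k) * complex_of_real (sqrt (f k)))"
  have "spectral_mat n U f = W * W\<dagger>"
  proof (rule eq_matI)
    fix i j assume "i < dim_row (W * W\<dagger>)" "j < dim_col (W * W\<dagger>)"
    then have ij: "i < n" "j < n" by (auto simp: W_def)
    have "complex_of_real (f k) = complex_of_real (sqrt (f k)) * complex_of_real (sqrt (f k))" if "k < n" for k
      using assms[OF that] by (simp flip: of_real_mult)
    then show "spectral_mat n U f $$ (i, j) = (W * W\<dagger>) $$ (i, j)"
      using ij mult_index[of W n n "W\<dagger>" n i j]
      by (auto simp: W_def spectral_mat_def mult_ac intro!: sum.cong)
  qed (auto simp: W_def spectral_mat_def)
  then show ?thesis using psd_gram[of W n n] by (simp add: W_def)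
qed

lemma psd_spectral:
  assumes "psd n A"
  obtains U f where "unitary n U" "\<And>k. 0 \<le> f k" "A = spectral_mat n U f"
proof -
  obtain U f where U: "unitary n U" "A = spectral_mat n U f"
    using hermitian_spectral[OF psd_carrier[OF assms] psd_adjoint[OF assms]] by blast
  have "f k \<ge> 0" if "k < n" for k
  proof -
    have "U\<dagger> * A * (U\<dagger>)\<dagger> = spectral_mat n (1\<^sub>m n) f"
      using U unitary_carrier[OF U(1)] spectral_mat_mult_left[of "U\<dagger>" n U f] by (simp add: unitary_def)
    moreover have "psd n (U\<dagger> * A * (U\<dagger>)\<dagger>)"
      using unitary_carrier[OF U(1)] by (intro psd_congruence[OF assms]) auto
    ultimately have "0 \<le> spectral_mat n (1\<^sub>m n) f $$ (k, k)"
      using psd_diag_nonneg that by metis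
    also have "spectral_mat n (1\<^sub>m n) f $$ (k, k) = complex_of_real (f k)"
      using that by (simp add: spectral_mat_def if_distrib if_distribR cong: if_cong)
    finally show ?thesis by (simp add: less_eq_complex_def)
  qed
  \<comment> \<open>Only indices below \<open>n\<close> enter the matrix; truncation at 0 makes
    nonnegativity hold for every index.\<close>
  then have "A = spectral_mat n U (\<lambda>k. max 0 (f k))"
    unfolding U(2) by (intro spectral_mat_cong) auto
  then show thesis using U(1) by (intro that[of U "\<lambda>k. max 0 (f k)"]) auto
qed

text \<open>In the eigenbasis only the diagonal of the conjugated \<open>M\<close> is weighted by
  \<open>f\<close>, so bounds on that diagonal bound the trace.\<close>

lemma mat_trace_spectral_mult:
  assumes "unitary n U" "M \<in> carrier_mat n n"
  shows "mat_trace (spectral_mat n U f * M) = (\<Sum>k<n. complex_of_real (f k) * (U\<dagger> * M * U) $$ (k, k))"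
proof -
  note U = unitary_carrier[OF assms(1)]
  define t where "t k i j = complex_of_real (f k) * (cnj (U $$ (i, k)) * M $$ (i, j) * U $$ (j, k))" for k i j
  have "mat_trace (spectral_mat n U f * M) = (\<Sum>j<n. \<Sum>i<n. \<Sum>k<n. t k i j)"
    using assms(2) mat_trace_mult[of "spectral_mat n U f" n n M]
    by (auto simp: spectral_mat_def t_def sum_distrib_left sum_distrib_right mult_ac intro!: sum.cong)
  also have "\<dots> = (\<Sum>j<n. \<Sum>k<n. \<Sum>i<n. t k i j)"
    by (intro sum.cong refl sum.swap)
  also have "\<dots> = (\<Sum>k<n. \<Sum>j<n. \<Sum>i<n. t k i j)"
    by (rule sum.swap)
  also have "\<dots> = (\<Sum>k<n. complex_of_real (f k) * (U\<dagger> * M * U) $$ (k, k))"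
    using assms(2) U
    by (auto simp: mult_index[of _ n n _ n] t_def sum_distrib_left sum_distrib_right mult_ac intro!: sum.cong)
  finally show ?thesis .
qed

lemma mat_trace_spectral:
  assumes "unitary n U"
  shows "mat_trace (spectral_mat n U f) = (\<Sum>k<n. complex_of_real (f k))"
  using mat_trace_spectral_mult[OF assms, of "1\<^sub>m n" f] assms
  by (simp add: unitary_def right_mult_one_mat[of _ n n])

text \<open>In an eigenbasis of \<open>B - C\<close> the two matrices differ only on the diagonal,
  by \<open>f\<close>. Comparing diagonal entries of the squares gives
  \<open>f k * (2 * a + f k) = 0\<close> with \<open>a\<close> the entry of \<open>C'\<close>; as
  \<open>a\<close> and \<open>a + f k\<close> are both diagonal entries of positive matrices,
  \<open>f k = 0\<close>.\<close>

lemma psd_square_inject: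
  assumes "psd n B" "psd n C" "B * B = C * C"
  shows "B = C"
proof -
  note c = psd_carrier[OF assms(1)] psd_carrier[OF assms(2)]
  have "(B - C)\<dagger> = B - C"
    using c psd_adjoint[OF assms(1)] psd_adjoint[OF assms(2)] by (simp add: adjoint_minus[of B n n])
  then obtain U f where U: "unitary n U" "B - C = spectral_mat n U f"
    using hermitian_spectral[of "B - C" n] c by (metis minus_carrier_mat)
  note Uc = unitary_carrier[OF U(1)]
  define B' C' where "B' = U\<dagger> * B * U" and "C' = U\<dagger> * C * U"
  have c': "B' \<in> carrier_mat n n" "C' \<in> carrier_mat n n" using c Uc by (auto simp: B'_def C'_def)
  have sq: "(U\<dagger> * M * U) * (U\<dagger> * M * U) = U\<dagger> * (M * M) * U" if "M \<in> carrier_mat n n" for M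
  proof -
    have "(U\<dagger> * M * U) * (U\<dagger> * M * U) = U\<dagger> * M * ((U * U\<dagger>) * (M * U))"
      using Uc that by (simp add: assoc_mult_mat[of _ n n _ n _ n])
    also have "(U * U\<dagger>) * (M * U) = M * U" using U(1) Uc that by (simp add: unitary_def)
    finally show ?thesis using Uc that by (simp add: assoc_mult_mat[of _ n n _ n _ n])
  qed
  have eq: "B' * B' = C' * C'" unfolding B'_def C'_def using sq c assms(3) by simp
  have "B' - C' = U\<dagger> * (B - C) * (U\<dagger>)\<dagger>"
    using c Uc by (simp add: B'_def C'_def mult_minus_distrib_mat[of _ n n] minus_mult_distrib_mat[of _ n n])
  also have "\<dots> = spectral_mat n (1\<^sub>m n) f"
    using U Uc spectral_mat_mult_left[of "U\<dagger>" n U f] by (simp add: unitary_def)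
  finally have d: "B' - C' = spectral_mat n (1\<^sub>m n) f" .
  have diff: "B' $$ (i, j) = C' $$ (i, j) + (if i = j then complex_of_real (f i) else 0)"
    if "i < n" "j < n" for i j
  proof -
    have "B' $$ (i, j) - C' $$ (i, j) = (B' - C') $$ (i, j)" using that c' by simp
    also have "\<dots> = (if i = j then complex_of_real (f i) else 0)"
      unfolding d using that by (simp add: spectral_mat_def if_distrib if_distribR cong: if_cong)
    finally show ?thesis by (simp add: diff_eq_eq)
  qed
  have p: "psd n B'" "psd n C'"
    using psd_congruence[OF assms(1), of "U\<dagger>" n] psd_congruence[OF assms(2), of "U\<dagger>" n] Uc
    by (auto simp: B'_def C'_def)
  have "f k = 0" if k: "k < n" for k
  proof -
    define a where "a = Re (C' $$ (k, k))"
    have a: "C' $$ (k, k) = complex_of_real a" "0 \<le> a"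
      using psd_diag_nonneg[OF p(2) k] by (auto simp: a_def less_eq_complex_def complex_eq_iff)
    have b: "0 \<le> a + f k"
      using psd_diag_nonneg[OF p(1) k] diff[OF k k] by (auto simp: a less_eq_complex_def)
    have "(B' * B') $$ (k, k) = (\<Sum>l<n. C' $$ (k, l) * C' $$ (l, k) +
      (if l = k then complex_of_real (2 * a * f k + (f k)\<^sup>2) else 0))"
      unfolding mult_index[OF c'(1,1) k k]
      using k by (intro sum.cong refl) (auto simp: diff a power2_eq_square algebra_simps)
    also have "\<dots> = (C' * C') $$ (k, k) + complex_of_real (2 * a * f k + (f k)\<^sup>2)"
      using k by (simp add: mult_index[OF c'(2,2) k k] sum.distrib)
    finally have "complex_of_real (2 * a * f k + (f k)\<^sup>2) = 0" unfolding eq by simp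
    then have "2 * a * f k + (f k)\<^sup>2 = 0" by (simp only: of_real_eq_0_iff)
    then have "f k * (2 * a + f k) = 0" by (simp add: power2_eq_square algebra_simps)
    then show ?thesis using a(2) b by auto
  qed
  then have BC: "B - C = 0\<^sub>m n n"
    unfolding U(2) by (intro eq_matI) (auto simp: spectral_mat_def)
  have "B $$ (i, j) = C $$ (i, j)" if "i < n" "j < n" for i j
    using arg_cong[OF BC, of "\<lambda>M. M $$ (i, j)"] that c by simp
  then show ?thesis using c by (intro eq_matI) auto
qed

lemma psd_sqrt_eqI:
  assumes "psd n B" "B * B = A"
  shows "psd_sqrt A = B"
proof -
  have n: "dim_row A = n" using assms psd_carrier[OF assms(1)] by auto
  show ?thesis
    unfolding psd_sqrt_def n
  proof (rule the_equality)
    show "psd n B \<and> B * B = A" using assms by simp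
    show "B' = B" if "psd n B' \<and> B' * B' = A" for B'
      using that assms by (intro psd_square_inject[of n B' B]) simp_all
  qed
qed

lemma psd_sqrt:
  assumes "psd n A"
  shows "psd n (psd_sqrt A)" "psd_sqrt A * psd_sqrt A = A"
proof -
  obtain U f where U: "unitary n U" "\<And>k. 0 \<le> f k" "A = spectral_mat n U f"
    using psd_spectral[OF assms] by metis
  define B where "B = spectral_mat n U (\<lambda>k. sqrt (f k))"
  have "psd n B" "B * B = A"
    using U by (auto simp: B_def spectral_mat_mult intro!: psd_spectral_mat)
  then show "psd n (psd_sqrt A)" "psd_sqrt A * psd_sqrt A = A"
    using psd_sqrt_eqI by simp_all
qed

text \<open>\<open>G\<close> is the Moore-Penrose inverse of \<open>Z\<close>, and \<open>E\<close> the projection onto the range of \<open>Z\<close>.\<close>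

lemma psd_pseudo_inverse:
  assumes "psd n Z"
  obtains G E where "psd n G" "psd n E" "psd n (1\<^sub>m n - E)" "E * Z = Z" "G * (Z * Z) = Z"
    "G * (Z * Z) * G = E" "Z * G = E" "E * E = E"
proof -
  obtain U f where U: "unitary n U" "\<And>k. 0 \<le> f k" "Z = spectral_mat n U f"
    using psd_spectral[OF assms] by metis
  \<comment> \<open>Since \<open>inverse 0 = 0\<close>, the product
    \<open>f k * inverse (f k)\<close> is the indicator of the nonzero eigenvalues.\<close>
  define G where "G = spectral_mat n U (\<lambda>k. inverse (f k))"
  define E where "E = spectral_mat n U (\<lambda>k. f k * inverse (f k))"
  have "psd n G" "psd n E"
    using U by (auto simp: G_def E_def intro!: psd_spectral_mat)
  moreover have "psd n (1\<^sub>m n - E)"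
    unfolding spectral_mat_one[OF U(1), symmetric] E_def spectral_mat_minus
  proof (rule psd_spectral_mat)
    fix k show "0 \<le> 1 - f k * inverse (f k)" by (cases "f k = 0") auto
  qed
  moreover have inv: "f k * inverse (f k) = (if f k = 0 then 0 else 1)"
    "inverse (f k) * f k = (if f k = 0 then 0 else 1)" for k
    by auto
  have "E * Z = Z" "G * (Z * Z) = Z" "G * (Z * Z) * G = E" "Z * G = E" "E * E = E"
    unfolding E_def G_def U(3) spectral_mat_mult[OF U(1)]
    by (auto simp: inv mult.assoc[symmetric] intro!: spectral_mat_cong)
  ultimately show thesis using that by blast
qed

section \<open>Contraction factors and the trace norm\<close>

lemma gram_nonpos_eq_0:
  assumes F: "F \<in> carrier_mat n m" and "psd n (0\<^sub>m n n - F * F\<dagger>)"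
  shows "F = 0\<^sub>m n m"
proof (rule eq_matI)
  fix i j assume "i < dim_row (0\<^sub>m n m :: complex mat)" "j < dim_col (0\<^sub>m n m :: complex mat)"
  then have ij: "i < n" "j < m" by auto
  have "(F * F\<dagger>) $$ (i, i) = (\<Sum>k<m. complex_of_real ((cmod (F $$ (i, k)))\<^sup>2))"
    using F ij mult_index[of F n m "F\<dagger>" n i i]
    by (auto simp: complex_norm_square simp del: of_real_power intro!: sum.cong)
  also have "\<dots> = complex_of_real (\<Sum>k<m. (cmod (F $$ (i, k)))\<^sup>2)" by simp
  finally have "(\<Sum>k<m. (cmod (F $$ (i, k)))\<^sup>2) \<le> 0"
    using psd_diag_nonneg[OF assms(2) ij(1)] F ij by (simp add: less_eq_complex_def)
  then have "(\<Sum>k<m. (cmod (F $$ (i, k)))\<^sup>2) = 0" by (simp add: sum_nonneg order_antisym)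
  then show "F $$ (i, j) = 0\<^sub>m n m $$ (i, j)"
    using ij by (simp add: sum_nonneg_eq_0_iff)
qed (use F in auto)

lemma gram_mult:
  fixes A :: "complex mat"
  assumes "A \<in> carrier_mat p n" "Y \<in> carrier_mat n m"
  shows "(A * Y) * (A * Y)\<dagger> = A * (Y * Y\<dagger>) * A\<dagger>"
proof -
  have "(A * Y) * (A * Y)\<dagger> = A * (Y * (Y\<dagger> * A\<dagger>))"
    unfolding adjoint_mult[OF assms] using assms by (intro assoc_mult_mat[of _ p n _ m _ p]) auto
  also have "Y * (Y\<dagger> * A\<dagger>) = (Y * Y\<dagger>) * A\<dagger>"
    using assms by (intro assoc_mult_mat[of _ n m _ n _ p, symmetric]) auto
  also have "A * (\<dots>) = A * (Y * Y\<dagger>) * A\<dagger>"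
    using assms by (intro assoc_mult_mat[of _ p n _ n _ p, symmetric]) auto
  finally show ?thesis .
qed

text \<open>Douglas' factorisation with \<open>C = G * Y\<close>, where \<open>G\<close> is the
  pseudo-inverse of \<open>Z\<close> and \<open>E\<close> its range projection. Compressing the
  inequality by \<open>1 - E\<close> kills \<open>Z * Z\<close>, so \<open>Y\<close> has its columns
  in the range of \<open>Z\<close>; compressing it by \<open>G\<close> gives
  \<open>C C\<dagger> \<le> E \<le> 1\<close>. In the equality case \<open>C\<close> is the polar
  factor, which accounts for the trace identity.\<close>

lemma psd_factor_contraction:
  assumes Z: "psd n Z" and Y: "Y \<in> carrier_mat n m" and le: "psd n (Z * Z - Y * Y\<dagger>)"
  obtains C where "C \<in> carrier_mat n m" "Y = Z * C" "psd n (1\<^sub>m n - C * C\<dagger>)"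
    "Y * Y\<dagger> = Z * Z \<Longrightarrow> mat_trace (C\<dagger> * Y) = mat_trace Z"
proof -
  obtain G E where G: "psd n G" "psd n E" "psd n (1\<^sub>m n - E)" "E * Z = Z" "G * (Z * Z) = Z"
    "G * (Z * Z) * G = E" "Z * G = E" "E * E = E"
    using psd_pseudo_inverse[OF Z] by metis
  have c: "Z \<in> carrier_mat n n" "G \<in> carrier_mat n n" "E \<in> carrier_mat n n"
    using Z G(1,2) by (auto intro: psd_carrier)
  have YY: "Y * Y\<dagger> \<in> carrier_mat n n" using Y by (intro mult_carrier_mat[of _ n m]) auto
  define F where "F = (1\<^sub>m n - E) * Y"
  have Fc: "F \<in> carrier_mat n m" using Y c by (auto simp: F_def)
  have h: "(1\<^sub>m n - E)\<dagger> = 1\<^sub>m n - E" using psd_adjoint[OF G(3)] .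
  have "F = 0\<^sub>m n m"
  proof (rule gram_nonpos_eq_0[OF Fc])
    have Z0: "(1\<^sub>m n - E) * (Z * Z) = 0\<^sub>m n n"
    proof -
      have "(1\<^sub>m n - E) * (Z * Z) = Z * Z - E * (Z * Z)"
        using c by (simp add: minus_mult_distrib_mat[of _ n n _ _ n])
      also have "E * (Z * Z) = (E * Z) * Z" using c by (intro assoc_mult_mat[symmetric]) auto
      finally show ?thesis using c G(4) by auto
    qed
    have FF: "F * F\<dagger> = (1\<^sub>m n - E) * (Y * Y\<dagger>) * (1\<^sub>m n - E)\<dagger>"
      unfolding F_def using c Y by (intro gram_mult[of _ n n _ m]) auto
    have "(1\<^sub>m n - E) * (Z * Z - Y * Y\<dagger>) = (1\<^sub>m n - E) * (Z * Z) - (1\<^sub>m n - E) * (Y * Y\<dagger>)"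
      using c YY by (intro mult_minus_distrib_mat[of _ n n _ n]) auto
    then have "(1\<^sub>m n - E) * (Z * Z - Y * Y\<dagger>) * (1\<^sub>m n - E)\<dagger> = 0\<^sub>m n n - F * F\<dagger>"
      unfolding FF Z0 using c YY
        minus_mult_distrib_mat[of "0\<^sub>m n n" n n "(1\<^sub>m n - E) * (Y * Y\<dagger>)" "(1\<^sub>m n - E)\<dagger>" n]
        left_mult_zero_mat[of "(1\<^sub>m n - E)\<dagger>" n n n]
      by simp
    moreover have "psd n ((1\<^sub>m n - E) * (Z * Z - Y * Y\<dagger>) * (1\<^sub>m n - E)\<dagger>)"
      using c by (intro psd_congruence[OF le]) auto
    ultimately show "psd n (0\<^sub>m n n - F * F\<dagger>)" by simp
  qed
  moreover have "F = Y - E * Y"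
    unfolding F_def using c Y by (simp add: minus_mult_distrib_mat[of _ n n _ _ m])
  ultimately have YE: "Y - E * Y = 0\<^sub>m n m" by simp
  have "Y $$ (i, j) = (E * Y) $$ (i, j)" if "i < n" "j < m" for i j
    using arg_cong[OF YE, of "\<lambda>M. M $$ (i, j)"] that c Y by simp
  then have EY: "E * Y = Y" using c Y by (intro eq_matI) auto
  define C where "C = G * Y"
  have Cc: "C \<in> carrier_mat n m" using c Y by (auto simp: C_def)
  have ZC: "Y = Z * C"
    using EY c Y G(7) by (simp add: C_def assoc_mult_mat[of _ n n _ n _ m, symmetric])
  have CC: "C * C\<dagger> = G * (Y * Y\<dagger>) * G"
    unfolding C_def using gram_mult[OF c(2) Y] psd_adjoint[OF G(1)] by simp
  have "G * (Z * Z - Y * Y\<dagger>) * G\<dagger> = E - C * C\<dagger>"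
    unfolding CC using c YY G(6) psd_adjoint[OF G(1)]
    by (simp add: mult_minus_distrib_mat[of _ n n _ n] minus_mult_distrib_mat[of _ n n _ _ n])
  then have "psd n (E - C * C\<dagger>)" using psd_congruence[OF le c(2)] by simp
  from psd_add[OF G(3) this] have "psd n ((1\<^sub>m n - E) + (E - C * C\<dagger>))" .
  moreover have "(1\<^sub>m n - E) + (E - C * C\<dagger>) = 1\<^sub>m n - C * C\<dagger>"
    using c Cc by (intro eq_matI) auto
  moreover have "mat_trace (C\<dagger> * Y) = mat_trace Z" if eq: "Y * Y\<dagger> = Z * Z"
  proof -
    have "C\<dagger> * Y = Y\<dagger> * (G * Y)"
      unfolding C_def adjoint_mult[OF c(2) Y] psd_adjoint[OF G(1)]
      using c Y by (intro assoc_mult_mat[of _ m n _ n _ m]) auto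
    also have "mat_trace \<dots> = mat_trace (G * Y * Y\<dagger>)"
      using c Y by (intro mat_trace_comm[of _ m n]) auto
    also have "G * Y * Y\<dagger> = G * (Y * Y\<dagger>)"
      using c Y by (intro assoc_mult_mat[of _ n n _ m _ n]) auto
    finally show ?thesis using eq G(5) by simp
  qed
  ultimately show thesis using that[OF Cc ZC] by simp
qed

text \<open>The trace norm is defined by \<open>X\<dagger> X\<close>, while the matrix at hand is
  \<open>X X\<dagger>\<close>. With \<open>G\<close> the pseudo-inverse of \<open>Z\<close>, the
  matrix \<open>X\<dagger> G X\<close> is the positive root of \<open>X\<dagger> X\<close>, and
  cyclicity of the trace moves it back to \<open>G Z Z = Z\<close>.\<close>

lemma trace_norm_eq:
  assumes X: "X \<in> carrier_mat n n" and Z: "psd n Z" and eq: "X * X\<dagger> = Z * Z"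
  shows "trace_norm X = Re (mat_trace Z)"
proof -
  have Zc: "Z \<in> carrier_mat n n" using Z by (rule psd_carrier)
  have "psd n (Z * Z - X * X\<dagger>)"
    unfolding eq using Zc by (auto simp: psd_iff_qform qform_minus[of _ n])
  then obtain C where C: "C \<in> carrier_mat n n" "X = Z * C" "mat_trace (C\<dagger> * X) = mat_trace Z"
    "psd n (1\<^sub>m n - C * C\<dagger>)"
    using psd_factor_contraction[OF Z X] eq by metis
  obtain G E where G: "psd n G" "psd n E" "psd n (1\<^sub>m n - E)" "E * Z = Z" "G * (Z * Z) = Z"
    "G * (Z * Z) * G = E" "Z * G = E" "E * E = E"
    using psd_pseudo_inverse[OF Z] by metis
  have c: "G \<in> carrier_mat n n" "E \<in> carrier_mat n n"
    using G(1,2) by (auto intro: psd_carrier)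
  have EX: "E * X = X"
    using C(1,2) c Zc G(4) by (simp add: assoc_mult_mat[of _ n n _ n _ n, symmetric])
  define T where "T = X\<dagger> * G * X"
  have "psd n T" unfolding T_def using psd_congruence[OF G(1), of "X\<dagger>" n] X by simp
  moreover have "T * T = X\<dagger> * X"
  proof -
    have "T * T = X\<dagger> * ((G * (X * X\<dagger>) * G) * X)"
      unfolding T_def using X c by (simp add: assoc_mult_mat[of _ n n _ n _ n])
    then show ?thesis unfolding eq G(6) EX .
  qed
  ultimately have "psd_sqrt (X\<dagger> * X) = T" by (rule psd_sqrt_eqI)
  moreover have "mat_trace T = mat_trace Z"
  proof -
    have "mat_trace T = mat_trace (X\<dagger> * (G * X))"
      unfolding T_def using X c by (simp add: assoc_mult_mat[of _ n n _ n _ n])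
    also have "\<dots> = mat_trace (G * X * X\<dagger>)"
      using X c by (intro mat_trace_comm) auto
    also have "G * X * X\<dagger> = G * (Z * Z)"
      unfolding eq[symmetric] using X c by (intro assoc_mult_mat) auto
    finally show ?thesis using G(5) by simp
  qed
  ultimately show ?thesis by (simp add: trace_norm_def)
qed

text \<open>In the eigenbasis of \<open>Z\<close>, each diagonal entry of
  \<open>D C\<dagger>\<close> has real part at most 1, because the rows of a contraction have norm
  at most 1; the eigenvalues of \<open>Z\<close> are the weights.\<close>

lemma trace_mult_contractions_le:
  assumes Z: "psd n Z" and C: "C \<in> carrier_mat n m" "psd n (1\<^sub>m n - C * C\<dagger>)"
    and D: "D \<in> carrier_mat n m" "psd n (1\<^sub>m n - D * D\<dagger>)"
  shows "Re (mat_trace (Z * (D * C\<dagger>))) \<le> Re (mat_trace Z)"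
proof -
  obtain U f where U: "unitary n U" "\<And>k. 0 \<le> f k" "Z = spectral_mat n U f"
    using psd_spectral[OF Z] by metis
  note Uc = unitary_carrier[OF U(1)]
  have diag: "Re ((U\<dagger> * B * (U\<dagger> * B)\<dagger>) $$ (k, k)) \<le> 1"
    if k: "k < n" and B: "B \<in> carrier_mat n m" "psd n (1\<^sub>m n - B * B\<dagger>)" for k B
  proof -
    have BB: "B * B\<dagger> \<in> carrier_mat n n" using B by (intro mult_carrier_mat[of _ n m]) auto
    have "U\<dagger> * (1\<^sub>m n - B * B\<dagger>) * (U\<dagger>)\<dagger> = U\<dagger> * U - U\<dagger> * (B * B\<dagger>) * U"
      using Uc BB by (simp add: mult_minus_distrib_mat[of _ n n _ n] minus_mult_distrib_mat[of _ n n _ _ n])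
    also have "\<dots> = 1\<^sub>m n - U\<dagger> * B * (U\<dagger> * B)\<dagger>"
      using U(1) Uc B by (simp add: unitary_def gram_mult[of _ n n _ m])
    finally have "psd n (1\<^sub>m n - U\<dagger> * B * (U\<dagger> * B)\<dagger>)"
      using psd_congruence[OF B(2), of "U\<dagger>" n] Uc by simp
    from psd_diag_nonneg[OF this k] show ?thesis
      using k Uc B BB by (auto simp: less_eq_complex_def)
  qed
  have DC: "D * C\<dagger> \<in> carrier_mat n n" using C D by (intro mult_carrier_mat[of _ n m]) auto
  have entry: "Re ((U\<dagger> * (D * C\<dagger>) * U) $$ (k, k)) \<le> 1" if k: "k < n" for k
  proof -
    have "U\<dagger> * (D * C\<dagger>) * U = (U\<dagger> * D) * (C\<dagger> * U)"
    proof -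
      have "U\<dagger> * (D * C\<dagger>) * U = U\<dagger> * (D * C\<dagger> * U)"
        using Uc DC by (intro assoc_mult_mat[of _ n n _ n _ n]) auto
      also have "D * C\<dagger> * U = D * (C\<dagger> * U)"
        using C D Uc by (intro assoc_mult_mat[of _ n m _ n _ n]) auto
      also have "U\<dagger> * \<dots> = (U\<dagger> * D) * (C\<dagger> * U)"
        using C D Uc by (intro assoc_mult_mat[of _ n n _ m _ n, symmetric]) auto
      finally show ?thesis .
    qed
    also have "C\<dagger> * U = (U\<dagger> * C)\<dagger>" using Uc C by (simp add: adjoint_mult[of "U\<dagger>" n n])
    finally have "2 * Re ((U\<dagger> * (D * C\<dagger>) * U) $$ (k, k)) \<le>
        Re ((U\<dagger> * D * (U\<dagger> * D)\<dagger>) $$ (k, k)) + Re ((U\<dagger> * C * (U\<dagger> * C)\<dagger>) $$ (k, k))"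
      using adjoint_mult_self_diag_le[of "U\<dagger> * D" n m "U\<dagger> * C" k] Uc C D k
      by (simp add: mult_carrier_mat[of _ n n _ m])
    also have "\<dots> \<le> 2" using diag[OF k C] diag[OF k D] by simp
    finally show ?thesis by simp
  qed
  have "Re (mat_trace (Z * (D * C\<dagger>))) = (\<Sum>k<n. f k * Re ((U\<dagger> * (D * C\<dagger>) * U) $$ (k, k)))"
    unfolding U(3) mat_trace_spectral_mult[OF U(1) DC] by simp
  also have "\<dots> \<le> (\<Sum>k<n. f k * 1)" by (intro sum_mono mult_left_mono entry) (auto simp: U(2))
  also have "\<dots> = Re (mat_trace Z)" unfolding U(3) mat_trace_spectral[OF U(1)] by simp
  finally show ?thesis .
qed

subsection \<open>Uhlmann's theorem\<close>

lemma trace_adjoint_mult_swap: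
  assumes "R \<in> carrier_mat n n" "R\<dagger> = R" "C \<in> carrier_mat n m" "W \<in> carrier_mat n m"
  shows "mat_trace ((R * C)\<dagger> * W) = mat_trace (C\<dagger> * (R * W))"
  unfolding adjoint_mult[OF assms(1,3)] assms(2)
  using assms by (subst assoc_mult_mat[of _ m n _ n _ m]) auto

context
  fixes n m :: nat and \<rho> W :: "complex mat"
  assumes psd: "psd n \<rho>" and W: "W \<in> carrier_mat n m"
begin

private definition "R = psd_sqrt \<rho>"
private definition "Z = psd_sqrt (R * W * (R * W)\<dagger>)"

private lemma R: "psd n R" "R * R = \<rho>" "R \<in> carrier_mat n n" "R\<dagger> = R"
  using psd_sqrt[OF psd] psd_carrier psd_adjoint by (auto simp: R_def)

private lemma RW: "R * W \<in> carrier_mat n m"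
  using R(3) W by (rule mult_carrier_mat)

private lemma Z: "psd n Z" "Z * Z = R * W * (R * W)\<dagger>" "Z \<in> carrier_mat n n"
  using psd_sqrt[OF psd_gram[OF RW]] psd_carrier by (auto simp: Z_def)

text \<open>With \<open>S\<close> the root of \<open>W W\<dagger>\<close>, both \<open>R * S\<close>
  and \<open>R * W\<close> have Gram matrix \<open>Z * Z\<close>. Any factor of the state, also a
  rectangular one, thus serves in place of its square root.\<close>

private lemma sqrt_fidelity: "trace_norm (psd_sqrt \<rho> * psd_sqrt (W * W\<dagger>)) = Re (mat_trace Z)"
proof -
  define S where "S = psd_sqrt (W * W\<dagger>)"
  have S: "S \<in> carrier_mat n n" "S\<dagger> = S" "S * S = W * W\<dagger>"
    using psd_sqrt[OF psd_gram[OF W]] psd_carrier psd_adjoint by (auto simp: S_def)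
  have "R * S * (R * S)\<dagger> = Z * Z"
    using gram_mult[OF R(3) S(1)] gram_mult[OF R(3) W] S(2,3) Z(2) by simp
  then show ?thesis
    using trace_norm_eq[of "R * S" n Z] R(3) S(1) Z(1) by (simp add: R_def S_def)
qed

private lemma ZY: "psd n (Z * Z - R * W * (R * W)\<dagger>)"
  unfolding Z(2)[symmetric] using Z(3) by (auto simp: psd_iff_qform qform_minus[of _ n])

text \<open>Factoring \<open>P = R C\<close> and \<open>R W = Z D\<close> through contractions turns
  the overlap into the trace of \<open>Z D C\<dagger>\<close>, which is at most the trace of
  \<open>Z\<close>.\<close>

lemma trace_le_sqrt_fidelity:
  assumes P: "P \<in> carrier_mat n m" "psd n (\<rho> - P * P\<dagger>)"
  shows "Re (mat_trace (P\<dagger> * W)) \<le> trace_norm (psd_sqrt \<rho> * psd_sqrt (W * W\<dagger>))"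
proof -
  obtain C where C: "C \<in> carrier_mat n m" "P = R * C" "psd n (1\<^sub>m n - C * C\<dagger>)"
    using psd_factor_contraction[OF R(1) P(1)] P(2) R(2) by metis
  obtain D where D: "D \<in> carrier_mat n m" "R * W = Z * D" "psd n (1\<^sub>m n - D * D\<dagger>)"
    using psd_factor_contraction[OF Z(1) RW ZY] by metis
  have "mat_trace (P\<dagger> * W) = mat_trace (C\<dagger> * (Z * D))"
    unfolding C(2) D(2)[symmetric] by (rule trace_adjoint_mult_swap) (use R C W in auto)
  also have "\<dots> = mat_trace (Z * D * C\<dagger>)"
    using C(1) D(1) Z(3) by (intro mat_trace_comm[of _ m n]) auto
  also have "Z * D * C\<dagger> = Z * (D * C\<dagger>)"
    using C(1) D(1) Z(3) by (intro assoc_mult_mat[of _ n n _ m _ n]) auto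
  finally show ?thesis
    using trace_mult_contractions_le[OF Z(1) C(1,3) D(1,3)] sqrt_fidelity by simp
qed

text \<open>The optimal factor is \<open>P = R D\<close>, with \<open>D\<close> the polar factor of
  \<open>R W = Z D\<close>; \<open>D D\<dagger> \<le> 1\<close> becomes
  \<open>P P\<dagger> \<le> \<rho>\<close> after compression by \<open>R\<close>.\<close>

lemma sqrt_fidelity_attained:
  obtains P where "P \<in> carrier_mat n m" "psd n (\<rho> - P * P\<dagger>)"
    "Re (mat_trace (P\<dagger> * W)) = trace_norm (psd_sqrt \<rho> * psd_sqrt (W * W\<dagger>))"
proof -
  obtain D where D: "D \<in> carrier_mat n m" "psd n (1\<^sub>m n - D * D\<dagger>)"
    "mat_trace (D\<dagger> * (R * W)) = mat_trace Z"
    using psd_factor_contraction[OF Z(1) RW ZY] Z(2) by metis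
  have DD: "D * D\<dagger> \<in> carrier_mat n n" using D by (intro mult_carrier_mat[of _ n m]) auto
  have "R * (1\<^sub>m n - D * D\<dagger>) * R\<dagger> = \<rho> - R * D * (R * D)\<dagger>"
    unfolding gram_mult[OF R(3) D(1)] using R DD
    by (simp add: mult_minus_distrib_mat[of _ n n _ n] minus_mult_distrib_mat[of _ n n _ _ n])
  then have "psd n (\<rho> - R * D * (R * D)\<dagger>)" using psd_congruence[OF D(2) R(3)] by simp
  moreover have "Re (mat_trace ((R * D)\<dagger> * W)) = trace_norm (psd_sqrt \<rho> * psd_sqrt (W * W\<dagger>))"
    using trace_adjoint_mult_swap[OF R(3,4) D(1) W] D(3) sqrt_fidelity by simp
  ultimately show thesis using that[of "R * D"] R(3) D(1) by auto
qed

lemma sqrt_fidelity_nonneg: "0 \<le> trace_norm (psd_sqrt \<rho> * psd_sqrt (W * W\<dagger>))"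
  unfolding sqrt_fidelity mat_trace_def
  using psd_diag_nonneg[OF Z(1)] Z(3) by (auto simp: less_eq_complex_def intro!: sum_nonneg)

end

subsection \<open>Caratheodory reduction\<close>

text \<open>Gaussian elimination on the last coordinate: a pivot vector \<open>j\<close> clears it
  from the others, to which the induction hypothesis applies.\<close>

lemma linear_dependence:
  fixes a :: "'k \<Rightarrow> nat \<Rightarrow> real"
  assumes "finite K" "D < card K"
  shows "\<exists>c. (\<exists>k\<in>K. c k \<noteq> 0) \<and> (\<forall>e<D. (\<Sum>k\<in>K. c k * a k e) = 0)"
  using assms
proof (induction D arbitrary: K a)
  case 0
  then show ?case by (intro exI[of _ "\<lambda>_. 1"]) (auto simp: card_gt_0_iff)
next
  case (Suc D)
  show ?case
  proof (cases "\<forall>k\<in>K. a k D = 0")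
    case True
    have "D < card K" using Suc.prems by simp
    then obtain c where "\<exists>k\<in>K. c k \<noteq> 0" "\<forall>e<D. (\<Sum>k\<in>K. c k * a k e) = 0"
      using Suc.IH[OF Suc.prems(1), of a] by auto
    then show ?thesis using True by (intro exI[of _ c]) (auto simp: less_Suc_eq)
  next
    case False
    then obtain j where j: "j \<in> K" "a j D \<noteq> 0" by auto
    define b where "b k e = a k e - a k D / a j D * a j e" for k e
    have "D < card (K - {j})" using Suc.prems j by simp
    then obtain c where c: "\<exists>k\<in>K - {j}. c k \<noteq> 0" "\<forall>e<D. (\<Sum>k\<in>K - {j}. c k * b k e) = 0"
      using Suc.IH[of "K - {j}" b] Suc.prems by auto
    \<comment> \<open>The coefficient of the pivot is fixed by the requirement that coordinate
      \<open>D\<close> cancels.\<close>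
    define c' where "c' k = (if k = j then - (\<Sum>k\<in>K - {j}. c k * a k D) / a j D else c k)" for k
    have split: "(\<Sum>k\<in>K. c' k * a k e) = c' j * a j e + (\<Sum>k\<in>K - {j}. c k * a k e)" for e
      using j(1) Suc.prems(1) by (simp add: sum.remove c'_def)
    have "(\<Sum>k\<in>K. c' k * a k e) = 0" if "e < Suc D" for e
    proof (cases "e = D")
      case True
      then show ?thesis unfolding split using j by (simp add: c'_def)
    next
      case False
      then have "0 = (\<Sum>k\<in>K - {j}. c k * b k e)" using c(2) that by simp
      also have "\<dots> = (\<Sum>k\<in>K - {j}. c k * a k e) - (\<Sum>k\<in>K - {j}. c k * a k D) / a j D * a j e"
        unfolding b_def by (simp add: algebra_simps sum_subtractf sum_distrib_left sum_divide_distrib)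
      finally show ?thesis unfolding split by (simp add: c'_def)
    qed
    moreover have "\<exists>k\<in>K. c' k \<noteq> 0" using c(1) by (auto simp: c'_def)
    ultimately show ?thesis by blast
  qed
qed

text \<open>Caratheodory's theorem for cones, where no affine condition adds to the bound
  \<open>D\<close>. While more than \<open>D\<close> coefficients are nonzero, they are moved along
  a linear dependence until one of them vanishes.\<close>

lemma conic_caratheodory:
  fixes a :: "'k \<Rightarrow> nat \<Rightarrow> real"
  assumes "finite K" "\<And>k. k \<in> K \<Longrightarrow> 0 \<le> b k"
  shows "\<exists>c. (\<forall>k\<in>K. 0 \<le> c k) \<and> card {k \<in> K. c k \<noteq> 0} \<le> D \<and>
    (\<forall>e<D. (\<Sum>k\<in>K. c k * a k e) = (\<Sum>k\<in>K. b k * a k e))"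
  using assms(2)
proof (induction "card {k \<in> K. b k \<noteq> 0}" arbitrary: b rule: less_induct)
  case less
  define S where "S = {k \<in> K. b k \<noteq> 0}"
  show ?case
  proof (cases "card S \<le> D")
    case True
    then show ?thesis using less.prems by (intro exI[of _ b]) (auto simp: S_def)
  next
    case False
    have S: "finite S" "S \<subseteq> K" using assms(1) by (auto simp: S_def)
    obtain x0 where x0: "\<exists>k\<in>S. x0 k \<noteq> 0" "\<forall>e<D. (\<Sum>k\<in>S. x0 k * a k e) = 0"
      using linear_dependence[OF S(1), of D a] False by auto
    \<comment> \<open>A dependence without positive coefficient is negated.\<close>
    obtain x where x: "\<exists>k\<in>S. 0 < x k" "\<forall>e<D. (\<Sum>k\<in>S. x k * a k e) = 0"
    proof (cases "\<exists>k\<in>S. 0 < x0 k")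
      case True
      then show ?thesis using x0(2) that by blast
    next
      case False
      then show ?thesis using x0 by (intro that[of "\<lambda>k. - x0 k"]) (force simp: sum_negf)+
    qed
    define R where "R = (\<lambda>k. b k / x k) ` {k \<in> S. 0 < x k}"
    have R: "finite R" "R \<noteq> {}" using S(1) x(1) by (auto simp: R_def)
    \<comment> \<open>The largest step that keeps all coefficients nonnegative; the index where the
      minimum is attained drops out of the support.\<close>
    define t where "t = Min R"
    obtain k0 where k0: "k0 \<in> S" "0 < x k0" "t = b k0 / x k0"
      using Min_in[OF R] by (auto simp: R_def t_def)
    have t0: "0 \<le> t" using k0 less.prems S by auto
    define b' where "b' k = (if k \<in> S then b k - t * x k else 0)" for k
    have b'0: "0 \<le> b' k" if "k \<in> K" for k
    proof (cases "k \<in> S \<and> 0 < x k")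
      case True
      then have "t \<le> b k / x k" using R(1) by (auto simp: t_def R_def intro!: Min_le)
      then show ?thesis using True by (simp add: b'_def pos_le_divide_eq)
    next
      case False
      then have "k \<in> S \<Longrightarrow> t * x k \<le> 0" using t0 by (auto simp: mult_nonneg_nonpos)
      then show ?thesis using less.prems[OF that] by (auto simp: b'_def)
    qed
    have "{k \<in> K. b' k \<noteq> 0} \<subset> S"
    proof
      show "{k \<in> K. b' k \<noteq> 0} \<subseteq> S" by (auto simp: b'_def split: if_splits)
      have "b' k0 = 0" using k0 by (simp add: b'_def)
      then show "{k \<in> K. b' k \<noteq> 0} \<noteq> S" using k0(1) by blast
    qed
    then have "card {k \<in> K. b' k \<noteq> 0} < card {k \<in> K. b k \<noteq> 0}"
      using S(1) by (simp add: psubset_card_mono flip: S_def)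
    from less.hyps[OF this b'0] obtain c where c: "\<forall>k\<in>K. 0 \<le> c k" "card {k \<in> K. c k \<noteq> 0} \<le> D"
      "\<forall>e<D. (\<Sum>k\<in>K. c k * a k e) = (\<Sum>k\<in>K. b' k * a k e)"
      by blast
    have "(\<Sum>k\<in>K. b' k * a k e) = (\<Sum>k\<in>K. b k * a k e)" if "e < D" for e
    proof -
      have "(\<Sum>k\<in>K. b' k * a k e) = (\<Sum>k\<in>S. b' k * a k e)"
        using S assms(1) by (intro sum.mono_neutral_right) (auto simp: b'_def)
      also have "\<dots> = (\<Sum>k\<in>S. b k * a k e) - t * (\<Sum>k\<in>S. x k * a k e)"
        by (simp add: b'_def left_diff_distrib sum_subtractf sum_distrib_left mult.assoc)
      also have "\<dots> = (\<Sum>k\<in>S. b k * a k e)" using x(2) that by simp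
      also have "\<dots> = (\<Sum>k\<in>K. b k * a k e)"
        using S assms(1) by (intro sum.mono_neutral_left) (auto simp: S_def)
      finally show ?thesis .
    qed
    then show ?thesis using c by (intro exI[of _ c]) auto
  qed
qed

text \<open>For a nonzero column this bounds the largest squared modulus of the normalised column by
  \<open>t\<close>. The homogeneous form admits zero columns, survives rescaling of columns, and is
  a closed condition on \<open>W\<close> and \<open>t\<close> together.\<close>

definition flat_cols :: "real \<Rightarrow> complex mat \<Rightarrow> bool" where
  "flat_cols t W \<longleftrightarrow> (\<forall>k<dim_col W. \<forall>i<dim_row W.
     (cmod (W $$ (i, k)))\<^sup>2 \<le> t * (\<Sum>j<dim_row W. (cmod (W $$ (j, k)))\<^sup>2))"

text \<open>Every Gram decomposition can be thinned out to \<open>2d\<^sup>2\<close> columns, the real dimension of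
  \<^term>\<open>carrier_mat d d\<close>; this confines all decompositions to a compact set.\<close>

definition flat_gram :: "nat \<Rightarrow> real \<Rightarrow> complex mat \<Rightarrow> bool" where
  "flat_gram d t \<omega> \<longleftrightarrow> (\<exists>W\<in>carrier_mat d (2 * d * d). flat_cols t W \<and> \<omega> = W * W\<dagger>)"

lemma gram_index:
  assumes "W \<in> carrier_mat d N" "i < d" "j < d"
  shows "(W * W\<dagger>) $$ (i, j) = (\<Sum>k<N. W $$ (i, k) * cnj (W $$ (j, k)))"
  using assms mult_index[of W d N "W\<dagger>" d i j] by (auto intro!: sum.cong)

text \<open>The Gram matrix is a conic combination of the rank-one matrices of the columns.
  Caratheodory's theorem replaces it by one with few terms, whose new weights are absorbed into the
  columns; rescaling does not disturb flatness.\<close>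

lemma flat_gramI:
  assumes W: "W \<in> carrier_mat d N" "flat_cols t W"
  shows "flat_gram d t (W * W\<dagger>)"
proof -
  define D where "D = 2 * d * d"
  \<comment> \<open>Real coordinates of the rank-one matrix of column \<open>k\<close>: index
    \<open>e\<close> encodes the entry by \<open>e div 2\<close> and its real or imaginary part by
    parity.\<close>
  define a where "a k e = (if even e then Re else Im)
    (W $$ (e div 2 div d, k) * cnj (W $$ (e div 2 mod d, k)))" for k e
  obtain c where c: "\<forall>k\<in>{..<N}. 0 \<le> c k" "card {k \<in> {..<N}. c k \<noteq> 0} \<le> D"
    "\<forall>e<D. (\<Sum>k<N. c k * a k e) = (\<Sum>k<N. 1 * a k e)"
    using conic_caratheodory[of "{..<N}" "\<lambda>_. 1" D a] by auto
  define S where "S = {k \<in> {..<N}. c k \<noteq> 0}"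
  obtain h where h: "bij_betw h {..<card S} S"
    using ex_bij_betw_nat_finite[of S] by (auto simp: S_def atLeast0LessThan)
  have hS: "h k \<in> S" if "k < card S" for k using h that by (auto simp: bij_betw_def)
  \<comment> \<open>The surviving columns come first; zero columns fill up to exactly
    \<open>D\<close>.\<close>
  define V where "V = mat d D (\<lambda>(i, k). if k < card S then complex_of_real (sqrt (c (h k))) * W $$ (i, h k) else 0)"
  have V: "V \<in> carrier_mat d D" by (simp add: V_def)
  have flat: "flat_cols t V"
    unfolding flat_cols_def
  proof (intro allI impI)
    fix k i assume "k < dim_col V" "i < dim_row V"
    then have ki: "k < D" "i < d" using V by auto
    show "(cmod (V $$ (i, k)))\<^sup>2 \<le> t * (\<Sum>j<dim_row V. (cmod (V $$ (j, k)))\<^sup>2)"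
    proof (cases "k < card S")
      case True
      have hk: "h k < N" "0 \<le> c (h k)" using hS[OF True] c(1) by (auto simp: S_def)
      have sq: "(cmod (V $$ (j, k)))\<^sup>2 = c (h k) * (cmod (W $$ (j, h k)))\<^sup>2" if "j < d" for j
        using that ki True hk by (simp add: V_def norm_mult power_mult_distrib)
      have "(cmod (W $$ (i, h k)))\<^sup>2 \<le> t * (\<Sum>j<d. (cmod (W $$ (j, h k)))\<^sup>2)"
        using W ki hk by (auto simp: flat_cols_def)
      from mult_left_mono[OF this hk(2)] show ?thesis
        using ki V by (simp add: sq sum_distrib_left mult_ac)
    next
      case False
      then show ?thesis using ki V by (simp add: V_def)
    qed
  qed
  have "W * W\<dagger> = V * V\<dagger>"
  proof (rule eq_matI)
    fix i j assume "i < dim_row (V * V\<dagger>)" "j < dim_col (V * V\<dagger>)"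
    then have ij: "i < d" "j < d" using V by auto
    define w where "w k = W $$ (i, k) * cnj (W $$ (j, k))" for k
    define e where "e = 2 * (i * d + j)"
    have "i * d + j < Suc i * d" using ij by simp
    also have "\<dots> \<le> d * d" using ij by (intro mult_right_mono) auto
    finally have e: "e < D" "Suc e < D" by (auto simp: e_def D_def)
    have ae: "a k e = Re (w k)" "a k (Suc e) = Im (w k)" for k
      using ij by (auto simp: a_def e_def w_def)
    have re: "(\<Sum>k<N. c k * Re (w k)) = (\<Sum>k<N. Re (w k))"
      using c(3)[rule_format, OF e(1)] by (simp add: ae)
    have im: "(\<Sum>k<N. c k * Im (w k)) = (\<Sum>k<N. Im (w k))"
      using c(3)[rule_format, OF e(2)] by (simp add: ae)
    have "(V * V\<dagger>) $$ (i, j) = (\<Sum>k<D. V $$ (i, k) * cnj (V $$ (j, k)))"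
      by (rule gram_index[OF V ij])
    also have "\<dots> = (\<Sum>k<card S. V $$ (i, k) * cnj (V $$ (j, k)))"
      using c(2) ij by (intro sum.mono_neutral_right) (auto simp: V_def S_def)
    also have "\<dots> = (\<Sum>k<card S. complex_of_real (c (h k)) * w (h k))"
    proof (intro sum.cong refl)
      fix k assume "k \<in> {..<card S}"
      then have k: "k < card S" by simp
      then have "k < D" "0 \<le> c (h k)" using c(1,2) hS[OF k] by (auto simp: S_def)
      then have "complex_of_real (sqrt (c (h k))) * complex_of_real (sqrt (c (h k))) = complex_of_real (c (h k))"
        by (simp flip: of_real_mult)
      then show "V $$ (i, k) * cnj (V $$ (j, k)) = complex_of_real (c (h k)) * w (h k)"
        using k \<open>k < D\<close> ij by (simp add: V_def w_def mult_ac)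
    qed
    also have "\<dots> = (\<Sum>k\<in>S. complex_of_real (c k) * w k)"
      by (rule sum.reindex_bij_betw[OF h])
    also have "\<dots> = (\<Sum>k<N. complex_of_real (c k) * w k)"
      by (intro sum.mono_neutral_left) (auto simp: S_def)
    also have "\<dots> = (\<Sum>k<N. w k)" using re im by (simp add: complex_eq_iff)
    finally show "(W * W\<dagger>) $$ (i, j) = (V * V\<dagger>) $$ (i, j)"
      using gram_index[OF W(1) ij] by (simp add: w_def)
  qed (use W(1) V in auto)
  then show ?thesis unfolding flat_gram_def using V flat by (auto simp: D_def)
qed

subsection \<open>Pure-state decompositions as Gram decompositions\<close>

lemma linf_norm_square_le_iff:
  assumes "unit_ket d \<psi>"
  shows "(linf_norm \<psi>)\<^sup>2 \<le> t \<longleftrightarrow> (\<forall>i<d. (cmod (\<psi> $ i))\<^sup>2 \<le> t)"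
proof -
  \<comment> \<open>A unit ket forces \<open>d > 0\<close>; otherwise \<open>Max\<close> would range
    over the empty set.\<close>
  have dim: "dim_vec \<psi> = d" "d > 0" using assms by (auto simp: unit_ket_def l2_norm_def intro: Nat.gr0I)
  have fin: "finite ((\<lambda>i. cmod (\<psi> $ i)) ` {..<d})" "(\<lambda>i. cmod (\<psi> $ i)) ` {..<d} \<noteq> {}"
    using dim by auto
  obtain i0 where i0: "i0 < d" "linf_norm \<psi> = cmod (\<psi> $ i0)"
    using Max_in[OF fin] dim by (auto simp: linf_norm_def)
  have "cmod (\<psi> $ i) \<le> linf_norm \<psi>" if "i < d" for i
    using Max_ge[OF fin(1)] that dim by (auto simp: linf_norm_def)
  then have "(cmod (\<psi> $ i))\<^sup>2 \<le> (linf_norm \<psi>)\<^sup>2" if "i < d" for i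
    using that by (simp add: power_mono)
  then show ?thesis using i0 by (metis order_trans)
qed

lemma linf_norm_nonneg: "unit_ket d \<psi> \<Longrightarrow> 0 \<le> linf_norm \<psi>"
proof -
  assume "unit_ket d \<psi>"
  then have dim: "dim_vec \<psi> = d" "d > 0" by (auto simp: unit_ket_def l2_norm_def intro: Nat.gr0I)
  have "0 \<le> cmod (\<psi> $ 0)" by simp
  also have "\<dots> \<le> linf_norm \<psi>" using dim by (auto simp: linf_norm_def intro!: Max_ge)
  finally show ?thesis .
qed

lemma linf_norm_le_iff:
  assumes "unit_ket d \<psi>"
  shows "linf_norm \<psi> \<le> 1 / sqrt (real m) \<longleftrightarrow> (\<forall>i<d. (cmod (\<psi> $ i))\<^sup>2 \<le> 1 / real m)"
proof -
  have "linf_norm \<psi> \<le> 1 / sqrt (real m) \<longleftrightarrow> (linf_norm \<psi>)\<^sup>2 \<le> (1 / sqrt (real m))\<^sup>2"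
    using linf_norm_nonneg[OF assms] by (simp add: abs_le_square_iff[symmetric])
  also have "(1 / sqrt (real m))\<^sup>2 = 1 / real m" by (simp add: power_divide)
  finally show ?thesis using linf_norm_square_le_iff[OF assms] by simp
qed

lemma unit_ket_sum: "unit_ket d \<psi> \<longleftrightarrow> \<psi> \<in> carrier_vec d \<and> (\<Sum>i<d. (cmod (\<psi> $ i))\<^sup>2) = 1"
  by (auto simp: unit_ket_def l2_norm_def)

text \<open>The square roots make the Gram matrix the mixture itself and the squared column norms
  the weights.\<close>

definition ket_mat :: "nat \<Rightarrow> nat \<Rightarrow> (nat \<Rightarrow> real) \<Rightarrow> (nat \<Rightarrow> complex vec) \<Rightarrow> complex mat" where
  "ket_mat d N p \<psi> = mat d N (\<lambda>(i, k). complex_of_real (sqrt (p k)) * \<psi> k $ i)"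

lemma ket_mat_carrier [simp]: "ket_mat d N p \<psi> \<in> carrier_mat d N"
  by (simp add: ket_mat_def)

lemma mat_comb_ket_bra:
  assumes "\<And>k. k < N \<Longrightarrow> 0 \<le> p k" "\<And>k. k < N \<Longrightarrow> \<psi> k \<in> carrier_vec d"
    "\<And>k. k < N \<Longrightarrow> A k = ket_bra (\<psi> k)"
  shows "mat_comb d N p A = ket_mat d N p \<psi> * (ket_mat d N p \<psi>)\<dagger>"
proof (rule eq_matI)
  fix i j assume "i < dim_row (ket_mat d N p \<psi> * (ket_mat d N p \<psi>)\<dagger>)"
    "j < dim_col (ket_mat d N p \<psi> * (ket_mat d N p \<psi>)\<dagger>)"
  then have ij: "i < d" "j < d" by (auto simp: ket_mat_def)
  have dim: "dim_vec (\<psi> k) = d" if "k < N" for k using assms(2)[OF that] by auto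
  have "mat_comb d N p A $$ (i, j) = (\<Sum>k<N. complex_of_real (p k) * (\<psi> k $ i * cnj (\<psi> k $ j)))"
    using ij assms(3) dim by (auto simp: mat_comb_def mat_sum_def ket_bra_def intro!: sum.cong)
  also have "\<dots> = (\<Sum>k<N. ket_mat d N p \<psi> $$ (i, k) * cnj (ket_mat d N p \<psi> $$ (j, k)))"
  proof (intro sum.cong refl)
    fix k assume "k \<in> {..<N}"
    then have k: "k < N" by simp
    have "complex_of_real (p k) = complex_of_real (sqrt (p k)) * complex_of_real (sqrt (p k))"
      using assms(1)[OF k] by (simp flip: of_real_mult)
    then show "complex_of_real (p k) * (\<psi> k $ i * cnj (\<psi> k $ j)) =
        ket_mat d N p \<psi> $$ (i, k) * cnj (ket_mat d N p \<psi> $$ (j, k))"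
      using ij k by (simp add: ket_mat_def mult_ac)
  qed
  finally show "mat_comb d N p A $$ (i, j) = (ket_mat d N p \<psi> * (ket_mat d N p \<psi>)\<dagger>) $$ (i, j)"
    using gram_index[OF ket_mat_carrier ij] by simp
qed (auto simp: mat_comb_def mat_sum_def ket_mat_def)

lemma ket_mat_col_norm:
  assumes "unit_ket d (\<psi> k)" "0 \<le> p k" "k < N"
  shows "(\<Sum>i<d. (cmod (ket_mat d N p \<psi> $$ (i, k)))\<^sup>2) = p k"
  using assms by (simp add: ket_mat_def norm_mult power_mult_distrib unit_ket_sum flip: sum_distrib_left)

lemma flat_cols_ket_mat:
  assumes "\<And>k. k < N \<Longrightarrow> unit_ket d (\<psi> k)" "\<And>k. k < N \<Longrightarrow> 0 \<le> p k"
    "\<And>k. k < N \<Longrightarrow> (linf_norm (\<psi> k))\<^sup>2 \<le> t"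
  shows "flat_cols t (ket_mat d N p \<psi>)"
  unfolding flat_cols_def
proof (intro allI impI)
  fix k i assume "k < dim_col (ket_mat d N p \<psi>)" "i < dim_row (ket_mat d N p \<psi>)"
  then have ki: "k < N" "i < d" by (auto simp: ket_mat_def)
  have "(cmod (\<psi> k $ i))\<^sup>2 \<le> t"
    using linf_norm_square_le_iff[OF assms(1)[OF ki(1)]] assms(3)[OF ki(1)] ki(2) by blast
  from mult_left_mono[OF this assms(2)[OF ki(1)]]
  show "(cmod (ket_mat d N p \<psi> $$ (i, k)))\<^sup>2 \<le> t * (\<Sum>j<dim_row (ket_mat d N p \<psi>). (cmod (ket_mat d N p \<psi> $$ (j, k)))\<^sup>2)"
    using ki ket_mat_col_norm[of d \<psi> k p N] assms(1,2)[OF ki(1)]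
    by (simp add: ket_mat_def norm_mult power_mult_distrib mult_ac)
qed

text \<open>A zero column receives weight zero and the ket of some nonzero column.\<close>

lemma gram_pure_decomposition:
  assumes W: "W \<in> carrier_mat d N" and tr: "mat_trace (W * W\<dagger>) = 1"
  obtains p \<psi> where "pure_decomposition d (W * W\<dagger>) N p \<psi>"
    "\<And>k. k < N \<Longrightarrow> p k = (\<Sum>i<d. (cmod (W $$ (i, k)))\<^sup>2)"
    "\<And>k i. k < N \<Longrightarrow> i < d \<Longrightarrow> W $$ (i, k) = complex_of_real (sqrt (p k)) * \<psi> k $ i"
    "\<And>t k. flat_cols t W \<Longrightarrow> k < N \<Longrightarrow> (linf_norm (\<psi> k))\<^sup>2 \<le> t"
proof -
  define p where "p k = (\<Sum>i<d. (cmod (W $$ (i, k)))\<^sup>2)" for k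
  have p0: "0 \<le> p k" for k by (simp add: p_def sum_nonneg)
  have "complex_of_real (\<Sum>k<N. p k) = 1"
    using tr mat_trace_gram[OF W] by (simp add: p_def)
  then have p1: "(\<Sum>k<N. p k) = 1" by (simp only: of_real_eq_1_iff)
  then obtain k0 where k0: "k0 < N" "p k0 \<noteq> 0"
    by (metis lessThan_iff sum.neutral zero_neq_one)
  define j where "j k = (if p k = 0 then k0 else k)" for k
  have j: "j k < N" "0 < p (j k)" if "k < N" for k
    using that k0 p0[of "j k"] by (auto simp: j_def)
  define \<psi> where "\<psi> k = vec d (\<lambda>i. W $$ (i, j k) / complex_of_real (sqrt (p (j k))))" for k
  have sq: "(cmod (\<psi> k $ i))\<^sup>2 = (cmod (W $$ (i, j k)))\<^sup>2 / p (j k)" if "k < N" "i < d" for k i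
    using that j(2)[OF that(1)] by (simp add: \<psi>_def norm_divide power_divide)
  have unit: "unit_ket d (\<psi> k)" if "k < N" for k
    unfolding unit_ket_sum using sq[OF that] j(2)[OF that]
    by (simp add: \<psi>_def[of k] p_def flip: sum_divide_distrib)
  have Wp: "W $$ (i, k) = complex_of_real (sqrt (p k)) * \<psi> k $ i" if "k < N" "i < d" for k i
  proof (cases "p k = 0")
    case True
    then have "W $$ (i, k) = 0" using that by (auto simp: p_def sum_nonneg_eq_0_iff)
    then show ?thesis using True by simp
  next
    case False
    then show ?thesis using that by (simp add: \<psi>_def j_def)
  qed
  have Wk: "W = ket_mat d N p \<psi>" using W Wp by (intro eq_matI) (auto simp: ket_mat_def)
  show thesis
  proof (rule that[of p \<psi>])
    show "pure_decomposition d (W * W\<dagger>) N p \<psi>"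
      unfolding pure_decomposition_def prob_weights_def
      using p0 p1 unit mat_comb_ket_bra[of N p \<psi> d "\<lambda>k. ket_bra (\<psi> k)"] Wk
      by (auto simp: unit_ket_sum)
    fix t k assume t: "flat_cols t W" and k: "k < N"
    have "(cmod (W $$ (i, j k)))\<^sup>2 \<le> t * p (j k)" if "i < d" for i
      using t j(1)[OF k] that W by (auto simp: flat_cols_def p_def)
    then show "(linf_norm (\<psi> k))\<^sup>2 \<le> t"
      unfolding linf_norm_square_le_iff[OF unit[OF k]]
      using sq[OF k] j(2)[OF k] by (simp add: pos_divide_le_eq)
  next
    show "p k = (\<Sum>i<d. (cmod (W $$ (i, k)))\<^sup>2)" for k by (rule p_def)
  qed (rule Wp)
qed

lemma density_gram:
  assumes "W \<in> carrier_mat d N" "mat_trace (W * W\<dagger>) = 1"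
  shows "W * W\<dagger> \<in> density d"
  using assms psd_gram by (auto simp: density_def)

lemma flat_gram_density: "flat_gram d t \<omega> \<Longrightarrow> mat_trace \<omega> = 1 \<Longrightarrow> \<omega> \<in> density d"
  using density_gram by (auto simp: flat_gram_def)

lemma mat_trace_ket_mat:
  assumes "prob_weights N p" "\<And>k. k < N \<Longrightarrow> unit_ket d (\<psi> k)"
  shows "mat_trace (ket_mat d N p \<psi> * (ket_mat d N p \<psi>)\<dagger>) = 1"
  unfolding mat_trace_gram[OF ket_mat_carrier]
  using assms by (auto simp: prob_weights_def ket_mat_col_norm)

text \<open>Replaces convex combinations of arbitrary length by a factor with a fixed number of
  columns, the form needed for compactness.\<close>

lemma flat_states_iff:
  "\<omega> \<in> flat_states d m \<longleftrightarrow> mat_trace \<omega> = 1 \<and> flat_gram d (1 / real m) \<omega>"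
proof
  assume "\<omega> \<in> flat_states d m"
  then obtain N p A where \<omega>: "\<omega> = mat_comb d N p A" "prob_weights N p"
    "\<forall>k<N. A k \<in> {ket_bra \<omega> | \<omega>. unit_ket d \<omega> \<and> linf_norm \<omega> \<le> 1 / sqrt (real m)}"
    by (auto simp: flat_states_def mat_conv_def)
  then have "\<forall>k<N. \<exists>v. A k = ket_bra v \<and> unit_ket d v \<and> linf_norm v \<le> 1 / sqrt (real m)" by auto
  then obtain v where v: "\<And>k. k < N \<Longrightarrow> A k = ket_bra (v k)" "\<And>k. k < N \<Longrightarrow> unit_ket d (v k)"
    "\<And>k. k < N \<Longrightarrow> linf_norm (v k) \<le> 1 / sqrt (real m)"
    by metis
  have p: "\<And>k. k < N \<Longrightarrow> 0 \<le> p k" using \<omega>(2) by (auto simp: prob_weights_def)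
  have W: "\<omega> = ket_mat d N p v * (ket_mat d N p v)\<dagger>"
    unfolding \<omega>(1) using p v by (intro mat_comb_ket_bra) (auto simp: unit_ket_def)
  have "(linf_norm (v k))\<^sup>2 \<le> 1 / real m" if "k < N" for k
    using v(2,3)[OF that] linf_norm_square_le_iff linf_norm_le_iff by blast
  then have "flat_cols (1 / real m) (ket_mat d N p v)"
    using v p by (intro flat_cols_ket_mat) auto
  then show "mat_trace \<omega> = 1 \<and> flat_gram d (1 / real m) \<omega>"
    unfolding W using mat_trace_ket_mat[of N p d v] \<omega>(2) v(2) flat_gramI[OF ket_mat_carrier] by blast
next
  assume "mat_trace \<omega> = 1 \<and> flat_gram d (1 / real m) \<omega>"
  then obtain W where W: "W \<in> carrier_mat d (2 * d * d)" "flat_cols (1 / real m) W" "\<omega> = W * W\<dagger>"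
    "mat_trace (W * W\<dagger>) = 1"
    by (auto simp: flat_gram_def)
  obtain p \<psi> where p: "pure_decomposition d (W * W\<dagger>) (2 * d * d) p \<psi>"
    "\<And>k. k < 2 * d * d \<Longrightarrow> (linf_norm (\<psi> k))\<^sup>2 \<le> 1 / real m"
    using gram_pure_decomposition[OF W(1,4)] W(2) by metis
  have "linf_norm (\<psi> k) \<le> 1 / sqrt (real m)" if "k < 2 * d * d" for k
  proof -
    have "unit_ket d (\<psi> k)" using p(1) that by (auto simp: pure_decomposition_def)
    then show ?thesis using p(2)[OF that] linf_norm_le_iff linf_norm_square_le_iff by blast
  qed
  then show "\<omega> \<in> flat_states d m"
    unfolding flat_states_def mat_conv_def W(3)
    using p(1) by (auto simp: pure_decomposition_def intro!: exI[of _ "2 * d * d"] exI[of _ p]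
        exI[of _ "\<lambda>k. ket_bra (\<psi> k)"])
qed

lemma theta_values_flat_gram:
  assumes "x \<in> theta_values d \<omega>"
  shows "flat_gram d x \<omega>"
proof -
  obtain N p \<psi> where x: "x = Max ((\<lambda>i. (linf_norm (\<psi> i))\<^sup>2) ` {..<N})"
    and p: "prob_weights N p" "\<And>k. k < N \<Longrightarrow> unit_ket d (\<psi> k)" "\<omega> = mat_comb d N p (\<lambda>k. ket_bra (\<psi> k))"
    using assms by (auto simp: theta_values_def pure_decomposition_def)
  have p0: "\<And>k. k < N \<Longrightarrow> 0 \<le> p k" using p(1) by (auto simp: prob_weights_def)
  have "\<omega> = ket_mat d N p \<psi> * (ket_mat d N p \<psi>)\<dagger>"
    unfolding p(3) using p(2) p0 by (intro mat_comb_ket_bra) (auto simp: unit_ket_def)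
  moreover have "flat_cols x (ket_mat d N p \<psi>)"
    using p p0 by (intro flat_cols_ket_mat) (auto simp: x)
  ultimately show ?thesis using flat_gramI[OF ket_mat_carrier] by metis
qed

text \<open>Only an inequality can be had in this direction, since the columns of a factor may be
  flatter than the bound \<open>t\<close> demands.\<close>

lemma flat_gram_theta_values:
  assumes "flat_gram d t \<omega>" "mat_trace \<omega> = 1"
  obtains x where "x \<in> theta_values d \<omega>" "x \<le> t"
proof -
  obtain W where W: "W \<in> carrier_mat d (2 * d * d)" "flat_cols t W" "\<omega> = W * W\<dagger>"
    "mat_trace (W * W\<dagger>) = 1"
    using assms by (auto simp: flat_gram_def)
  obtain p \<psi> where p: "pure_decomposition d (W * W\<dagger>) (2 * d * d) p \<psi>"
    "\<And>k. k < 2 * d * d \<Longrightarrow> (linf_norm (\<psi> k))\<^sup>2 \<le> t"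
    using gram_pure_decomposition[OF W(1,4)] W(2) by metis
  \<comment> \<open>The maximum over the kets has to be over a nonempty set.\<close>
  have "2 * d * d \<noteq> 0"
    using p(1) by (cases "d = 0") (auto simp: pure_decomposition_def prob_weights_def)
  then have "Max ((\<lambda>i. (linf_norm (\<psi> i))\<^sup>2) ` {..<2 * d * d}) \<le> t"
    using p(2) by (subst Max_le_iff) (auto simp: lessThan_empty_iff)
  then show thesis using p(1) W(3) by (intro that) (auto simp: theta_values_def)
qed

subsection \<open>Fidelity and compactness\<close>

lemma qform_gram:
  assumes "P \<in> carrier_mat n m"
  shows "qform n (P * P\<dagger>) v = complex_of_real (\<Sum>k<m. (cmod (\<Sum>i<n. cnj (v i) * P $$ (i, k)))\<^sup>2)"
proof -
  have "qform n (P * P\<dagger>) v = (\<Sum>i<n. \<Sum>j<n. \<Sum>k<m. cnj (v i) * P $$ (i, k) * (cnj (P $$ (j, k)) * v j))"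
    using assms by (auto simp: qform_def gram_index sum_distrib_left sum_distrib_right mult_ac intro!: sum.cong)
  also have "\<dots> = (\<Sum>i<n. \<Sum>k<m. \<Sum>j<n. cnj (v i) * P $$ (i, k) * (cnj (P $$ (j, k)) * v j))"
    by (intro sum.cong refl sum.swap)
  also have "\<dots> = (\<Sum>k<m. \<Sum>i<n. \<Sum>j<n. cnj (v i) * P $$ (i, k) * (cnj (P $$ (j, k)) * v j))"
    by (rule sum.swap)
  also have "\<dots> = (\<Sum>k<m. (\<Sum>i<n. cnj (v i) * P $$ (i, k)) * cnj (\<Sum>j<n. cnj (v j) * P $$ (j, k)))"
    unfolding sum_product cnj_sum by (simp add: mult_ac)
  finally show ?thesis by (simp add: complex_norm_square del: of_real_power)
qed

text \<open>Rewrites the operator inequality as a family of scalar inequalities, one per test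
  vector, each visibly closed in the entries of \<open>P\<close>.\<close>

lemma psd_minus_gram_iff:
  assumes "psd n \<rho>" "P \<in> carrier_mat n m"
  shows "psd n (\<rho> - P * P\<dagger>) \<longleftrightarrow>
    (\<forall>v. (\<Sum>k<m. (cmod (\<Sum>i<n. cnj (v i) * P $$ (i, k)))\<^sup>2) \<le> Re (qform n \<rho> v))"
proof -
  have c: "\<rho> \<in> carrier_mat n n" "P * P\<dagger> \<in> carrier_mat n n"
    using assms psd_carrier psd_gram by auto
  have "Im (qform n \<rho> v) = 0" for v
    using assms(1) by (auto simp: psd_iff_qform less_eq_complex_def)
  then show ?thesis
    using c by (auto simp: psd_iff_qform qform_minus[OF c] qform_gram[OF assms(2)] less_eq_complex_def)
qed

lemma mat_trace_adjoint_mult: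
  assumes "P \<in> carrier_mat n m" "W \<in> carrier_mat n m"
  shows "Re (mat_trace (P\<dagger> * W)) = (\<Sum>k<m. \<Sum>i<n. Re (cnj (P $$ (i, k)) * W $$ (i, k)))"
  using assms by (simp add: mat_trace_mult[of "P\<dagger>" m n W])

lemma fidelity_gram_ge:
  assumes "psd n \<rho>" "W \<in> carrier_mat n m" "P \<in> carrier_mat n m" "psd n (\<rho> - P * P\<dagger>)"
    "0 \<le> c" "c \<le> Re (mat_trace (P\<dagger> * W))"
  shows "c\<^sup>2 \<le> fidelity \<rho> (W * W\<dagger>)"
  unfolding fidelity_def using assms trace_le_sqrt_fidelity[OF assms(1-4)] by (intro power_mono) auto

lemma fidelity_gram_attained:
  assumes "psd n \<rho>" "W \<in> carrier_mat n m"
  obtains P where "P \<in> carrier_mat n m" "psd n (\<rho> - P * P\<dagger>)"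
    "Re (mat_trace (P\<dagger> * W)) = sqrt (fidelity \<rho> (W * W\<dagger>))"
  using sqrt_fidelity_attained[OF assms] sqrt_fidelity_nonneg[OF assms] unfolding fidelity_def
  by (metis real_sqrt_abs abs_of_nonneg)

lemma fidelity_nonneg: "0 \<le> fidelity \<rho> \<omega>"
  by (simp add: fidelity_def)

lemma densityD: "\<rho> \<in> density d \<Longrightarrow> psd d \<rho>" "\<rho> \<in> density d \<Longrightarrow> mat_trace \<rho> = 1"
  by (simp_all add: density_def)

lemma density_dim_pos: "\<rho> \<in> density d \<Longrightarrow> 0 < d"
  by (rule Nat.gr0I) (auto simp: density_def mat_trace_def dest!: psd_carrier)

lemma density_diag_le_1:
  assumes "\<rho> \<in> density d" "i < d"
  shows "Re (\<rho> $$ (i, i)) \<le> 1"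
proof -
  note d = densityD[OF assms(1)] psd_carrier[OF densityD(1)[OF assms(1)]]
  have "Re (\<rho> $$ (i, i)) \<le> (\<Sum>j<d. Re (\<rho> $$ (j, j)))"
    using assms(2) psd_diag_nonneg[OF d(1)]
    by (intro member_le_sum) (auto simp: less_eq_complex_def)
  also have "\<dots> = 1" using d(2,3) by (simp add: mat_trace_def flip: Re_sum)
  finally show ?thesis .
qed

text \<open>The squared norm of row \<open>i\<close> of \<open>P\<close> is a diagonal entry of
  \<open>P P\<dagger>\<close>, hence at most that of \<open>\<rho>\<close>. This confines all
  factors to a product of unit discs.\<close>

lemma sub_density_entry_le_1:
  assumes "\<rho> \<in> density d" "P \<in> carrier_mat d N" "psd d (\<rho> - P * P\<dagger>)" "i < d" "k < N"
  shows "cmod (P $$ (i, k)) \<le> 1"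
proof -
  note c = psd_carrier[OF densityD(1)[OF assms(1)]]
  have "(cmod (P $$ (i, k)))\<^sup>2 \<le> (\<Sum>l<N. (cmod (P $$ (i, l)))\<^sup>2)"
    using assms(5) by (intro member_le_sum) auto
  also have "\<dots> = Re ((P * P\<dagger>) $$ (i, i))"
    unfolding gram_index[OF assms(2,4,4)] complex_norm_square[symmetric] by simp
  also have "\<dots> \<le> Re (\<rho> $$ (i, i))"
    using psd_diag_nonneg[OF assms(3,4)] c assms(2,4) by (simp add: less_eq_complex_def)
  also have "\<dots> \<le> 1" by (rule density_diag_le_1[OF assms(1,4)])
  finally show ?thesis by (simp add: abs_square_le_1)
qed

section \<open>The compact set of candidate triples\<close>

lemma psd_diff_self: "A \<in> carrier_mat n n \<Longrightarrow> psd n (A - A)"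
  by (simp add: psd_iff_qform qform_def)

text \<open>Entries of \<open>W\<close>, entries of \<open>P\<close>, and the flatness bound. As
  functions on index pairs the entries carry the product topology.\<close>

type_synonym candidate = "(nat \<times> nat \<Rightarrow> complex) \<times> (nat \<times> nat \<Rightarrow> complex) \<times> real"

text \<open>Entries with indices outside the matrix are merely kept in the unit disc, so that the
  ambient box is compact on all index pairs.\<close>

definition feasible ::
  "nat \<Rightarrow> complex mat \<Rightarrow> candidate set" where
  "feasible d \<rho> = {(f, g, t). (\<forall>x. cmod (f x) \<le> 1) \<and> (\<forall>x. cmod (g x) \<le> 1) \<and> t \<in> {0..1} \<and>
     mat_trace (mat d (2 * d * d) f * (mat d (2 * d * d) f)\<dagger>) = 1 \<and>
     flat_cols t (mat d (2 * d * d) f) \<and>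
     psd d (\<rho> - mat d (2 * d * d) g * (mat d (2 * d * d) g)\<dagger>)}"

lemma continuous_on_coordinate [continuous_intros]:
  fixes f :: "'a::topological_space \<Rightarrow> 'b \<Rightarrow> 'c::topological_space"
  shows "continuous_on S f \<Longrightarrow> continuous_on S (\<lambda>x. f x i)"
  by (rule continuous_on_product_then_coordinatewise)

text \<open>Tychonoff's theorem.\<close>

lemma compact_function_box:
  fixes B :: "'a \<Rightarrow> 'b::topological_space set"
  assumes "\<And>x. compact (B x)"
  shows "compact {f. \<forall>x. f x \<in> B x}"
proof -
  have "compactin (product_topology (\<lambda>_. euclidean) UNIV) (Pi\<^sub>E UNIV B)"
    using assms by (simp add: compactin_PiE)
  moreover have "Pi\<^sub>E UNIV B = {f. \<forall>x. f x \<in> B x}" by (auto simp: PiE_def)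
  ultimately show ?thesis by (simp add: euclidean_product_topology)
qed

lemma compact_unit_disc: "compact {z. cmod z \<le> 1}"
proof -
  define sq where "sq = (\<lambda>p. complex_of_real (fst p) + \<i> * complex_of_real (snd p)) ` ({-1..1} \<times> {-1..1})"
  have "compact sq"
    unfolding sq_def by (intro compact_continuous_image continuous_intros compact_Times compact_Icc)
  moreover have sq: "z \<in> sq" if "cmod z \<le> 1" for z
    unfolding sq_def
  proof (rule image_eqI)
    show "(Re z, Im z) \<in> {-1..1} \<times> {-1..1}"
      using that abs_Re_le_cmod[of z] abs_Im_le_cmod[of z] by auto
  qed (simp add: complex_eq)
  have "{z. cmod z \<le> 1} = sq \<inter> {z. cmod z \<le> 1}" by (auto simp: sq)
  moreover have "closed {z. cmod z \<le> 1}" by (intro closed_Collect_le continuous_intros)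
  ultimately show ?thesis using compact_Int_closed by metis
qed

text \<open>Inside the compact box, unit trace (\<open>C1\<close>), flatness (\<open>C2\<close>) and
  \<open>P P\<dagger> \<le> \<rho>\<close> (\<open>C3\<close>, one condition per test vector) are
  intersections of closed sets.\<close>

lemma compact_feasible:
  assumes "psd d \<rho>"
  shows "compact (feasible d \<rho>)"
proof -
  define N where "N = 2 * d * d"
  define B where "B = {f :: nat \<times> nat \<Rightarrow> complex. \<forall>x. f x \<in> {z. cmod z \<le> 1}}"
  define C1 where "C1 = {x :: candidate.
    (\<Sum>k<N. \<Sum>i<d. (cmod (fst x (i, k)))\<^sup>2) = 1}"
  define C2 where "C2 i k = {x :: candidate.
    (cmod (fst x (i, k)))\<^sup>2 \<le> snd (snd x) * (\<Sum>j<d. (cmod (fst x (j, k)))\<^sup>2)}" for i k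
  define C3 where "C3 v = {x :: candidate.
    (\<Sum>k<N. (cmod (\<Sum>i<d. cnj (v i) * fst (snd x) (i, k)))\<^sup>2) \<le> Re (qform d \<rho> v)}" for v
  have B: "compact B" unfolding B_def by (intro compact_function_box compact_unit_disc)
  have "closed C1" "closed (C2 i k)" "closed (C3 v)" for i k v
    unfolding C1_def C2_def C3_def
    by (intro closed_Collect_eq closed_Collect_le continuous_intros)+
  then have "closed (C1 \<inter> (\<Inter>i\<in>{..<d}. \<Inter>k\<in>{..<N}. C2 i k) \<inter> (\<Inter>v. C3 v))"
    by (intro closed_Int closed_INT ballI) auto
  moreover have "compact (B \<times> B \<times> {0..1::real})" using B by (intro compact_Times) auto
  ultimately have "compact ((B \<times> B \<times> {0..1}) \<inter> (C1 \<inter> (\<Inter>i\<in>{..<d}. \<Inter>k\<in>{..<N}. C2 i k) \<inter> (\<Inter>v. C3 v)))"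
    by (intro compact_Int_closed)
  also have "(B \<times> B \<times> {0..1}) \<inter> (C1 \<inter> (\<Inter>i\<in>{..<d}. \<Inter>k\<in>{..<N}. C2 i k) \<inter> (\<Inter>v. C3 v)) = feasible d \<rho>"
  proof (rule Set.set_eqI)
    fix x :: candidate
    obtain f g t where x: "x = (f, g, t)" by (cases x)
    have 1: "mat_trace (mat d N f * (mat d N f)\<dagger>) = 1 \<longleftrightarrow> x \<in> C1"
      by (simp add: mat_trace_gram[of _ d N] C1_def x flip: of_real_power of_real_sum)
    have 2: "flat_cols t (mat d N f) \<longleftrightarrow> (\<forall>i<d. \<forall>k<N. x \<in> C2 i k)"
      by (auto simp: flat_cols_def C2_def x)
    have 3: "psd d (\<rho> - mat d N g * (mat d N g)\<dagger>) \<longleftrightarrow> (\<forall>v. x \<in> C3 v)"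
      using psd_minus_gram_iff[OF assms, of "mat d N g" N] by (simp add: C3_def x)
    show "x \<in> (B \<times> B \<times> {0..1}) \<inter> (C1 \<inter> (\<Inter>i\<in>{..<d}. \<Inter>k\<in>{..<N}. C2 i k) \<inter> (\<Inter>v. C3 v)) \<longleftrightarrow> x \<in> feasible d \<rho>"
      using 1 2 3 unfolding x feasible_def N_def[symmetric] by (auto simp: B_def simp del: split_paired_All)
  qed
  finally show ?thesis .
qed

text \<open>Extension by 0 outside the dimensions keeps the bound by 1 valid at every index
  pair.\<close>

definition entries :: "complex mat \<Rightarrow> nat \<times> nat \<Rightarrow> complex" where
  "entries W x = (if fst x < dim_row W \<and> snd x < dim_col W then W $$ x else 0)"

lemma mat_entries: "W \<in> carrier_mat d N \<Longrightarrow> mat d N (entries W) = W"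
  by (rule eq_matI) (auto simp: entries_def)

lemma flat_cols_pos:
  assumes "flat_cols t W" "W \<in> carrier_mat d N" "mat_trace (W * W\<dagger>) = 1"
  shows "0 < t"
proof (rule ccontr)
  assume "\<not> 0 < t"
  have "W $$ (i, k) = 0" if "i < d" "k < N" for i k
  proof -
    have "(cmod (W $$ (i, k)))\<^sup>2 \<le> t * (\<Sum>j<d. (cmod (W $$ (j, k)))\<^sup>2)"
      using assms(1,2) that by (auto simp: flat_cols_def)
    also have "\<dots> \<le> 0" using \<open>\<not> 0 < t\<close> by (intro mult_nonpos_nonneg sum_nonneg) auto
    finally show ?thesis by simp
  qed
  then show False using assms(3) by (simp add: mat_trace_gram[OF assms(2)])
qed

lemma flat_cols_mono:
  assumes "flat_cols s W" "s \<le> t"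
  shows "flat_cols t W"
  unfolding flat_cols_def
proof (intro allI impI)
  fix k i assume "k < dim_col W" "i < dim_row W"
  then have "(cmod (W $$ (i, k)))\<^sup>2 \<le> s * (\<Sum>j<dim_row W. (cmod (W $$ (j, k)))\<^sup>2)"
    using assms(1) by (simp add: flat_cols_def)
  also have "\<dots> \<le> t * (\<Sum>j<dim_row W. (cmod (W $$ (j, k)))\<^sup>2)"
    using assms(2) by (intro mult_right_mono sum_nonneg) auto
  finally show "(cmod (W $$ (i, k)))\<^sup>2 \<le> t * (\<Sum>j<dim_row W. (cmod (W $$ (j, k)))\<^sup>2)" .
qed

lemma flat_cols_1: "flat_cols 1 W"
  unfolding flat_cols_def by (auto intro!: member_le_sum)

lemma flat_gram_mono: "flat_gram d s \<omega> \<Longrightarrow> s \<le> t \<Longrightarrow> flat_gram d t \<omega>"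
  using flat_cols_mono by (auto simp: flat_gram_def)

lemma flat_gram_pos: "flat_gram d t \<omega> \<Longrightarrow> mat_trace \<omega> = 1 \<Longrightarrow> 0 < t"
  using flat_cols_pos by (auto simp: flat_gram_def)

lemma density_flat_gram_1:
  assumes "\<omega> \<in> density d"
  shows "flat_gram d 1 \<omega>"
proof -
  note psd = densityD(1)[OF assms]
  have "\<omega> = psd_sqrt \<omega> * (psd_sqrt \<omega>)\<dagger>"
    using psd_sqrt[OF psd] psd_adjoint by metis
  then show ?thesis
    using flat_gramI[OF psd_carrier[OF psd_sqrt(1)[OF psd]] flat_cols_1] by metis
qed

lemma feasibleI:
  assumes \<rho>: "\<rho> \<in> density d" and W: "W \<in> carrier_mat d (2 * d * d)" "flat_cols t W" "mat_trace (W * W\<dagger>) = 1"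
    and P: "P \<in> carrier_mat d (2 * d * d)" "psd d (\<rho> - P * P\<dagger>)" and t: "t \<le> 1"
  shows "(entries W, entries P, t) \<in> feasible d \<rho>"
proof -
  have 1: "cmod (entries P x) \<le> 1" for x
    using sub_density_entry_le_1[OF \<rho> P] P(1) by (cases x) (auto simp: entries_def)
  have "psd d (W * W\<dagger> - W * W\<dagger>)" using psd_gram[OF W(1)] by (intro psd_diff_self psd_carrier)
  then have "cmod (entries W x) \<le> 1" for x
    using sub_density_entry_le_1[OF density_gram[OF W(1,3)] W(1)] W(1) by (cases x) (auto simp: entries_def)
  then show ?thesis
    using 1 W P t flat_cols_pos[OF W(2,1,3)] by (simp add: feasible_def mat_entries)
qed

text \<open>The zero matrix is an admissible \<open>P\<close>, a placeholder wherever only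
  \<open>W\<close> matters.\<close>

lemma psd_minus_zero_gram:
  assumes "psd n \<rho>"
  shows "psd n (\<rho> - 0\<^sub>m n m * (0\<^sub>m n m)\<dagger>)"
proof -
  have "0\<^sub>m n m * (0\<^sub>m n m)\<dagger> = (0\<^sub>m n n :: complex mat)"
    by (intro left_mult_zero_mat) auto
  then show ?thesis using assms psd_carrier[OF assms] by (simp add: psd_iff_qform qform_minus[of _ n]) (simp add: qform_def)
qed

lemma overlap_continuous:
  fixes S :: "candidate set"
  shows "continuous_on S (\<lambda>x. Re (mat_trace ((mat d N (fst (snd x)))\<dagger> * mat d N (fst x))))"
proof -
  have "Re (mat_trace ((mat d N g)\<dagger> * mat d N f)) = (\<Sum>k<N. \<Sum>i<d. Re (cnj (g (i, k)) * f (i, k)))" for f g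
    by (subst mat_trace_adjoint_mult[of _ d N]) auto
  then show ?thesis by (simp only:) (intro continuous_intros)
qed

text \<open>By Uhlmann's theorem the root fidelity of a flat state is the largest overlap of its
  factor with an admissible \<open>P\<close>, so maximising the overlap over both factors at once
  maximises the fidelity, and the overlap is continuous on a compact set.\<close>

lemma fidelity_flat_states_has_max:
  assumes \<rho>: "\<rho> \<in> density d" and m: "m \<in> {1..d}"
  shows "has_max (fidelity \<rho> ` flat_states d m)"
proof -
  define N where "N = 2 * d * d"
  note psd = densityD(1)[OF \<rho>]
  define ov where "ov x = Re (mat_trace ((mat d N (fst (snd x)))\<dagger> * mat d N (fst x)))"
    for x :: candidate
  define S where "S = feasible d \<rho> \<inter> {x. snd (snd x) = 1 / real m}"
  have "compact S" unfolding S_def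
    by (intro compact_Int_closed compact_feasible psd closed_Collect_eq continuous_intros)
  have inS: "(entries W, entries P, 1 / real m) \<in> S" "ov (entries W, entries P, 1 / real m) = Re (mat_trace (P\<dagger> * W))"
    if "W \<in> carrier_mat d N" "flat_cols (1 / real m) W" "mat_trace (W * W\<dagger>) = 1"
      "P \<in> carrier_mat d N" "psd d (\<rho> - P * P\<dagger>)" for W P
    using feasibleI[OF \<rho>, of W "1 / real m" P] that m
    by (auto simp: S_def ov_def N_def mat_entries)
  \<comment> \<open>The uniform unit vector as the only nonzero column is flat because
    \<open>1/d \<le> 1/m\<close>; here \<open>m \<le> d\<close> enters.\<close>
  define U where "U = mat d N (\<lambda>(i, k). if k = 0 then complex_of_real (1 / sqrt (real d)) else 0)"
  have U: "U \<in> carrier_mat d N" by (simp add: U_def)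
  have d: "0 < d" using m by auto
  then have N: "0 < N" by (simp add: N_def)
  have Usq: "(cmod (U $$ (i, k)))\<^sup>2 = (if k = 0 then 1 / real d else 0)" if "i < d" "k < N" for i k
    using that by (simp add: U_def norm_divide power_divide)
  have "flat_cols (1 / real m) U"
    using U d m Usq by (auto simp: flat_cols_def intro!: divide_left_mono)
  moreover have "mat_trace (U * U\<dagger>) = 1"
    using d N by (simp add: mat_trace_gram[OF U] Usq if_distrib[of "\<lambda>x. real d * x"]
        flip: of_real_power del: of_real_sum cong: if_cong)
  ultimately have "S \<noteq> {}" using inS(1)[OF U _ _ zero_carrier_mat psd_minus_zero_gram[OF psd]] by blast
  then obtain x where x: "x \<in> S" "\<And>y. y \<in> S \<Longrightarrow> ov y \<le> ov x"
    using continuous_attains_sup[OF \<open>compact S\<close> _ overlap_continuous[of S d N]] unfolding ov_def by blast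
  define W P where "W = mat d N (fst x)" and "P = mat d N (fst (snd x))"
  have W: "W \<in> carrier_mat d N" "flat_cols (1 / real m) W" "mat_trace (W * W\<dagger>) = 1"
    and P: "P \<in> carrier_mat d N" "psd d (\<rho> - P * P\<dagger>)"
    using x(1) by (auto simp: S_def feasible_def W_def P_def N_def)
  have mem: "W * W\<dagger> \<in> flat_states d m"
    unfolding flat_states_iff using W flat_gramI by blast
  have "fidelity \<rho> \<omega> \<le> fidelity \<rho> (W * W\<dagger>)" if \<omega>: "\<omega> \<in> flat_states d m" for \<omega>
  proof -
    obtain V where V: "V \<in> carrier_mat d N" "flat_cols (1 / real m) V" "\<omega> = V * V\<dagger>" "mat_trace (V * V\<dagger>) = 1"
      using \<omega> by (auto simp: flat_states_iff flat_gram_def N_def)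
    obtain Q where Q: "Q \<in> carrier_mat d N" "psd d (\<rho> - Q * Q\<dagger>)"
      "Re (mat_trace (Q\<dagger> * V)) = sqrt (fidelity \<rho> (V * V\<dagger>))"
      using fidelity_gram_attained[OF psd V(1)] by metis
    have "sqrt (fidelity \<rho> \<omega>) \<le> ov x"
      using x(2)[OF inS(1)[OF V(1,2,4) Q(1,2)]] inS(2)[OF V(1,2,4) Q(1,2)] Q(3) V(3) by simp
    also have "ov x = Re (mat_trace (P\<dagger> * W))" by (simp add: ov_def W_def P_def)
    finally have "(sqrt (fidelity \<rho> \<omega>))\<^sup>2 \<le> fidelity \<rho> (W * W\<dagger>)"
      by (intro fidelity_gram_ge[OF psd W(1) P]) (simp_all add: fidelity_nonneg)
    then show ?thesis by (simp add: fidelity_nonneg)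
  qed
  then show ?thesis unfolding has_max_def using mem by blast
qed

text \<open>The flatness bound is itself a coordinate of a candidate, so it attains a minimum on the
  compact set of candidates whose \<open>W\<close> is a factor of \<open>\<omega>\<close>.\<close>

lemma theta_values_has_min:
  assumes "\<omega> \<in> density d"
  shows "has_min (theta_values d \<omega>)"
proof -
  define N where "N = 2 * d * d"
  note psd = densityD(1)[OF assms] and tr = densityD(2)[OF assms]
  note c = psd_carrier[OF psd]
  define C where "C i j = {x :: candidate.
    (\<Sum>k<N. fst x (i, k) * cnj (fst x (j, k))) = \<omega> $$ (i, j)}" for i j
  define S where "S = feasible d \<omega> \<inter> (\<Inter>i\<in>{..<d}. \<Inter>j\<in>{..<d}. C i j)"
  have "closed (C i j)" for i j
    unfolding C_def by (intro closed_Collect_eq continuous_intros)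
  then have "compact S" unfolding S_def
    by (intro compact_Int_closed compact_feasible psd closed_INT ballI)
  have C: "(\<forall>i<d. \<forall>j<d. (f, y) \<in> C i j) \<longleftrightarrow> mat d N f * (mat d N f)\<dagger> = \<omega>" for f y
  proof
    assume *: "\<forall>i<d. \<forall>j<d. (f, y) \<in> C i j"
    show "mat d N f * (mat d N f)\<dagger> = \<omega>"
      using c * by (intro eq_matI) (auto simp: gram_index[of _ d N] C_def)
  next
    assume *: "mat d N f * (mat d N f)\<dagger> = \<omega>"
    show "\<forall>i<d. \<forall>j<d. (f, y) \<in> C i j"
      unfolding C_def *[symmetric] by (auto simp: gram_index[of _ d N])
  qed
  have inS: "(entries W, entries (0\<^sub>m d N), t) \<in> S"
    if "W \<in> carrier_mat d N" "flat_cols t W" "\<omega> = W * W\<dagger>" "t \<le> 1" for W t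
  proof -
    have "\<forall>i<d. \<forall>j<d. (entries W, entries (0\<^sub>m d N), t) \<in> C i j"
      using that C by (simp add: mat_entries)
    moreover have "(entries W, entries (0\<^sub>m d N), t) \<in> feasible d \<omega>"
      using feasibleI[OF assms, of W t "0\<^sub>m d N"] that tr psd_minus_zero_gram[OF psd, of N]
      by (simp add: N_def)
    ultimately show ?thesis by (simp add: S_def)
  qed
  have "S \<noteq> {}" using density_flat_gram_1[OF assms] inS by (auto simp: flat_gram_def N_def)
  then have "\<exists>x\<in>S. \<forall>y\<in>S. snd (snd x) \<le> snd (snd y)"
    by (intro continuous_attains_inf \<open>compact S\<close> continuous_intros)
  then obtain x where x: "x \<in> S" "\<And>y. y \<in> S \<Longrightarrow> snd (snd x) \<le> snd (snd y)"
    by blast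
  have "flat_gram d (snd (snd x)) \<omega>"
    unfolding flat_gram_def
  proof (intro bexI conjI)
    show "\<omega> = mat d N (fst x) * (mat d N (fst x))\<dagger>"
      using x(1) C[of "fst x" "snd x"] by (simp add: S_def)
  qed (use x(1) in \<open>auto simp: S_def feasible_def N_def\<close>)
  then obtain y where y: "y \<in> theta_values d \<omega>" "y \<le> snd (snd x)"
    using flat_gram_theta_values[OF _ tr] by metis
  have "y \<le> z" if z: "z \<in> theta_values d \<omega>" for z
  \<comment> \<open>Candidates satisfy \<open>t \<le> 1\<close>; a larger value exceeds the minimum
    anyway.\<close>
  proof (cases "z \<le> 1")
    case True
    obtain W where W: "W \<in> carrier_mat d N" "flat_cols z W" "\<omega> = W * W\<dagger>"
      using theta_values_flat_gram[OF z] by (auto simp: flat_gram_def N_def)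
    from x(2)[OF inS[OF this True]] show ?thesis using y(2) by simp
  next
    case False
    moreover have "snd (snd x) \<le> 1" using x(1) by (auto simp: S_def feasible_def)
    ultimately show ?thesis using y(2) by simp
  qed
  then show ?thesis unfolding has_min_def using y(1) by blast
qed

section \<open>Attained extrema and the functional \<open>theta\<close>\<close>

lemma has_min_Inf:
  fixes S :: "real set"
  assumes "has_min S"
  shows "Inf S \<in> S" "x \<in> S \<Longrightarrow> Inf S \<le> x"
proof -
  obtain y where y: "y \<in> S" "\<forall>z\<in>S. y \<le> z" using assms by (auto simp: has_min_def)
  then have "Inf S = y" by (intro cInf_eq_minimum) auto
  then show "Inf S \<in> S" "x \<in> S \<Longrightarrow> Inf S \<le> x" using y by auto
qed

lemma has_max_Sup:
  fixes S :: "real set"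
  assumes "has_max S"
  shows "Sup S \<in> S" "x \<in> S \<Longrightarrow> x \<le> Sup S"
proof -
  obtain y where y: "y \<in> S" "\<forall>z\<in>S. z \<le> y" using assms by (auto simp: has_max_def)
  then have "Sup S = y" by (intro cSup_eq_maximum) auto
  then show "Sup S \<in> S" "x \<in> S \<Longrightarrow> x \<le> Sup S" using y by auto
qed

text \<open>Attainment of the minimum makes the left-to-right implication hold also at equality;
  comparisons of \<open>theta\<close> become statements about factors.\<close>

lemma theta_le_iff:
  assumes "\<omega> \<in> density d"
  shows "theta d \<omega> \<le> t \<longleftrightarrow> flat_gram d t \<omega>"
proof
  assume "theta d \<omega> \<le> t"
  then show "flat_gram d t \<omega>"
    using flat_gram_mono[OF theta_values_flat_gram] has_min_Inf(1)[OF theta_values_has_min[OF assms]]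
    unfolding theta_def by blast
next
  assume "flat_gram d t \<omega>"
  then obtain x where "x \<in> theta_values d \<omega>" "x \<le> t"
    using flat_gram_theta_values densityD(2)[OF assms] by metis
  then show "theta d \<omega> \<le> t"
    using has_min_Inf(2)[OF theta_values_has_min[OF assms]] unfolding theta_def by force
qed

text \<open>Membership in the ball means overlap at least the root of \<open>1 - \<epsilon>\<close>
  for some admissible \<open>P\<close>, a closed condition on candidates; the flatness coordinate is
  then minimised over state and decomposition jointly.\<close>

lemma theta_fidelity_ball_has_min:
  assumes \<rho>: "\<rho> \<in> density d" and \<epsilon>: "0 \<le> \<epsilon>"
  shows "has_min (theta d ` fidelity_ball d \<epsilon> \<rho>)"
proof -
  define N where "N = 2 * d * d"
  \<comment> \<open>The maximum with 0 covers \<open>\<epsilon> > 1\<close> and keeps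
    \<open>c\<close> nonnegative, as squaring the overlap bound requires.\<close>
  define c where "c = sqrt (max 0 (1 - \<epsilon>))"
  have c: "0 \<le> c" "c \<le> 1" "c\<^sup>2 = max 0 (1 - \<epsilon>)" using \<epsilon> by (auto simp: c_def)
  note psd = densityD(1)[OF \<rho>]
  define ov where "ov x = Re (mat_trace ((mat d N (fst (snd x)))\<dagger> * mat d N (fst x)))"
    for x :: candidate
  define S where "S = feasible d \<rho> \<inter> {x. c \<le> ov x}"
  have "continuous_on UNIV ov" unfolding ov_def by (rule overlap_continuous)
  then have "closed {x. c \<le> ov x}" by (intro closed_Collect_le continuous_on_const)
  then have "compact S" unfolding S_def by (intro compact_Int_closed compact_feasible psd)
  have inS: "(entries W, entries P, t) \<in> S"
    if "W \<in> carrier_mat d N" "flat_cols t W" "mat_trace (W * W\<dagger>) = 1"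
      "P \<in> carrier_mat d N" "psd d (\<rho> - P * P\<dagger>)" "t \<le> 1" "c \<le> Re (mat_trace (P\<dagger> * W))" for W P t
    using feasibleI[OF \<rho>, of W t P] that by (simp add: S_def ov_def N_def mat_entries)
  \<comment> \<open>The state \<open>\<rho>\<close> itself, with both factors equal, has overlap 1;
    \<open>0 \<le> \<epsilon>\<close> guarantees \<open>c \<le> 1\<close>.\<close>
  have "S \<noteq> {}"
  proof -
    obtain W where W: "W \<in> carrier_mat d N" "flat_cols 1 W" "\<rho> = W * W\<dagger>"
      using density_flat_gram_1[OF \<rho>] by (auto simp: flat_gram_def N_def)
    have "mat_trace (W\<dagger> * W) = mat_trace (W * W\<dagger>)" using W(1) by (intro mat_trace_comm) auto
    then have "Re (mat_trace (W\<dagger> * W)) = 1" using densityD(2)[OF \<rho>] W(3) by simp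
    moreover have "psd d (\<rho> - W * W\<dagger>)"
      using psd_diff_self[OF psd_carrier[OF psd]] W(3) by simp
    moreover have "mat_trace (W * W\<dagger>) = 1" using densityD(2)[OF \<rho>] W(3) by simp
    ultimately have "(entries W, entries W, 1) \<in> S" using W(1,2) c(2) by (intro inS) simp_all
    then show ?thesis by blast
  qed
  then have "\<exists>x\<in>S. \<forall>y\<in>S. snd (snd x) \<le> snd (snd y)"
    by (intro continuous_attains_inf \<open>compact S\<close> continuous_intros)
  then obtain x where x: "x \<in> S" "\<And>y. y \<in> S \<Longrightarrow> snd (snd x) \<le> snd (snd y)"
    by blast
  define W P where "W = mat d N (fst x)" and "P = mat d N (fst (snd x))"
  have W: "W \<in> carrier_mat d N" "flat_cols (snd (snd x)) W" "mat_trace (W * W\<dagger>) = 1"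
    and P: "P \<in> carrier_mat d N" "psd d (\<rho> - P * P\<dagger>)" "c \<le> Re (mat_trace (P\<dagger> * W))"
    using x(1) by (auto simp: S_def feasible_def W_def P_def N_def ov_def)
  have "c\<^sup>2 \<le> fidelity \<rho> (W * W\<dagger>)"
    by (rule fidelity_gram_ge[OF psd W(1) P(1,2) c(1) P(3)])
  then have mem: "W * W\<dagger> \<in> fidelity_ball d \<epsilon> \<rho>"
    using density_gram[OF W(1,3)] by (simp add: fidelity_ball_def c(3))
  have le: "theta d (W * W\<dagger>) \<le> snd (snd x)"
    using W flat_gramI by (simp add: theta_le_iff[OF density_gram[OF W(1,3)]])
  have "theta d (W * W\<dagger>) \<le> theta d \<omega>" if \<omega>: "\<omega> \<in> fidelity_ball d \<epsilon> \<rho>" for \<omega>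
  proof -
    have D: "\<omega> \<in> density d" and F: "1 - \<epsilon> \<le> fidelity \<rho> \<omega>" using \<omega> by (auto simp: fidelity_ball_def)
    obtain V where V: "V \<in> carrier_mat d N" "flat_cols (theta d \<omega>) V" "\<omega> = V * V\<dagger>"
      using theta_le_iff[OF D, of "theta d \<omega>"] by (auto simp: flat_gram_def N_def)
    have tr: "mat_trace (V * V\<dagger>) = 1" using densityD(2)[OF D] V(3) by simp
    obtain Q where Q: "Q \<in> carrier_mat d N" "psd d (\<rho> - Q * Q\<dagger>)"
      "Re (mat_trace (Q\<dagger> * V)) = sqrt (fidelity \<rho> (V * V\<dagger>))"
      using fidelity_gram_attained[OF psd V(1)] by metis
    have "c \<le> Re (mat_trace (Q\<dagger> * V))"
      unfolding Q(3) c_def using F fidelity_nonneg by (simp add: V(3)[symmetric])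
    moreover have "theta d \<omega> \<le> 1" using theta_le_iff[OF D] density_flat_gram_1[OF D] by simp
    ultimately have "snd (snd x) \<le> theta d \<omega>"
      using x(2)[OF inS[OF V(1,2) tr Q(1,2)]] by simp
    then show ?thesis using le by simp
  qed
  then show ?thesis unfolding has_min_def using mem by blast
qed

subsection \<open>Channels\<close>

lemma qform_mat_sum:
  assumes "\<And>l. l < N \<Longrightarrow> A l \<in> carrier_mat n n"
  shows "qform n (mat_sum n N A) v = (\<Sum>l<N. qform n (A l) v)"
proof -
  have "qform n (mat_sum n N A) v = (\<Sum>i<n. \<Sum>j<n. \<Sum>l<N. cnj (v i) * A l $$ (i, j) * v j)"
    by (simp add: qform_def mat_sum_def sum_distrib_left sum_distrib_right)
  also have "\<dots> = (\<Sum>i<n. \<Sum>l<N. \<Sum>j<n. cnj (v i) * A l $$ (i, j) * v j)"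
    by (intro sum.cong refl sum.swap)
  also have "\<dots> = (\<Sum>l<N. \<Sum>i<n. \<Sum>j<n. cnj (v i) * A l $$ (i, j) * v j)"
    by (rule sum.swap)
  finally show ?thesis by (simp add: qform_def)
qed

lemma mat_sum_carrier [simp]: "mat_sum n N A \<in> carrier_mat n n"
  by (simp add: mat_sum_def)

lemma psd_mat_sum:
  assumes "\<And>l. l < N \<Longrightarrow> psd n (A l)"
  shows "psd n (mat_sum n N A)"
proof -
  have "0 \<le> qform n (mat_sum n N A) v" for v
    using assms by (subst qform_mat_sum) (auto simp: psd_iff_qform intro!: sum_nonneg)
  then show ?thesis by (simp add: psd_iff_qform)
qed

lemma sandwich_index:
  assumes "K \<in> carrier_mat m d" "X \<in> carrier_mat d d" "b < m" "c < m"
  shows "(K * X * K\<dagger>) $$ (b, c) = (\<Sum>j<d. \<Sum>i<d. K $$ (b, i) * X $$ (i, j) * cnj (K $$ (c, j)))"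
proof -
  have "(K * X * K\<dagger>) $$ (b, c) = (\<Sum>j<d. (K * X) $$ (b, j) * K\<dagger> $$ (j, c))"
    using assms by (intro mult_index[of _ m d _ m]) auto
  then show ?thesis
    using assms by (simp add: mult_index[of K m d X d] sum_distrib_right)
qed

lemma mat_sum_index: "i < n \<Longrightarrow> j < n \<Longrightarrow> mat_sum n N A $$ (i, j) = (\<Sum>l<N. A l $$ (i, j))"
  by (simp add: mat_sum_def)

lemma sum_blocks:
  fixes f :: "nat \<Rightarrow> 'a::comm_monoid_add"
  shows "(\<Sum>q<k * d. f q) = (\<Sum>a<k. \<Sum>i<d. f (a * d + i))"
proof (induction k)
  case (Suc k)
  have "(\<Sum>q<Suc k * d. f q) = (\<Sum>q<k * d. f q) + (\<Sum>q\<in>{k * d..<k * d + d}. f q)"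
    by (subst sum.union_disjoint[symmetric]) (auto intro!: sum.cong)
  also have "(\<Sum>q\<in>{k * d..<k * d + d}. f q) = (\<Sum>i<d. f (k * d + i))"
    using sum.shift_bounds_nat_ivl[of f 0 "k * d" d] by (simp add: atLeast0LessThan add.commute)
  finally show ?case using Suc by simp
qed simp

definition kraus_map :: "nat \<Rightarrow> nat \<Rightarrow> (nat \<Rightarrow> complex mat) \<Rightarrow> complex mat \<Rightarrow> complex mat" where
  "kraus_map m N K X = mat_sum m N (\<lambda>l. K l * X * (K l)\<dagger>)"

lemma kraus_map_index:
  assumes "\<And>l. l < N \<Longrightarrow> K l \<in> carrier_mat m d" "X \<in> carrier_mat d d" "b < m" "c < m"
  shows "kraus_map m N K X $$ (b, c) =
    (\<Sum>l<N. \<Sum>j<d. \<Sum>i<d. K l $$ (b, i) * X $$ (i, j) * cnj (K l $$ (c, j)))"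
  using assms by (simp add: kraus_map_def mat_sum_index sandwich_index[of _ m d])

text \<open>The ampliation of a Kraus map is the Kraus map of the operators \<open>1 \<otimes> K\<^sub>l\<close>.\<close>

lemma kraus_map_completely_positive:
  assumes K: "\<And>l. l < N \<Longrightarrow> K l \<in> carrier_mat m d"
  shows "completely_positive d m (kraus_map m N K)"
  unfolding completely_positive_def
proof (intro allI impI)
  fix k X assume X: "psd (k * d) X"
  note Xc = psd_carrier[OF X]
  define L where "L l = mat (k * m) (k * d)
    (\<lambda>(p, q). if p div m = q div d then K l $$ (p mod m, q mod d) else 0)" for l
  have L: "L l \<in> carrier_mat (k * m) (k * d)" for l by (simp add: L_def)
  \<comment> \<open>Row \<open>p\<close> of \<open>1 \<otimes> K l\<close> meets only the block of
    columns numbered \<open>p div m\<close>.\<close>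
  have blocks: "(\<Sum>q<k * d. L l $$ (p, q) * f q) = (\<Sum>i<d. K l $$ (p mod m, i) * f ((p div m) * d + i))"
    if "p < k * m" for l p f
  proof -
    have pm: "p div m < k" using that by (simp add: less_mult_imp_div_less)
    have "(\<Sum>q<k * d. L l $$ (p, q) * f q) = (\<Sum>a<k. \<Sum>i<d. L l $$ (p, a * d + i) * f (a * d + i))"
      by (rule sum_blocks)
    also have "\<dots> = (\<Sum>a<k. if a = p div m then \<Sum>i<d. K l $$ (p mod m, i) * f ((p div m) * d + i) else 0)"
    proof (intro sum.cong refl)
      fix a assume "a \<in> {..<k}"
      then have a: "a < k" by simp
      have "L l $$ (p, a * d + i) = (if a = p div m then K l $$ (p mod m, i) else 0)" if i: "i < d" for i
      proof -
        have "a * d + i < Suc a * d" using i by simp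
        also have "\<dots> \<le> k * d" using a by (intro mult_right_mono) auto
        finally show ?thesis using i \<open>p < k * m\<close> by (auto simp: L_def)
      qed
      then show "(\<Sum>i<d. L l $$ (p, a * d + i) * f (a * d + i)) =
        (if a = p div m then \<Sum>i<d. K l $$ (p mod m, i) * f ((p div m) * d + i) else 0)"
        by simp
    qed
    finally show ?thesis using pm by simp
  qed
  have "ampliation k d m (kraus_map m N K) X = mat_sum (k * m) N (\<lambda>l. L l * X * (L l)\<dagger>)"
  proof (rule eq_matI)
    fix p p' assume "p < dim_row (mat_sum (k * m) N (\<lambda>l. L l * X * (L l)\<dagger>))"
      "p' < dim_col (mat_sum (k * m) N (\<lambda>l. L l * X * (L l)\<dagger>))"
    then have p: "p < k * m" "p' < k * m" by (auto simp: mat_sum_def)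
    then have "m \<noteq> 0" by (cases "m = 0") auto
    then have pm: "p mod m < m" "p' mod m < m" by auto
    define Y where "Y i j = X $$ ((p div m) * d + i, (p' div m) * d + j)" for i j
    have "ampliation k d m (kraus_map m N K) X $$ (p, p') =
      (\<Sum>l<N. \<Sum>j<d. \<Sum>i<d. K l $$ (p mod m, i) * Y i j * cnj (K l $$ (p' mod m, j)))"
      using p pm K
      by (simp add: ampliation_def kraus_map_index[of N K m d] mat_block_def Y_def)
    also have "\<dots> = (\<Sum>l<N. (L l * X * (L l)\<dagger>) $$ (p, p'))"
    proof (intro sum.cong refl)
      fix l
      have "(L l * X * (L l)\<dagger>) $$ (p, p') =
        (\<Sum>q'<k * d. cnj (L l $$ (p', q') * cnj (\<Sum>q<k * d. L l $$ (p, q) * X $$ (q, q'))))"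
        unfolding sandwich_index[OF L Xc p] by (simp add: sum_distrib_left mult_ac)
      also have "\<dots> = (\<Sum>q'<k * d. cnj (L l $$ (p', q') *
          cnj (\<Sum>i<d. K l $$ (p mod m, i) * X $$ ((p div m) * d + i, q'))))"
        unfolding blocks[OF p(1)] ..
      also have "\<dots> = cnj (\<Sum>q'<k * d. L l $$ (p', q') *
          cnj (\<Sum>i<d. K l $$ (p mod m, i) * X $$ ((p div m) * d + i, q')))"
        by simp
      also have "\<dots> = (\<Sum>j<d. \<Sum>i<d. K l $$ (p mod m, i) * Y i j * cnj (K l $$ (p' mod m, j)))"
        unfolding blocks[OF p(2)] Y_def by (simp add: sum_distrib_left mult_ac)
      finally show "(\<Sum>j<d. \<Sum>i<d. K l $$ (p mod m, i) * Y i j * cnj (K l $$ (p' mod m, j))) =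
          (L l * X * (L l)\<dagger>) $$ (p, p')" by simp
    qed
    finally show "ampliation k d m (kraus_map m N K) X $$ (p, p') =
        mat_sum (k * m) N (\<lambda>l. L l * X * (L l)\<dagger>) $$ (p, p')"
      using p by (simp add: mat_sum_index)
  qed (auto simp: ampliation_def mat_sum_def)
  then show "psd (k * m) (ampliation k d m (kraus_map m N K) X)"
    using psd_mat_sum[of N "k * m" "\<lambda>l. L l * X * (L l)\<dagger>"] psd_congruence[OF X L] by simp
qed

text \<open>The hypothesis \<open>tp\<close> is the entrywise form of
  \<open>\<Sum> K\<dagger> K = 1\<close>, with the indices transposed.\<close>

lemma kraus_map_channel:
  assumes K: "\<And>l. l < N \<Longrightarrow> K l \<in> carrier_mat m d"
    and tp: "\<And>i j. i < d \<Longrightarrow> j < d \<Longrightarrow>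
      (\<Sum>l<N. \<Sum>b<m. K l $$ (b, i) * cnj (K l $$ (b, j))) = (if i = j then 1 else 0)"
  shows "kraus_map m N K \<in> channels d m"
proof -
  have c: "kraus_map m N K X \<in> carrier_mat m m" for X by (simp add: kraus_map_def)
  have "kraus_map m N K (X + Y) = kraus_map m N K X + kraus_map m N K Y"
    if "X \<in> carrier_mat d d" "Y \<in> carrier_mat d d" for X Y
    using that c[of X] c[of Y] c[of "X + Y"] K
    by (intro eq_matI) (auto simp: kraus_map_index[of N K m d] distrib_left distrib_right sum.distrib)
  moreover have "kraus_map m N K (a \<cdot>\<^sub>m X) = a \<cdot>\<^sub>m kraus_map m N K X" if "X \<in> carrier_mat d d" for a X
    using that c[of X] c[of "a \<cdot>\<^sub>m X"] K
    by (intro eq_matI) (auto simp: kraus_map_index[of N K m d] sum_distrib_left mult_ac)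
  moreover have "mat_trace (kraus_map m N K X) = mat_trace X" if X: "X \<in> carrier_mat d d" for X
  proof -
    define t where "t l b i j = X $$ (i, j) * (K l $$ (b, i) * cnj (K l $$ (b, j)))" for l b i j
    have "mat_trace (kraus_map m N K X) = (\<Sum>b<m. \<Sum>l<N. \<Sum>j<d. \<Sum>i<d. t l b i j)"
      using c[of X] X K by (simp add: mat_trace_def kraus_map_index[of N K m d] t_def mult_ac)
    also have "\<dots> = (\<Sum>l<N. \<Sum>b<m. \<Sum>j<d. \<Sum>i<d. t l b i j)"
      by (rule sum.swap)
    also have "\<dots> = (\<Sum>l<N. \<Sum>j<d. \<Sum>b<m. \<Sum>i<d. t l b i j)"
      by (intro sum.cong refl sum.swap)
    also have "\<dots> = (\<Sum>j<d. \<Sum>l<N. \<Sum>b<m. \<Sum>i<d. t l b i j)"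
      by (rule sum.swap)
    also have "\<dots> = (\<Sum>j<d. \<Sum>l<N. \<Sum>i<d. \<Sum>b<m. t l b i j)"
      by (intro sum.cong refl sum.swap)
    also have "\<dots> = (\<Sum>j<d. \<Sum>i<d. \<Sum>l<N. \<Sum>b<m. t l b i j)"
      by (intro sum.cong refl sum.swap)
    also have "\<dots> = (\<Sum>j<d. \<Sum>i<d. X $$ (i, j) * (if i = j then 1 else 0))"
      by (intro sum.cong refl) (simp add: t_def tp flip: sum_distrib_left)
    also have "\<dots> = mat_trace X"
      using X by (simp add: mat_trace_def if_distrib cong: if_cong)
    finally show ?thesis .
  qed
  ultimately show ?thesis
    unfolding channels_def using c kraus_map_completely_positive[of N K m d] K by simp
qed

text \<open>Complete positivity with an ancilla of dimension 1.\<close>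

lemma channel_psd:
  assumes "E \<in> channels d m" "psd d X"
  shows "psd m (E X)"
proof -
  have X: "X \<in> carrier_mat d d" "E X \<in> carrier_mat m m"
    using assms psd_carrier[OF assms(2)] by (auto simp: channels_def)
  have "mat_block d X 0 0 = X" using X by (intro eq_matI) (auto simp: mat_block_def)
  then have "ampliation 1 d m E X = E X"
    using X by (intro eq_matI) (auto simp: ampliation_def)
  moreover have "psd (1 * m) (ampliation 1 d m E X)"
    using assms unfolding channels_def completely_positive_def by (metis (mono_tags, lifting) mem_Collect_eq mult_1)
  ultimately show ?thesis by simp
qed

lemma channel_density:
  assumes "E \<in> channels d m" "\<rho> \<in> density d"
  shows "E \<rho> \<in> density m"
proof -
  have "mat_trace (E \<rho>) = mat_trace \<rho>"
    using assms psd_carrier[OF densityD(1)[OF assms(2)]] by (auto simp: channels_def)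
  then show ?thesis using assms channel_psd by (auto simp: density_def)
qed

section \<open>Incoherent states and inclusions between the classes\<close>

lemma dephase_eq_iff:
  assumes "X \<in> carrier_mat n n"
  shows "X = dephase X \<longleftrightarrow> (\<forall>i<n. \<forall>j<n. i \<noteq> j \<longrightarrow> X $$ (i, j) = 0)"
proof
  assume eq: "X = dephase X"
  show "\<forall>i<n. \<forall>j<n. i \<noteq> j \<longrightarrow> X $$ (i, j) = 0"
  proof (intro allI impI)
    fix i j assume "i < n" "j < n" "i \<noteq> j"
    then have "dephase X $$ (i, j) = 0" using assms by (simp add: dephase_def)
    then show "X $$ (i, j) = 0" using eq by simp
  qed
next
  assume "\<forall>i<n. \<forall>j<n. i \<noteq> j \<longrightarrow> X $$ (i, j) = 0"
  then show "X = dephase X" using assms by (intro eq_matI) (auto simp: dephase_def)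
qed

lemma incoherent_statesD:
  assumes "\<sigma> \<in> incoherent_states d"
  shows "\<sigma> \<in> density d" "\<sigma> \<in> carrier_mat d d"
    "i < d \<Longrightarrow> j < d \<Longrightarrow> i \<noteq> j \<Longrightarrow> \<sigma> $$ (i, j) = 0" "i < d \<Longrightarrow> 0 \<le> \<sigma> $$ (i, i)"
proof -
  show "\<sigma> \<in> density d" and c: "\<sigma> \<in> carrier_mat d d"
    using assms psd_carrier by (auto simp: incoherent_states_def density_def)
  show "i < d \<Longrightarrow> j < d \<Longrightarrow> i \<noteq> j \<Longrightarrow> \<sigma> $$ (i, j) = 0"
    using assms dephase_eq_iff[OF c] by (auto simp: incoherent_states_def)
  show "i < d \<Longrightarrow> 0 \<le> \<sigma> $$ (i, i)"
    using assms psd_diag_nonneg by (auto simp: incoherent_states_def density_def)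
qed

lemma IO_subset_MIO: "IO d m \<subseteq> MIO d m"
proof
  fix E assume "E \<in> IO d m"
  then obtain N K where E: "E \<in> channels d m" "kraus_decomposition d m E N K"
    and K: "\<And>l. l < N \<Longrightarrow> incoherent_op d m (K l)"
    by (auto simp: IO_def)
  have "E \<sigma> \<in> incoherent_states m" if \<sigma>: "\<sigma> \<in> incoherent_states d" for \<sigma>
  proof -
    have D: "E \<sigma> \<in> density m" using channel_density[OF E(1) incoherent_statesD(1)[OF \<sigma>]] .
    have Es: "E \<sigma> = mat_sum m N (\<lambda>l. K l * \<sigma> * (K l)\<dagger>)"
      using E(2) incoherent_statesD(2)[OF \<sigma>] by (auto simp: kraus_decomposition_def)
    have "(K l * \<sigma> * (K l)\<dagger>) $$ (i, j) = 0" if ij: "l < N" "i < m" "j < m" "i \<noteq> j" for l i j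
    proof -
      obtain c \<tau> where \<tau>: "\<tau> \<in> incoherent_states m" "K l * \<sigma> * (K l)\<dagger> = complex_of_real c \<cdot>\<^sub>m \<tau>"
        using K[OF ij(1)] \<sigma> by (auto simp: incoherent_op_def)
      then show ?thesis using ij incoherent_statesD(2,3)[OF \<tau>(1)] by simp
    qed
    then have "\<forall>i<m. \<forall>j<m. i \<noteq> j \<longrightarrow> E \<sigma> $$ (i, j) = 0"
      by (simp add: Es mat_sum_index)
    then show ?thesis
      using D dephase_eq_iff[OF psd_carrier[OF densityD(1)[OF D]]] by (auto simp: incoherent_states_def)
  qed
  then show "E \<in> MIO d m" using E(1) by (auto simp: MIO_def)
qed

lemma SIO_subset_IO: "SIO d m \<subseteq> IO d m"
  by (auto simp: SIO_def IO_def)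

lemma DIO_subset_MIO: "DIO d m \<subseteq> MIO d m"
  using channel_density by (fastforce simp: DIO_def MIO_def incoherent_states_def)

text \<open>All four classes are treated at once: upper bounds are proved for MIO, and optimal
  channels are built in the intersection of SIO and DIO.\<close>

lemma free_ops_sandwich:
  assumes "Ops \<in> {MIO, DIO, SIO, IO}"
  shows "Ops d m \<subseteq> MIO d m" "SIO d m \<inter> DIO d m \<subseteq> Ops d m"
  using assms SIO_subset_IO[of d m] IO_subset_MIO[of d m] DIO_subset_MIO[of d m] by auto

subsection \<open>The fidelity of distillation under maximally incoherent operations\<close>

text \<open>The expectation of \<open>M\<close> in the maximally coherent state, kept complex so
  that it is linear in \<open>M\<close> over the complex numbers.\<close>

definition coherent_overlap :: "nat \<Rightarrow> complex mat \<Rightarrow> complex" where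
  "coherent_overlap m M = (\<Sum>i<m. \<Sum>j<m. M $$ (i, j)) / of_nat m"

lemma hs_inner_max_coherent:
  assumes "M \<in> carrier_mat m m"
  shows "Re (hs_inner M (ket_bra (max_coherent m))) = Re (coherent_overlap m M)"
proof -
  have P: "ket_bra (max_coherent m) \<in> carrier_mat m m"
    by (simp add: ket_bra_def max_coherent_def)
  have entry: "ket_bra (max_coherent m) $$ (k, i) = 1 / of_nat m" if "k < m" "i < m" for k i
  proof -
    have "complex_of_real (1 / sqrt (real m)) * complex_of_real (1 / sqrt (real m)) = complex_of_real (1 / real m)"
      by (simp only: of_real_mult[symmetric]) (simp add: real_sqrt_mult_self)
    then show ?thesis using that by (simp add: ket_bra_def max_coherent_def)
  qed
  have "hs_inner M (ket_bra (max_coherent m)) = (\<Sum>i<m. \<Sum>k<m. cnj (M $$ (k, i)) * (1 / of_nat m))"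
    unfolding hs_inner_def mat_trace_mult[OF adjoint_carrier[OF assms] P]
    using assms entry by (auto intro!: sum.cong)
  also have "\<dots> = cnj (\<Sum>i<m. \<Sum>k<m. M $$ (k, i)) / of_nat m"
    by (simp add: sum_divide_distrib)
  also have "(\<Sum>i<m. \<Sum>k<m. M $$ (k, i)) = (\<Sum>i<m. \<Sum>j<m. M $$ (i, j))"
    by (rule sum.swap)
  finally show ?thesis by (simp add: coherent_overlap_def Re_divide_of_nat)
qed

lemma coherent_overlap_nonneg:
  assumes "psd m M"
  shows "0 \<le> coherent_overlap m M"
proof -
  have "0 \<le> qform m M (\<lambda>_. 1)" using assms by (simp add: psd_iff_qform)
  then show ?thesis
    by (simp add: qform_def coherent_overlap_def less_eq_complex_def Re_divide_of_nat Im_divide_of_nat)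
qed

text \<open>The projection onto the maximally coherent state is at most the identity; elementarily,
  the off-diagonal bound is summed over all index pairs.\<close>

lemma coherent_overlap_le_trace:
  assumes "psd m M"
  shows "Re (coherent_overlap m M) \<le> Re (mat_trace M)"
proof (cases "m = 0")
  case True
  then show ?thesis using psd_carrier[OF assms] by (simp add: coherent_overlap_def mat_trace_def)
next
  case False
  have "2 * (\<Sum>i<m. \<Sum>j<m. Re (M $$ (i, j))) = (\<Sum>i<m. \<Sum>j<m. 2 * Re (M $$ (i, j)))"
    by (simp add: sum_distrib_left)
  also have "\<dots> \<le> (\<Sum>i<m. \<Sum>j<m. Re (M $$ (i, i)) + Re (M $$ (j, j)))"
    by (intro sum_mono psd_offdiag_le[OF assms]) auto
  also have "\<dots> = 2 * (real m * Re (mat_trace M))"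
    using psd_carrier[OF assms] by (simp add: sum.distrib mat_trace_def sum_distrib_left)
  finally have "(\<Sum>i<m. \<Sum>j<m. Re (M $$ (i, j))) \<le> real m * Re (mat_trace M)" by simp
  then show ?thesis using False
    by (simp add: coherent_overlap_def Re_divide_of_nat pos_divide_le_eq mult.commute)
qed

text \<open>The premise is positivity of a sesquilinear form at \<open>x + c y\<close>, with
  \<open>a\<close>, \<open>b\<close> its values at \<open>x\<close>, \<open>y\<close> and
  \<open>p\<close>, \<open>q\<close> the mixed terms.\<close>

lemma hermitian_form_cauchy_schwarz:
  fixes p q :: complex and a b :: real
  assumes "\<And>c. 0 \<le> complex_of_real a + cnj c * p + c * q + c * cnj c * complex_of_real b"
    and "0 \<le> a" "0 \<le> b"
  shows "q = cnj p" "(cmod p)\<^sup>2 \<le> a * b"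
proof -
  show q: "q = cnj p"
    using assms(1)[of 1] assms(1)[of \<i>] by (auto simp: complex_eq_iff less_eq_complex_def)
  have pos: "0 \<le> a - 2 * t * (cmod p)\<^sup>2 + t\<^sup>2 * (cmod p)\<^sup>2 * b" for t :: real
  proof -
    \<comment> \<open>The phase of \<open>c\<close> makes both mixed terms equal to
      \<open>- t |p|^2\<close>.\<close>
    define c where "c = - complex_of_real t * p"
    have "cnj c * p = - complex_of_real (t * (cmod p)\<^sup>2)" "c * q = - complex_of_real (t * (cmod p)\<^sup>2)"
      "c * cnj c = complex_of_real (t\<^sup>2 * (cmod p)\<^sup>2)"
      unfolding c_def q of_real_mult complex_norm_square by (simp_all add: power2_eq_square mult_ac)
    then have "0 \<le> complex_of_real (a - 2 * t * (cmod p)\<^sup>2 + t\<^sup>2 * (cmod p)\<^sup>2 * b)"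
      using assms(1)[of c] by (simp add: mult.assoc)
    then show ?thesis by (simp add: less_eq_complex_def)
  qed
  show "(cmod p)\<^sup>2 \<le> a * b"
  proof (cases "b = 0")
    case False
    then have "0 < b" using assms(3) by simp
    have "0 \<le> a - 2 * (1 / b) * (cmod p)\<^sup>2 + (1 / b)\<^sup>2 * (cmod p)\<^sup>2 * b" by (rule pos)
    also have "\<dots> = a - (cmod p)\<^sup>2 / b" using \<open>0 < b\<close> by (simp add: field_simps power2_eq_square)
    finally show ?thesis using \<open>0 < b\<close> by (simp add: pos_divide_le_eq)
  next
    case True
    have "cmod p = 0"
    proof (rule ccontr)
      assume "cmod p \<noteq> 0"
      then have "0 < (cmod p)\<^sup>2" by simp
      then have "(a + 1) / (cmod p)\<^sup>2 * (cmod p)\<^sup>2 = a + 1" by simp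
      \<comment> \<open>This \<open>t\<close> turns the nonnegative expression into
        \<open>- a - 2\<close>.\<close>
      then show False using pos[of "(a + 1) / (cmod p)\<^sup>2"] True assms(2) \<open>cmod p \<noteq> 0\<close>
        by (simp add: mult.assoc)
    qed
    then show ?thesis using True by simp
  qed
qed

text \<open>Two different vectors are allowed so that a linear map on operators induces a
  sesquilinear form on vectors.\<close>

definition ket_bra2 :: "nat \<Rightarrow> (nat \<Rightarrow> complex) \<Rightarrow> (nat \<Rightarrow> complex) \<Rightarrow> complex mat" where
  "ket_bra2 d x y = mat d d (\<lambda>(i, j). x i * cnj (y j))"

text \<open>With \<open>G = E\<dagger>(\<Psi>\<^sub>m)\<close> one has \<open>0 \<le> G \<le> 1\<close>, and \<open>G\<close> has diagonal entries \<open>1/m\<close>; the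
  vector \<open>r\<close> consists of the moduli of the coefficients of \<open>G\<psi> / \<langle>\<psi>, G\<psi>\<rangle>\<^sup>1\<^sup>/\<^sup>2\<close>.\<close>

lemma MIO_overlap_le:
  assumes E: "E \<in> MIO d m" and m: "1 \<le> m"
  shows "\<exists>r. (\<forall>i<d. 0 \<le> r i \<and> (r i)\<^sup>2 \<le> 1 / real m) \<and> (\<Sum>i<d. (r i)\<^sup>2) \<le> 1 \<and>
    Re (coherent_overlap m (E (ket_bra2 d \<psi> \<psi>))) \<le> (\<Sum>i<d. r i * cmod (\<psi> i))\<^sup>2"
proof -
  \<comment> \<open>This is \<open>\<langle>y, G x\<rangle>\<close> for
    \<open>G = E\<dagger>(\<Psi>)\<close>; the adjoint channel is never formed.\<close>
  define B where "B x y = coherent_overlap m (E (ket_bra2 d x y))" for x y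
  have ch: "E \<in> channels d m" using E by (simp add: MIO_def)
  have kc: "ket_bra2 d x y \<in> carrier_mat d d" for x y by (simp add: ket_bra2_def)
  have lin: "coherent_overlap m (E (X + c \<cdot>\<^sub>m Y)) = coherent_overlap m (E X) + c * coherent_overlap m (E Y)"
    if "X \<in> carrier_mat d d" "Y \<in> carrier_mat d d" for X Y c
  proof -
    have "E (X + c \<cdot>\<^sub>m Y) = E X + c \<cdot>\<^sub>m E Y" "E X \<in> carrier_mat m m" "E Y \<in> carrier_mat m m"
      using that ch by (auto simp: channels_def)
    then show ?thesis
      by (simp add: coherent_overlap_def sum.distrib sum_distrib_left add_divide_distrib)
  qed
  have B1: "B (\<lambda>i. x i + c * x' i) y = B x y + c * B x' y" for x x' y c
  proof -
    have "ket_bra2 d (\<lambda>i. x i + c * x' i) y = ket_bra2 d x y + c \<cdot>\<^sub>m ket_bra2 d x' y"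
      by (rule eq_matI) (auto simp: ket_bra2_def algebra_simps)
    then show ?thesis unfolding B_def using lin[OF kc kc] by simp
  qed
  have B2: "B x (\<lambda>i. y i + c * y' i) = B x y + cnj c * B x y'" for x y y' c
  proof -
    have "ket_bra2 d x (\<lambda>i. y i + c * y' i) = ket_bra2 d x y + cnj c \<cdot>\<^sub>m ket_bra2 d x y'"
      by (rule eq_matI) (auto simp: ket_bra2_def algebra_simps)
    then show ?thesis unfolding B_def using lin[OF kc kc] by simp
  qed
  have psd: "psd d (ket_bra2 d x x)" for x
  proof -
    have "ket_bra2 d x x = mat d 1 (\<lambda>(i, k). x i) * (mat d 1 (\<lambda>(i, k). x i))\<dagger>"
      by (rule eq_matI) (auto simp: ket_bra2_def gram_index[of _ d 1])
    then show ?thesis using psd_gram[of "mat d 1 (\<lambda>(i, k). x i)" d 1] by simp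
  qed
  have pos: "0 \<le> B x x" for x
    unfolding B_def by (intro coherent_overlap_nonneg channel_psd[OF ch] psd)
  define \<beta> where "\<beta> x = Re (B x x)" for x
  have \<beta>: "B x x = complex_of_real (\<beta> x)" "0 \<le> \<beta> x" for x
    using pos[of x] by (auto simp: \<beta>_def less_eq_complex_def complex_eq_iff)
  have \<beta>le: "\<beta> x \<le> (\<Sum>i<d. (cmod (x i))\<^sup>2)" for x
  proof -
    have "\<beta> x \<le> Re (mat_trace (E (ket_bra2 d x x)))"
      unfolding \<beta>_def B_def by (intro coherent_overlap_le_trace channel_psd[OF ch] psd)
    also have "mat_trace (E (ket_bra2 d x x)) = mat_trace (ket_bra2 d x x)"
      using ch kc by (simp add: channels_def)
    also have "\<dots> = complex_of_real (\<Sum>i<d. (cmod (x i))\<^sup>2)"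
      by (simp add: mat_trace_def ket_bra2_def complex_norm_square del: of_real_power)
    finally show ?thesis by simp
  qed
  have CS: "(cmod (B x y))\<^sup>2 \<le> \<beta> x * \<beta> y" for x y
  proof (rule hermitian_form_cauchy_schwarz(2)[where q = "B y x"])
    fix c
    have "0 \<le> B (\<lambda>i. x i + c * y i) (\<lambda>i. x i + c * y i)" by (rule pos)
    also have "\<dots> = B x x + cnj c * B x y + c * B y x + c * cnj c * B y y"
      unfolding B1 B2 by (simp add: algebra_simps)
    finally show "0 \<le> complex_of_real (\<beta> x) + cnj c * B x y + c * B y x + c * cnj c * complex_of_real (\<beta> y)"
      unfolding \<beta>(1) .
  qed (auto simp: \<beta>(2))
  define e where "e i = (\<lambda>k. if k = i then 1 else 0 :: complex)" for i :: nat
  \<comment> \<open>The one place where preservation of incoherence is used: a basis state is mapped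
    to a diagonal matrix of trace 1, whose entries sum to 1.\<close>
  have \<beta>e: "\<beta> (e i) = 1 / real m" if i: "i < d" for i
  proof -
    have "(\<Sum>k<d. e i k * cnj (e i k)) = (\<Sum>k<d. if k = i then 1 else 0)"
      by (intro sum.cong refl) (auto simp: e_def)
    then have "mat_trace (ket_bra2 d (e i) (e i)) = 1"
      using i by (simp add: mat_trace_def ket_bra2_def)
    then have "ket_bra2 d (e i) (e i) \<in> incoherent_states d"
      using psd[of "e i"] dephase_eq_iff[OF kc, of "e i" "e i"]
      by (auto simp: incoherent_states_def density_def ket_bra2_def e_def)
    then have inc: "E (ket_bra2 d (e i) (e i)) \<in> incoherent_states m"
      using E by (simp add: MIO_def)
    define M where "M = E (ket_bra2 d (e i) (e i))"
    note M = incoherent_statesD[OF inc[folded M_def]]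
    have "(\<Sum>a<m. \<Sum>b<m. M $$ (a, b)) = (\<Sum>a<m. \<Sum>b<m. if b = a then M $$ (a, a) else 0)"
      using M(3) by (intro sum.cong refl) auto
    also have "\<dots> = mat_trace M" using M(2) by (simp add: mat_trace_def)
    also have "\<dots> = 1" using densityD(2)[OF M(1)] .
    finally show ?thesis
      by (simp add: \<beta>_def B_def coherent_overlap_def Re_divide_of_nat flip: M_def)
  qed
  \<comment> \<open>Complex conjugates of the coefficients of \<open>G \<psi>\<close>.\<close>
  define g where "g i = B (e i) \<psi>" for i
  have B0: "B (\<lambda>_. 0) y = 0" for y using B1[of "\<lambda>_. 0" 1 "\<lambda>_. 0" y] by simp
  have expand: "B x \<psi> = (\<Sum>i<d. x i * g i)" for x
  proof -
    have "B (\<lambda>i. if i < n then x i else 0) \<psi> = (\<Sum>i<n. x i * g i)" for n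
    proof (induction n)
      case (Suc n)
      have "(\<lambda>i. if i < Suc n then x i else 0) = (\<lambda>i. (if i < n then x i else 0) + x n * e n i)"
        by (auto simp: e_def fun_eq_iff less_Suc_eq)
      then have "B (\<lambda>i. if i < Suc n then x i else 0) \<psi> =
          B (\<lambda>i. (if i < n then x i else 0) + x n * e n i) \<psi>" by simp
      then show ?case unfolding B1 Suc by (simp add: g_def)
    qed (simp add: B0)
    from this[of d] have "B (\<lambda>i. if i < d then x i else 0) \<psi> = (\<Sum>i<d. x i * g i)" .
    moreover have "ket_bra2 d (\<lambda>i. if i < d then x i else 0) \<psi> = ket_bra2 d x \<psi>"
      by (rule eq_matI) (auto simp: ket_bra2_def)
    ultimately show ?thesis by (simp add: B_def)
  qed
  define b where "b = \<beta> \<psi>"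
  have b: "0 \<le> b" by (simp add: b_def \<beta>(2))
  have gi: "(cmod (g i))\<^sup>2 \<le> b / real m" if "i < d" for i
    using CS[of "e i" \<psi>] \<beta>e[OF that] by (simp add: g_def b_def)
  define n where "n = (\<Sum>i<d. (cmod (g i))\<^sup>2)"
  have n: "0 \<le> n" by (simp add: n_def sum_nonneg)
  \<comment> \<open>Cauchy-Schwarz for the form \<open>B\<close> at \<open>G \<psi>\<close> and
    \<open>\<psi>\<close> gives \<open>n^2 \<le> \<beta>(G \<psi>) * b\<close>, and
    \<open>G \<le> 1\<close> gives \<open>\<beta>(G \<psi>) \<le> n\<close>.\<close>
  have "n \<le> b"
  proof (cases "n = 0")
    case False
    have "B (\<lambda>i. cnj (g i)) \<psi> = complex_of_real n"
      unfolding expand n_def by (simp add: complex_norm_square mult.commute del: of_real_power)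
    then have "n\<^sup>2 \<le> \<beta> (\<lambda>i. cnj (g i)) * b"
      using CS[of "\<lambda>i. cnj (g i)" \<psi>] by (simp add: b_def)
    also have "\<dots> \<le> n * b"
      using \<beta>le[of "\<lambda>i. cnj (g i)"] b by (intro mult_right_mono) (auto simp: n_def)
    finally show ?thesis using False n by (simp add: power2_eq_square)
  qed (use b in simp)
  define r where "r i = cmod (g i) / sqrt b" for i
  show ?thesis
  proof (cases "b = 0")
    case True
    then show ?thesis
      by (intro exI[of _ "\<lambda>_. 0"]) (simp add: b_def \<beta>_def B_def)
  next
    case False
    then have b0: "0 < b" using b by simp
    have r2: "(r i)\<^sup>2 = (cmod (g i))\<^sup>2 / b" for i
      using b by (simp add: r_def power_divide)
    \<comment> \<open>Here \<open>b = \<langle>\<psi>, G \<psi>\<rangle>\<close> is expanded in the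
      basis and the triangle inequality is applied.\<close>
    have "b \<le> sqrt b * (\<Sum>i<d. r i * cmod (\<psi> i))"
    proof -
      have "b = cmod (B \<psi> \<psi>)" using \<beta>[of \<psi>] b by (simp add: b_def)
      also have "\<dots> \<le> (\<Sum>i<d. cmod (\<psi> i * g i))" unfolding expand by (rule norm_sum)
      also have "\<dots> = sqrt b * (\<Sum>i<d. r i * cmod (\<psi> i))"
        using b0 by (simp add: r_def sum_distrib_left norm_mult mult_ac)
      finally show ?thesis .
    qed
    then have "sqrt b * sqrt b \<le> sqrt b * (\<Sum>i<d. r i * cmod (\<psi> i))" using b by simp
    then have "sqrt b \<le> (\<Sum>i<d. r i * cmod (\<psi> i))"
      by (rule mult_left_le_imp_le) (use b0 in simp)
    then have "(sqrt b)\<^sup>2 \<le> (\<Sum>i<d. r i * cmod (\<psi> i))\<^sup>2" using b by (intro power_mono) auto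
    then have "b \<le> (\<Sum>i<d. r i * cmod (\<psi> i))\<^sup>2" using b by simp
    moreover have "(r i)\<^sup>2 \<le> 1 / real m" if "i < d" for i
      using gi[OF that] b0 by (simp add: r2 divide_simps mult.commute split: if_splits)
    moreover have "(\<Sum>i<d. (r i)\<^sup>2) \<le> 1"
      using \<open>n \<le> b\<close> b0 by (simp add: r2 n_def flip: sum_divide_distrib)
    moreover have "0 \<le> r i" for i using b by (simp add: r_def)
    moreover have "b = Re (coherent_overlap m (E (ket_bra2 d \<psi> \<psi>)))"
      by (simp add: b_def \<beta>_def B_def)
    ultimately show ?thesis by (intro exI[of _ r]) simp
  qed
qed

text \<open>The amplitudes are pushed linearly towards the constant value \<open>1 / sqrt m\<close>.
  At the end point the squared norm is \<open>d/m \<ge> 1\<close>, so it equals 1 somewhere on the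
  way, and the cap is never exceeded.\<close>

lemma flat_amplitudes_extend:
  fixes r :: "nat \<Rightarrow> real"
  assumes r: "\<And>i. i < d \<Longrightarrow> 0 \<le> r i \<and> (r i)\<^sup>2 \<le> 1 / real m" "(\<Sum>i<d. (r i)\<^sup>2) \<le> 1" and m: "m \<in> {1..d}"
  obtains s where "\<And>i. i < d \<Longrightarrow> r i \<le> s i \<and> (s i)\<^sup>2 \<le> 1 / real m" "(\<Sum>i<d. (s i)\<^sup>2) = 1"
proof -
  define u where "u = 1 / sqrt (real m)"
  have u: "0 \<le> u" "u\<^sup>2 = 1 / real m" by (auto simp: u_def power_divide)
  have ru: "r i \<le> u" if "i < d" for i
    using r(1)[OF that] u by (intro power2_le_imp_le[of "r i" u]) auto
  define s where "s t i = r i + t * (u - r i)" for t i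
  have "\<exists>t\<ge>0. t \<le> 1 \<and> (\<Sum>i<d. (s t i)\<^sup>2) = 1"
  proof (rule IVT')
    show "(\<Sum>i<d. (s 0 i)\<^sup>2) \<le> 1" using r(2) by (simp add: s_def)
    show "1 \<le> (\<Sum>i<d. (s 1 i)\<^sup>2)" using u m by (simp add: s_def)
    show "continuous_on {0..1} (\<lambda>t. \<Sum>i<d. (s t i)\<^sup>2)"
      unfolding s_def by (intro continuous_intros)
  qed auto
  then obtain t where t: "0 \<le> t" "t \<le> 1" "(\<Sum>i<d. (s t i)\<^sup>2) = 1" by auto
  show thesis
  proof (rule that[of "s t"])
    fix i assume i: "i < d"
    have "0 \<le> t * (u - r i)" "t * (u - r i) \<le> u - r i"
      using t ru[OF i] by (auto simp: mult_left_le_one_le)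
    then have "r i \<le> s t i" "s t i \<le> u" by (auto simp: s_def)
    moreover from this have "(s t i)\<^sup>2 \<le> u\<^sup>2" using r(1)[OF i] by (intro power_mono) auto
    ultimately show "r i \<le> s t i \<and> (s t i)\<^sup>2 \<le> 1 / real m" using u by simp
  qed (rule t(3))
qed

subsection \<open>Strictly incoherent channels from partial injections\<close>

lemma psd_diagonal:
  assumes A: "A \<in> carrier_mat n n" and off: "\<And>i j. i < n \<Longrightarrow> j < n \<Longrightarrow> i \<noteq> j \<Longrightarrow> A $$ (i, j) = 0"
    and diag: "\<And>i. i < n \<Longrightarrow> 0 \<le> A $$ (i, i)"
  shows "psd n A"
proof -
  have "0 \<le> qform n A v" for v
  proof -
    have "qform n A v = (\<Sum>i<n. \<Sum>j<n. if j = i then cnj (v i) * A $$ (i, i) * v i else 0)"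
      unfolding qform_def using off by (intro sum.cong refl) auto
    also have "\<dots> = (\<Sum>i<n. cnj (v i) * A $$ (i, i) * v i)" by simp
    also have "\<dots> = (\<Sum>i<n. complex_of_real (Re (A $$ (i, i)) * (cmod (v i))\<^sup>2))"
    proof (intro sum.cong refl)
      fix i assume "i \<in> {..<n}"
      then have "A $$ (i, i) = complex_of_real (Re (A $$ (i, i)))"
        using diag[of i] by (simp add: less_eq_complex_def complex_eq_iff)
      then have "cnj (v i) * A $$ (i, i) * v i = complex_of_real (Re (A $$ (i, i))) * (v i * cnj (v i))"
        by (simp add: mult_ac)
      then show "cnj (v i) * A $$ (i, i) * v i = complex_of_real (Re (A $$ (i, i)) * (cmod (v i))\<^sup>2)"
        unfolding of_real_mult complex_norm_square .
    qed
    also have "\<dots> = complex_of_real (\<Sum>i<n. Re (A $$ (i, i)) * (cmod (v i))\<^sup>2)" by simp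
    also have "0 \<le> \<dots>"
      using diag by (auto simp: less_eq_complex_def intro!: sum_nonneg)
    finally show ?thesis .
  qed
  then show ?thesis using A by (simp add: psd_iff_qform)
qed

lemma diagonal_scaled_incoherent:
  assumes m: "1 \<le> m" and A: "A \<in> carrier_mat m m"
    and off: "\<And>i j. i < m \<Longrightarrow> j < m \<Longrightarrow> i \<noteq> j \<Longrightarrow> A $$ (i, j) = 0"
    and diag: "\<And>i. i < m \<Longrightarrow> 0 \<le> A $$ (i, i)"
  shows "\<exists>c\<ge>0. \<exists>\<tau>\<in>incoherent_states m. A = complex_of_real c \<cdot>\<^sub>m \<tau>"
proof -
  define c where "c = Re (mat_trace A)"
  have tr: "mat_trace A = complex_of_real c" "0 \<le> c"
    using diag A by (auto simp: c_def mat_trace_def complex_eq_iff less_eq_complex_def intro!: sum_nonneg)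
  show ?thesis
  proof (cases "c = 0")
    case True
    have "(\<Sum>i<m. Re (A $$ (i, i))) = 0" using True A by (simp add: c_def mat_trace_def)
    then have "\<forall>i<m. Re (A $$ (i, i)) = 0"
      using diag by (subst (asm) sum_nonneg_eq_0_iff) (auto simp: less_eq_complex_def)
    then have A0: "A $$ (i, j) = 0" if "i < m" "j < m" for i j
      using off[OF that] diag[OF that(1)] that by (cases "i = j") (auto simp: complex_eq_iff less_eq_complex_def)
    \<comment> \<open>For trace 0 any incoherent state will do; a basis state exists because
      \<open>m \<ge> 1\<close>.\<close>
    define \<tau> :: "complex mat" where "\<tau> = mat m m (\<lambda>(i, j). if i = 0 \<and> j = 0 then 1 else 0)"
    have "psd m \<tau>" by (rule psd_diagonal) (auto simp: \<tau>_def less_eq_complex_def)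
    moreover have "mat_trace \<tau> = 1"
      using m by (simp add: mat_trace_def \<tau>_def)
    moreover have "\<tau> = dephase \<tau>"
      by (subst dephase_eq_iff[of _ m]) (auto simp: \<tau>_def)
    ultimately have "\<tau> \<in> incoherent_states m" by (simp add: incoherent_states_def density_def)
    moreover have "A = complex_of_real 0 \<cdot>\<^sub>m \<tau>"
      using A A0 by (intro eq_matI) (auto simp: \<tau>_def)
    ultimately show ?thesis by blast
  next
    case False
    define \<tau> where "\<tau> = complex_of_real (1 / c) \<cdot>\<^sub>m A"
    have \<tau>c: "\<tau> \<in> carrier_mat m m" using A by (simp add: \<tau>_def)
    have "psd m \<tau>"
      using A off diag tr(2) by (intro psd_diagonal) (auto simp: \<tau>_def less_eq_complex_def)
    moreover have "mat_trace \<tau> = 1"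
    proof -
      have "mat_trace \<tau> = complex_of_real (1 / c) * mat_trace A"
        using A by (simp add: \<tau>_def mat_trace_def sum_distrib_left)
      then show ?thesis using False by (simp add: tr(1))
    qed
    moreover have "\<tau> = dephase \<tau>"
      using A off by (subst dephase_eq_iff[OF \<tau>c]) (auto simp: \<tau>_def)
    ultimately have "\<tau> \<in> incoherent_states m" by (simp add: incoherent_states_def density_def)
    moreover have "A = complex_of_real c \<cdot>\<^sub>m \<tau>"
      using A False by (intro eq_matI) (auto simp: \<tau>_def)
    ultimately show ?thesis using tr(2) by blast
  qed
qed

text \<open>The premise \<open>col\<close> says that every column has at most one nonzero entry, so
  basis states go to multiples of basis states.\<close>

lemma incoherent_opI:
  assumes m: "1 \<le> m" and K: "K \<in> carrier_mat m d"
    and col: "\<And>i b c. i < d \<Longrightarrow> b < m \<Longrightarrow> c < m \<Longrightarrow> b \<noteq> c \<Longrightarrow> K $$ (b, i) * cnj (K $$ (c, i)) = 0"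
  shows "incoherent_op d m K"
  unfolding incoherent_op_def
proof (intro conjI ballI)
  fix \<sigma> assume "\<sigma> \<in> incoherent_states d"
  note \<sigma> = incoherent_statesD[OF this]
  have entry: "(K * \<sigma> * K\<dagger>) $$ (b, c) = (\<Sum>i<d. \<sigma> $$ (i, i) * (K $$ (b, i) * cnj (K $$ (c, i))))"
    if "b < m" "c < m" for b c
  proof -
    have "(K * \<sigma> * K\<dagger>) $$ (b, c) =
        (\<Sum>j<d. \<Sum>i<d. if i = j then \<sigma> $$ (j, j) * (K $$ (b, j) * cnj (K $$ (c, j))) else 0)"
      unfolding sandwich_index[OF K \<sigma>(2) that] using \<sigma>(3) by (intro sum.cong refl) auto
    then show ?thesis by simp
  qed
  show "\<exists>c\<ge>0. \<exists>\<tau>\<in>incoherent_states m. K * \<sigma> * K\<dagger> = complex_of_real c \<cdot>\<^sub>m \<tau>"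
  proof (rule diagonal_scaled_incoherent[OF m])
    show "K * \<sigma> * K\<dagger> \<in> carrier_mat m m"
      using mult_carrier_mat[OF mult_carrier_mat[OF K \<sigma>(2)] adjoint_carrier[OF K]] .
    show "(K * \<sigma> * K\<dagger>) $$ (i, j) = 0" if "i < m" "j < m" "i \<noteq> j" for i j
      unfolding entry[OF that(1,2)]
      by (intro sum.neutral ballI) (simp only: lessThan_iff col[OF _ that] mult_zero_right)
    show "0 \<le> (K * \<sigma> * K\<dagger>) $$ (i, i)" if "i < m" for i
      unfolding entry[OF that that] complex_norm_square[symmetric]
      using \<sigma>(4) by (intro sum_nonneg) (auto simp: less_eq_complex_def simp del: of_real_power)
  qed
qed (rule K)

text \<open>The operator \<open>K l\<close> sends basis vector \<open>i\<close> to
  \<open>a l i\<close> times basis vector \<open>\<pi> l i\<close>, with \<open>\<pi> l\<close>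
  injective on the support of \<open>a l\<close>. One nonzero entry per column makes
  \<open>K l\<close> incoherent; at most one per row makes its adjoint incoherent, gives commutation
  with dephasing, and reduces trace preservation to \<open>norm\<close>.\<close>

lemma partial_injection_channel:
  fixes a :: "nat \<Rightarrow> nat \<Rightarrow> complex" and \<pi> :: "nat \<Rightarrow> nat \<Rightarrow> nat"
  assumes m: "1 \<le> m" and d: "1 \<le> d"
    and range: "\<And>l i. l < N \<Longrightarrow> i < d \<Longrightarrow> a l i \<noteq> 0 \<Longrightarrow> \<pi> l i < m"
    and inj: "\<And>l i j. l < N \<Longrightarrow> i < d \<Longrightarrow> j < d \<Longrightarrow> a l i \<noteq> 0 \<Longrightarrow> a l j \<noteq> 0 \<Longrightarrow> \<pi> l i = \<pi> l j \<Longrightarrow> i = j"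
    and norm: "\<And>i. i < d \<Longrightarrow> (\<Sum>l<N. (cmod (a l i))\<^sup>2) = 1"
  obtains E where "E \<in> SIO d m \<inter> DIO d m"
    "\<And>\<psi>. Re (coherent_overlap m (E (ket_bra2 d \<psi> \<psi>))) = (\<Sum>l<N. (cmod (\<Sum>i<d. a l i * \<psi> i))\<^sup>2) / real m"
proof -
  define K where "K l = mat m d (\<lambda>(b, i). if b = \<pi> l i then a l i else 0)" for l
  have K: "K l \<in> carrier_mat m d" for l by (simp add: K_def)
  have Ki: "K l $$ (b, i) = (if b = \<pi> l i then a l i else 0)" if "b < m" "i < d" for l b i
    using that by (simp add: K_def)
  have col: "K l $$ (b, i) * cnj (K l $$ (c, i)) = 0" if "i < d" "b < m" "c < m" "b \<noteq> c" for l i b c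
    using that by (simp add: Ki)
  have row: "K l $$ (b, i) * cnj (K l $$ (b, j)) = 0" if "l < N" "i < d" "j < d" "b < m" "i \<noteq> j" for l i j b
  proof (cases "a l i = 0 \<or> a l j = 0")
    case False
    then have "\<pi> l i \<noteq> \<pi> l j" using inj[OF that(1-3)] that(5) by blast
    then show ?thesis using that by (auto simp: Ki)
  qed (use that in \<open>auto simp: Ki\<close>)
  define E where "E = kraus_map m N K"
  have ch: "E \<in> channels d m"
    unfolding E_def
  proof (rule kraus_map_channel[OF K])
    fix i j assume ij: "i < d" "j < d"
    show "(\<Sum>l<N. \<Sum>b<m. K l $$ (b, i) * cnj (K l $$ (b, j))) = (if i = j then 1 else 0)"
    proof (cases "i = j")
      case True
      have "(\<Sum>b<m. K l $$ (b, i) * cnj (K l $$ (b, i))) = complex_of_real ((cmod (a l i))\<^sup>2)" if "l < N" for l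
      proof -
        have "(\<Sum>b<m. K l $$ (b, i) * cnj (K l $$ (b, i))) =
            (\<Sum>b<m. if b = \<pi> l i then complex_of_real ((cmod (a l i))\<^sup>2) else 0)"
          using ij by (intro sum.cong refl) (auto simp: Ki complex_norm_square simp del: of_real_power)
        then show ?thesis using range[OF that ij(1)] by auto
      qed
      then have "(\<Sum>l<N. \<Sum>b<m. K l $$ (b, i) * cnj (K l $$ (b, i))) = complex_of_real (\<Sum>l<N. (cmod (a l i))\<^sup>2)"
        by simp
      then show ?thesis unfolding norm[OF ij(1)] using True by simp
    next
      case False
      then show ?thesis using row ij by (simp add: sum.neutral)
    qed
  qed
  have dec: "kraus_decomposition d m E N K"
    using K by (auto simp: kraus_decomposition_def E_def kraus_map_def)
  have "incoherent_op d m (K l) \<and> incoherent_op m d ((K l)\<dagger>)" if l: "l < N" for l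
  proof
    show "incoherent_op d m (K l)" using incoherent_opI[OF m K] col by blast
    show "incoherent_op m d ((K l)\<dagger>)"
    proof (rule incoherent_opI[OF d adjoint_carrier[OF K]])
      fix b i j assume *: "b < m" "i < d" "j < d" "i \<noteq> j"
      then show "(K l)\<dagger> $$ (i, b) * cnj ((K l)\<dagger> $$ (j, b)) = 0"
        using row[OF l *(3,2,1)] K[of l] by (auto simp: mult.commute)
    qed
  qed
  then have sio: "E \<in> SIO d m" using ch dec by (auto simp: SIO_def)
  have "dephase (E \<rho>) = E (dephase \<rho>)" if \<rho>: "\<rho> \<in> carrier_mat d d" for \<rho>
  proof (rule eq_matI)
    have Ec: "E X \<in> carrier_mat m m" for X by (simp add: E_def kraus_map_def)
    show "dim_row (dephase (E \<rho>)) = dim_row (E (dephase \<rho>))" "dim_col (dephase (E \<rho>)) = dim_col (E (dephase \<rho>))"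
      unfolding carrier_matD[OF Ec] using carrier_matD[OF Ec[of \<rho>]] by (simp_all add: dephase_def)
    fix b c assume "b < dim_row (E (dephase \<rho>))" "c < dim_col (E (dephase \<rho>))"
    then have bc: "b < m" "c < m" using Ec[of "dephase \<rho>"] by auto
    have dr: "dephase \<rho> \<in> carrier_mat d d" using \<rho> by (simp add: dephase_def)
    have entry: "E X $$ (b, c) = (\<Sum>l<N. \<Sum>j<d. \<Sum>i<d. K l $$ (b, i) * X $$ (i, j) * cnj (K l $$ (c, j)))"
      if "X \<in> carrier_mat d d" for X
      unfolding E_def using kraus_map_index[OF K that bc] .
    have dep: "dephase \<rho> $$ (i, j) = (if i = j then \<rho> $$ (i, j) else 0)" if "i < d" "j < d" for i j
      using \<rho> that by (simp add: dephase_def)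
    have d1: "dephase (E \<rho>) $$ (b, c) = (if b = c then E \<rho> $$ (b, c) else 0)"
      using Ec[of \<rho>] bc by (simp add: dephase_def)
    show "dephase (E \<rho>) $$ (b, c) = E (dephase \<rho>) $$ (b, c)"
    proof (cases "b = c")
      case True
      have eq: "K l $$ (b, i) * \<rho> $$ (i, j) * cnj (K l $$ (b, j)) =
          K l $$ (b, i) * dephase \<rho> $$ (i, j) * cnj (K l $$ (b, j))" if "l < N" "i < d" "j < d" for l i j
        using row[OF that bc(1)] that by (auto simp: dep)
      have "E \<rho> $$ (b, c) = E (dephase \<rho>) $$ (b, c)"
        unfolding entry[OF \<rho>] entry[OF dr] unfolding True[symmetric] by (intro sum.cong refl eq) auto
      then show ?thesis unfolding d1 using True by simp
    next
      case False
      have "K l $$ (b, i) * dephase \<rho> $$ (i, j) * cnj (K l $$ (c, j)) = 0" if "l < N" "i < d" "j < d" for l i j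
        using col[OF that(2) bc False, of l] that by (auto simp: dep)
      then have "E (dephase \<rho>) $$ (b, c) = 0"
        unfolding entry[OF dr] by (intro sum.neutral ballI) auto
      then show ?thesis unfolding d1 using False by simp
    qed
  qed
  then have dio: "E \<in> DIO d m" using ch psd_carrier by (auto simp: DIO_def density_def)
  have "Re (coherent_overlap m (E (ket_bra2 d \<psi> \<psi>))) = (\<Sum>l<N. (cmod (\<Sum>i<d. a l i * \<psi> i))\<^sup>2) / real m" for \<psi>
  proof -
    define z where "z l b = (\<Sum>i<d. K l $$ (b, i) * \<psi> i)" for l b
    have kb: "ket_bra2 d \<psi> \<psi> \<in> carrier_mat d d" by (simp add: ket_bra2_def)
    have "E (ket_bra2 d \<psi> \<psi>) $$ (b, c) = (\<Sum>l<N. z l b * cnj (z l c))" if "b < m" "c < m" for b c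
    proof -
      have "E (ket_bra2 d \<psi> \<psi>) $$ (b, c) =
          (\<Sum>l<N. \<Sum>j<d. \<Sum>i<d. K l $$ (b, i) * \<psi> i * (cnj (K l $$ (c, j)) * cnj (\<psi> j)))"
        unfolding E_def kraus_map_index[OF K kb that] by (simp add: ket_bra2_def mult_ac)
      also have "\<dots> = (\<Sum>l<N. z l b * cnj (z l c))"
        unfolding z_def by (simp add: sum_distrib_left sum_distrib_right)
      finally show ?thesis .
    qed
    then have "coherent_overlap m (E (ket_bra2 d \<psi> \<psi>)) = (\<Sum>b<m. \<Sum>c<m. \<Sum>l<N. z l b * cnj (z l c)) / of_nat m"
      by (simp add: coherent_overlap_def)
    also have "(\<Sum>b<m. \<Sum>c<m. \<Sum>l<N. z l b * cnj (z l c)) = (\<Sum>b<m. \<Sum>l<N. \<Sum>c<m. z l b * cnj (z l c))"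
      by (intro sum.cong refl sum.swap)
    also have "\<dots> = (\<Sum>l<N. \<Sum>b<m. \<Sum>c<m. z l b * cnj (z l c))"
      by (rule sum.swap)
    also have "\<dots> = (\<Sum>l<N. complex_of_real ((cmod (\<Sum>b<m. z l b))\<^sup>2))"
      unfolding complex_norm_square cnj_sum sum_product ..
    also have "(\<Sum>l<N. complex_of_real ((cmod (\<Sum>b<m. z l b))\<^sup>2)) =
        (\<Sum>l<N. complex_of_real ((cmod (\<Sum>i<d. a l i * \<psi> i))\<^sup>2))"
    proof (intro sum.cong refl)
      fix l assume "l \<in> {..<N}"
      then have l: "l < N" by simp
      \<comment> \<open>The uniform target vector sees only column sums, so the choice of
        \<open>\<pi>\<close> does not affect the overlap.\<close>
      have "(\<Sum>b<m. z l b) = (\<Sum>i<d. \<Sum>b<m. K l $$ (b, i) * \<psi> i)"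
        unfolding z_def by (rule sum.swap)
      also have "\<dots> = (\<Sum>i<d. a l i * \<psi> i)"
      proof (intro sum.cong refl)
        fix i assume "i \<in> {..<d}"
        then have i: "i < d" by simp
        have "(\<Sum>b<m. K l $$ (b, i) * \<psi> i) = (\<Sum>b<m. if b = \<pi> l i then a l i * \<psi> i else 0)"
          using i by (intro sum.cong refl) (auto simp: Ki)
        then show "(\<Sum>b<m. K l $$ (b, i) * \<psi> i) = a l i * \<psi> i" using range[OF l i] by auto
      qed
      finally show "complex_of_real ((cmod (\<Sum>b<m. z l b))\<^sup>2) = complex_of_real ((cmod (\<Sum>i<d. a l i * \<psi> i))\<^sup>2)"
        by simp
    qed
    finally show ?thesis by (simp add: Re_divide_of_nat del: of_real_power)
  qed
  then show thesis using sio dio by (intro that[of E]) auto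
qed

text \<open>The Kraus operators map every basis vector to the first one: all states are reset. It is
  a filler for kets whose contribution is only needed to be nonnegative.\<close>

lemma free_op_exists:
  assumes "1 \<le> m" "1 \<le> d"
  obtains E where "E \<in> SIO d m \<inter> DIO d m"
proof (rule partial_injection_channel[OF assms, of d "\<lambda>l i. if l = i then 1 else 0" "\<lambda>_ _. 0"])
  fix i assume "i < d"
  have "(\<Sum>l<d. (cmod (if l = i then 1 else 0))\<^sup>2) = (\<Sum>l<d. if l = i then 1 else 0)"
    by (intro sum.cong refl) auto
  also have "\<dots> = 1" using \<open>i < d\<close> by simp
  finally show "(\<Sum>l<d. (cmod (if l = i then 1 else 0))\<^sup>2) = 1" .
qed (use assms that in \<open>auto split: if_splits\<close>)

subsection \<open>The hypersimplex\<close>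

text \<open>Moving mass between two fractional coordinates until one of them becomes integral writes a
  point of the hypersimplex as a convex combination of two points with fewer fractional
  coordinates.\<close>

lemma hypersimplex_decomposition:
  fixes x :: "nat \<Rightarrow> real"
  assumes "\<And>i. i < d \<Longrightarrow> 0 \<le> x i \<and> x i \<le> 1" "(\<Sum>i<d. x i) = real m"
  shows "\<exists>q. (\<forall>S. 0 \<le> q S) \<and> (\<Sum>S | S \<subseteq> {..<d} \<and> card S = m. q S) = 1 \<and>
    (\<forall>i<d. x i = (\<Sum>S | S \<subseteq> {..<d} \<and> card S = m. if i \<in> S then q S else (0::real)))"
  using assms
proof (induction "card {i \<in> {..<d}. 0 < x i \<and> x i < 1}" arbitrary: x rule: less_induct)
  case less
  define F where "F = {S. S \<subseteq> {..<d} \<and> card S = m}"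
  have finF: "finite F" by (rule finite_subset[of _ "Pow {..<d}"]) (auto simp: F_def)
  define R where "R = {i \<in> {..<d}. 0 < x i \<and> x i < 1}"
  show ?case
    unfolding F_def[symmetric]
  proof (cases "R = {}")
    case True
    \<comment> \<open>Without fractional coordinates the point is the indicator of a set, of size
      \<open>m\<close> by the sum condition.\<close>
    define T where "T = {i \<in> {..<d}. x i = 1}"
    have x01: "x i = (if i \<in> T then 1 else 0)" if "i < d" for i
      using less.prems(1)[OF that] True that by (force simp: R_def T_def)
    then have "real m = (\<Sum>i<d. if i \<in> T then 1 else 0)" using less.prems(2) by simp
    also have "\<dots> = (\<Sum>i\<in>T. 1)" by (intro sum.mono_neutral_cong_right) (auto simp: T_def)
    finally have "T \<in> F" by (auto simp: F_def T_def)
    then have sums: "(\<Sum>S\<in>F. if S = T then 1 else 0 :: real) = 1"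
      "(\<Sum>S\<in>F. if i \<in> S then if S = T then 1 else 0 else 0 :: real) = (if i \<in> T then 1 else 0)" for i
    proof -
      show "(\<Sum>S\<in>F. if S = T then 1 else 0 :: real) = 1" using finF \<open>T \<in> F\<close> by simp
      have "(\<Sum>S\<in>F. if i \<in> S then if S = T then 1 else 0 else 0 :: real) =
          (\<Sum>S\<in>F. if S = T then (if i \<in> T then 1 else 0) else 0)"
        by (intro sum.cong) auto
      then show "(\<Sum>S\<in>F. if i \<in> S then if S = T then 1 else 0 else 0 :: real) = (if i \<in> T then 1 else 0)"
        using finF \<open>T \<in> F\<close> by simp
    qed
    show "\<exists>q. (\<forall>S. 0 \<le> q S) \<and> sum q F = 1 \<and> (\<forall>i<d. x i = (\<Sum>S\<in>F. if i \<in> S then q S else 0))"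
      using sums x01 by (intro exI[of _ "\<lambda>S. if S = T then 1 else 0"]) auto
  next
    case False
    then obtain i where i: "i \<in> R" by auto
    \<comment> \<open>A lone fractional coordinate would be an integer minus integers.\<close>
    have "\<exists>j\<in>R. j \<noteq> i"
    proof (rule ccontr)
      assume "\<not> (\<exists>j\<in>R. j \<noteq> i)"
      then have int: "x k \<in> \<int>" if "k \<in> {..<d} - {i}" for k
        using less.prems(1)[of k] that by (force simp: R_def)
      have "x i = real m - (\<Sum>k\<in>{..<d} - {i}. x k)"
        using less.prems(2) i sum.remove[of "{..<d}" i x] by (simp add: R_def)
      also have "\<dots> \<in> \<int>" using int by (intro Ints_diff Ints_of_nat Ints_sum)
      finally obtain z where "x i = of_int z" by (auto elim: Ints_cases)
      then show False using i by (auto simp: R_def)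
    qed
    then obtain j where j: "j \<in> R" "j \<noteq> i" by auto
    have xi: "i < d" "0 < x i" "x i < 1" and xj: "j < d" "0 < x j" "x j < 1" using i j by (auto simp: R_def)
    \<comment> \<open>The largest transfers from \<open>j\<close> to \<open>i\<close>
      (\<open>\<alpha>\<close>) and from \<open>i\<close> to \<open>j\<close>
      (\<open>\<beta>\<close>) that stay in the cube; each makes a coordinate integral.\<close>
    define \<alpha> where "\<alpha> = min (1 - x i) (x j)"
    define \<beta> where "\<beta> = min (x i) (1 - x j)"
    have \<alpha>\<beta>: "0 < \<alpha>" "0 < \<beta>" using xi xj by (auto simp: \<alpha>_def \<beta>_def)
    define y where "y = x(i := x i + \<alpha>, j := x j - \<alpha>)"
    define z where "z = x(i := x i - \<beta>, j := x j + \<beta>)"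
    have shift: "(\<Sum>k<d. (x(i := x i + t, j := x j - t)) k) = real m" for t
    proof -
      have "(\<Sum>k<d. (x(i := x i + t, j := x j - t)) k) =
          (\<Sum>k<d. x k + (if k = i then t else 0) - (if k = j then t else 0))"
        using j(2) by (intro sum.cong) auto
      then show ?thesis using xi xj less.prems(2) by (simp add: sum.distrib sum_subtractf)
    qed
    have mono: "card {k \<in> {..<d}. 0 < w k \<and> w k < 1} < card {i \<in> {..<d}. 0 < x i \<and> x i < 1}"
      if "\<And>k. k \<noteq> i \<Longrightarrow> k \<noteq> j \<Longrightarrow> w k = x k" "w i = 1 \<or> w i = 0 \<or> w j = 0 \<or> w j = 1" for w
    proof (rule psubset_card_mono)
      show "{k \<in> {..<d}. 0 < w k \<and> w k < 1} \<subset> {i \<in> {..<d}. 0 < x i \<and> x i < 1}"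
      proof
        show "{k \<in> {..<d}. 0 < w k \<and> w k < 1} \<subseteq> {i \<in> {..<d}. 0 < x i \<and> x i < 1}"
          using that(1) xi xj by auto metis+
        have "i \<notin> {k \<in> {..<d}. 0 < w k \<and> w k < 1} \<or> j \<notin> {k \<in> {..<d}. 0 < w k \<and> w k < 1}"
          using that(2) by auto
        then show "{k \<in> {..<d}. 0 < w k \<and> w k < 1} \<noteq> {i \<in> {..<d}. 0 < x i \<and> x i < 1}"
          using i j(1) unfolding R_def by blast
      qed
    qed simp
    obtain qy where qy: "\<forall>S. 0 \<le> qy S" "sum qy F = 1" "\<forall>k<d. y k = (\<Sum>S\<in>F. if k \<in> S then qy S else 0)"
    proof -
      have "card {k \<in> {..<d}. 0 < y k \<and> y k < 1} < card {i \<in> {..<d}. 0 < x i \<and> x i < 1}"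
        by (rule mono) (auto simp: y_def \<alpha>_def min_def j(2) j(2)[symmetric])
      moreover have "0 \<le> y k \<and> y k \<le> 1" if "k < d" for k
        using less.prems(1)[OF that] xi xj j(2) by (auto simp: y_def \<alpha>_def)
      moreover have "(\<Sum>k<d. y k) = real m" unfolding y_def by (rule shift)
      ultimately show thesis using less.hyps[of y] that unfolding F_def by blast
    qed
    obtain qz where qz: "\<forall>S. 0 \<le> qz S" "sum qz F = 1" "\<forall>k<d. z k = (\<Sum>S\<in>F. if k \<in> S then qz S else 0)"
    proof -
      have "card {k \<in> {..<d}. 0 < z k \<and> z k < 1} < card {i \<in> {..<d}. 0 < x i \<and> x i < 1}"
        by (rule mono) (auto simp: z_def \<beta>_def min_def j(2) j(2)[symmetric])
      moreover have "0 \<le> z k \<and> z k \<le> 1" if "k < d" for k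
        using less.prems(1)[OF that] xi xj j(2) by (auto simp: z_def \<beta>_def)
      moreover have "(\<Sum>k<d. z k) = real m" unfolding z_def using shift[of "- \<beta>"] by simp
      ultimately show thesis using less.hyps[of z] that unfolding F_def by blast
    qed
    \<comment> \<open>The weight for which the two opposite transfers cancel.\<close>
    define u where "u = \<beta> / (\<alpha> + \<beta>)"
    have u: "0 \<le> u" "0 \<le> 1 - u" using \<alpha>\<beta> by (auto simp: u_def)
    have "u * \<alpha> = (1 - u) * \<beta>" using \<alpha>\<beta> by (simp add: u_def field_simps)
    then have comb: "x k = u * y k + (1 - u) * z k" for k
      using j(2) by (auto simp: y_def z_def algebra_simps)
    define q where "q S = u * qy S + (1 - u) * qz S" for S
    have "sum q F = 1" by (simp add: q_def sum.distrib qy(2) qz(2) flip: sum_distrib_left)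
    moreover have "x k = (\<Sum>S\<in>F. if k \<in> S then q S else 0)" if "k < d" for k
    proof -
      have "(\<Sum>S\<in>F. if k \<in> S then q S else 0) =
          (\<Sum>S\<in>F. u * (if k \<in> S then qy S else 0) + (1 - u) * (if k \<in> S then qz S else 0))"
        by (intro sum.cong) (auto simp: q_def)
      also have "\<dots> = u * y k + (1 - u) * z k"
        using qy(3) qz(3) that by (simp add: sum.distrib flip: sum_distrib_left)
      finally show ?thesis using comb by simp
    qed
    moreover have "0 \<le> q S" for S using qy(1) qz(1) u by (simp add: q_def)
    ultimately show "\<exists>q. (\<forall>S. 0 \<le> q S) \<and> sum q F = 1 \<and> (\<forall>i<d. x i = (\<Sum>S\<in>F. if i \<in> S then q S else 0))"
      by (intro exI[of _ q]) auto
  qed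
qed

text \<open>Nonnegativity of the variance of \<open>s\<close> under the weights
  \<open>q\<close>.\<close>

lemma jensen_square:
  fixes q s :: "'a \<Rightarrow> real"
  assumes "finite F" "\<And>S. S \<in> F \<Longrightarrow> 0 \<le> q S" "sum q F = 1"
  shows "(\<Sum>S\<in>F. q S * s S)\<^sup>2 \<le> (\<Sum>S\<in>F. q S * (s S)\<^sup>2)"
proof -
  define \<mu> where "\<mu> = (\<Sum>S\<in>F. q S * s S)"
  have "0 \<le> (\<Sum>S\<in>F. q S * (s S - \<mu>)\<^sup>2)" using assms(2) by (intro sum_nonneg) auto
  also have "\<dots> = (\<Sum>S\<in>F. q S * (s S)\<^sup>2) - 2 * \<mu> * (\<Sum>S\<in>F. q S * s S) + \<mu>\<^sup>2 * sum q F"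
    by (simp add: power2_diff algebra_simps sum.distrib sum_subtractf sum_distrib_left sum_distrib_right)
  also have "\<dots> = (\<Sum>S\<in>F. q S * (s S)\<^sup>2) - \<mu>\<^sup>2"
    by (simp add: assms(3) power2_eq_square flip: \<mu>_def)
  finally show ?thesis by (simp add: \<mu>_def)
qed

text \<open>For an \<open>m\<close>-subset \<open>S\<close> of weight \<open>q S\<close> in the decomposition of \<open>m r\<^sup>2\<close>, the Kraus operator
  maps \<open>|i\<rangle>\<close>, \<open>i \<in> S\<close>, injectively to a multiple \<open>(q S / (m r\<^sub>i\<^sup>2))\<^sup>1\<^sup>/\<^sup>2\<close> of a basis vector, up to the
  phase that makes the coefficients of \<open>\<psi>\<close> nonnegative. The operators with index at least \<open>M\<close> only
  restore the trace on the coordinates with \<open>r\<^sub>i = 0\<close>.\<close>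

lemma SIO_overlap_ge:
  fixes r :: "nat \<Rightarrow> real"
  assumes m: "1 \<le> m" and r: "\<And>i. i < d \<Longrightarrow> 0 \<le> r i \<and> (r i)\<^sup>2 \<le> 1 / real m" "(\<Sum>i<d. (r i)\<^sup>2) = 1"
  obtains E where "E \<in> SIO d m \<inter> DIO d m"
    "(\<Sum>i<d. r i * cmod (\<psi> i))\<^sup>2 \<le> Re (coherent_overlap m (E (ket_bra2 d \<psi> \<psi>)))"
proof -
  have d: "1 \<le> d" using r(2) by (cases d) auto
  have m0: "0 < real m" using m by simp
  define F where "F = {S. S \<subseteq> {..<d} \<and> card S = m}"
  have finF: "finite F" by (rule finite_subset[of _ "Pow {..<d}"]) (auto simp: F_def)
  have "0 \<le> real m * (r i)\<^sup>2 \<and> real m * (r i)\<^sup>2 \<le> 1" if "i < d" for i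
    using r(1)[OF that] m0 by (simp add: pos_le_divide_eq mult.commute)
  moreover have "(\<Sum>i<d. real m * (r i)\<^sup>2) = real m" using r(2) by (simp flip: sum_distrib_left)
  ultimately obtain q where q: "\<forall>S. 0 \<le> q S" "sum q F = 1"
    "\<forall>i<d. real m * (r i)\<^sup>2 = (\<Sum>S\<in>F. if i \<in> S then q S else 0)"
    using hypersimplex_decomposition[of d "\<lambda>i. real m * (r i)\<^sup>2" m] unfolding F_def by blast
  define M where "M = card F"
  obtain h where h: "bij_betw h {..<M} F"
    using ex_bij_betw_nat_finite[OF finF] by (auto simp: M_def atLeast0LessThan)
  have "\<exists>p. inj_on p S \<and> p ` S \<subseteq> {..<m}" if "S \<in> F" for S
  proof -
    have "finite S" "card S = m" using that finite_subset[of S "{..<d}"] by (auto simp: F_def)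
    then obtain p where "bij_betw p S {0..<m}" using ex_bij_betw_finite_nat by blast
    then show ?thesis by (intro exI[of _ p]) (auto simp: bij_betw_def)
  qed
  then obtain p where p: "\<And>S. S \<in> F \<Longrightarrow> inj_on (p S) S" "\<And>S. S \<in> F \<Longrightarrow> p S ` S \<subseteq> {..<m}"
    by metis
  define ph where "ph i = (if \<psi> i = 0 then 1 else cnj (\<psi> i) / complex_of_real (cmod (\<psi> i)))" for i
  have ph: "cmod (ph i) = 1" "ph i * \<psi> i = complex_of_real (cmod (\<psi> i))" for i
  proof -
    show "cmod (ph i) = 1" by (simp add: ph_def norm_divide)
    have "cnj (\<psi> i) * \<psi> i = complex_of_real (cmod (\<psi> i)) * complex_of_real (cmod (\<psi> i))"
      by (metis complex_norm_square mult.commute of_real_mult of_real_power power2_eq_square)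
    then show "ph i * \<psi> i = complex_of_real (cmod (\<psi> i))" by (simp add: ph_def)
  qed
  define w where "w S i = (if i \<in> S \<and> r i \<noteq> 0 then sqrt (q S) / (sqrt (real m) * r i) else 0)" for S i
  define a where "a l i = (if l < M then complex_of_real (w (h l) i) * ph i
    else if i = l - M \<and> r i = 0 then 1 else 0)" for l i
  define \<pi> where "\<pi> l i = (if l < M then p (h l) i else 0)" for l i
  have hF: "h l \<in> F" if "l < M" for l using h that by (auto simp: bij_betw_def)
  have split: "(\<Sum>l<M + d. f l) = (\<Sum>l<M. f l) + (\<Sum>l<d. f (M + l))" for f :: "nat \<Rightarrow> real"
    by (induction d) (auto simp: add.assoc)
  have norm: "(\<Sum>l<M + d. (cmod (a l i))\<^sup>2) = 1" if i: "i < d" for i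
  proof -
    have "(\<Sum>l<M. (cmod (a l i))\<^sup>2) = (\<Sum>l<M. (w (h l) i)\<^sup>2)"
      by (simp add: a_def norm_mult ph(1))
    also have "\<dots> = (\<Sum>S\<in>F. (w S i)\<^sup>2)" by (rule sum.reindex_bij_betw[OF h])
    \<comment> \<open>The sets containing \<open>i\<close> have total weight \<open>m r_i^2\<close>,
      which the normalisation of \<open>w\<close> divides out.\<close>
    also have "\<dots> = (if r i = 0 then 0 else (\<Sum>S\<in>F. (if i \<in> S then q S else 0) / (real m * (r i)\<^sup>2)))"
      using q(1) by (auto simp: w_def power_divide power_mult_distrib intro!: sum.cong)
    also have "\<dots> = (if r i = 0 then 0 else 1)"
      unfolding sum_divide_distrib[symmetric] q(3)[rule_format, OF i, symmetric] using m0 by simp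
    finally have 1: "(\<Sum>l<M. (cmod (a l i))\<^sup>2) = (if r i = 0 then 0 else 1)" .
    have "(\<Sum>l<d. (cmod (a (M + l) i))\<^sup>2) = (\<Sum>l<d. if l = i then (if r i = 0 then 1 else 0) else 0)"
      by (intro sum.cong refl) (auto simp: a_def)
    also have "\<dots> = (if r i = 0 then 1 else 0)" using i by simp
    finally show ?thesis unfolding split 1 by simp
  qed
  have supp: "i \<in> h l" if "l < M" "a l i \<noteq> 0" for l i
    using that by (auto simp: a_def w_def split: if_splits)
  obtain E where E: "E \<in> SIO d m \<inter> DIO d m"
    "Re (coherent_overlap m (E (ket_bra2 d \<psi> \<psi>))) = (\<Sum>l<M + d. (cmod (\<Sum>i<d. a l i * \<psi> i))\<^sup>2) / real m"
  proof (rule partial_injection_channel[of m d "M + d" a \<pi>])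
    show "\<pi> l i < m" if "l < M + d" "i < d" "a l i \<noteq> 0" for l i
      using that m supp[of l i] p(2)[OF hF, of l] by (auto simp: \<pi>_def)
    show "i = j" if "l < M + d" "i < d" "j < d" "a l i \<noteq> 0" "a l j \<noteq> 0" "\<pi> l i = \<pi> l j" for l i j
    proof (cases "l < M")
      case True
      then show ?thesis
        using that supp[OF True] inj_onD[OF p(1)[OF hF[OF True]], of i j] by (simp add: \<pi>_def)
    next
      case False
      then show ?thesis using that by (auto simp: a_def split: if_splits)
    qed
  qed (use m d norm in auto)
  \<comment> \<open>Up to a factor depending on the weight of \<open>S\<close>, the amplitude
    produced by its Kraus operator. The mean of \<open>s\<close> under \<open>q\<close> is
    \<open>m\<close> times the target sum, so Jensen's inequality yields the claim.\<close>
  define s where "s S = (\<Sum>i<d. if i \<in> S \<and> r i \<noteq> 0 then cmod (\<psi> i) / r i else 0)" for S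
  have "(\<Sum>S\<in>F. q S * s S) = (\<Sum>S\<in>F. \<Sum>i<d. (if i \<in> S then q S else 0) * (if r i = 0 then 0 else cmod (\<psi> i) / r i))"
    unfolding s_def sum_distrib_left by (intro sum.cong refl) auto
  also have "\<dots> = (\<Sum>i<d. \<Sum>S\<in>F. (if i \<in> S then q S else 0) * (if r i = 0 then 0 else cmod (\<psi> i) / r i))"
    by (rule sum.swap)
  also have "\<dots> = (\<Sum>i<d. real m * (r i)\<^sup>2 * (if r i = 0 then 0 else cmod (\<psi> i) / r i))"
    using q(3) by (simp flip: sum_distrib_right)
  also have "\<dots> = real m * (\<Sum>i<d. r i * cmod (\<psi> i))"
    unfolding sum_distrib_left by (intro sum.cong refl) (auto simp: power2_eq_square)
  finally have mean: "(\<Sum>S\<in>F. q S * s S) = real m * (\<Sum>i<d. r i * cmod (\<psi> i))" .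
  have inner: "(cmod (\<Sum>i<d. a l i * \<psi> i))\<^sup>2 = q (h l) * (s (h l))\<^sup>2 / real m" if l: "l < M" for l
  proof -
    have "(\<Sum>i<d. a l i * \<psi> i) = (\<Sum>i<d. complex_of_real (w (h l) i * cmod (\<psi> i)))"
      using l by (intro sum.cong refl) (simp add: a_def mult.assoc ph(2))
    also have "\<dots> = complex_of_real (\<Sum>i<d. w (h l) i * cmod (\<psi> i))" by simp
    also have "(\<Sum>i<d. w (h l) i * cmod (\<psi> i)) = sqrt (q (h l)) / sqrt (real m) * s (h l)"
      unfolding s_def sum_distrib_left by (intro sum.cong refl) (auto simp: w_def)
    finally show ?thesis using q(1) by (simp add: power_mult_distrib power_divide del: of_real_mult of_real_divide)
  qed
  have "(real m * (\<Sum>i<d. r i * cmod (\<psi> i)))\<^sup>2 \<le> (\<Sum>S\<in>F. q S * (s S)\<^sup>2)"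
    unfolding mean[symmetric] using finF q(1,2) by (intro jensen_square) auto
  also have "\<dots> = (\<Sum>l<M. q (h l) * (s (h l))\<^sup>2)" by (rule sum.reindex_bij_betw[OF h, symmetric])
  also have "\<dots> = real m * (\<Sum>l<M. (cmod (\<Sum>i<d. a l i * \<psi> i))\<^sup>2)"
    using m0 by (simp add: inner sum_distrib_left)
  also have "\<dots> \<le> real m * (\<Sum>l<M + d. (cmod (\<Sum>i<d. a l i * \<psi> i))\<^sup>2)"
    using m0 by (intro mult_left_mono sum_mono2) auto
  finally have "(\<Sum>i<d. r i * cmod (\<psi> i))\<^sup>2 \<le> (\<Sum>l<M + d. (cmod (\<Sum>i<d. a l i * \<psi> i))\<^sup>2) / real m"
    using m0 by (simp add: power_mult_distrib power2_eq_square pos_le_divide_eq mult_ac)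
  then show thesis using E that by metis
qed

subsection \<open>Assisted distillation\<close>

lemma cauchy_schwarz_sum:
  fixes f g :: "'a \<Rightarrow> real"
  shows "(\<Sum>i\<in>A. f i * g i)\<^sup>2 \<le> (\<Sum>i\<in>A. (f i)\<^sup>2) * (\<Sum>i\<in>A. (g i)\<^sup>2)"
proof -
  have "\<bar>\<Sum>i\<in>A. f i * g i\<bar> \<le> (\<Sum>i\<in>A. \<bar>f i\<bar> * \<bar>g i\<bar>)"
    by (rule order_trans[OF sum_abs]) (simp add: abs_mult)
  also have "\<dots> \<le> L2_set f A * L2_set g A" by (rule L2_set_mult_ineq)
  finally have "\<bar>\<Sum>i\<in>A. f i * g i\<bar>\<^sup>2 \<le> (L2_set f A * L2_set g A)\<^sup>2" by (rule power_mono) simp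
  also have "\<dots> = (\<Sum>i\<in>A. (f i)\<^sup>2) * (\<Sum>i\<in>A. (g i)\<^sup>2)"
    by (simp add: L2_set_def power_mult_distrib sum_nonneg)
  finally show ?thesis by simp
qed

lemma mat_trace_gram_eq_1_iff:
  assumes "W \<in> carrier_mat d N"
  shows "mat_trace (W * W\<dagger>) = 1 \<longleftrightarrow> (\<Sum>k<N. \<Sum>i<d. (cmod (W $$ (i, k)))\<^sup>2) = 1"
  unfolding mat_trace_gram[OF assms] of_real_eq_1_iff ..

lemma ket_bra_eq_ket_bra2: "\<psi> \<in> carrier_vec d \<Longrightarrow> ket_bra \<psi> = ket_bra2 d (vec_index \<psi>) (vec_index \<psi>)"
  by (rule eq_matI) (auto simp: ket_bra_def ket_bra2_def)

lemma assisted_value_eq: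
  assumes "\<And>k. k < N \<Longrightarrow> A k \<in> carrier_mat m m"
  shows "Re (hs_inner (mat_comb m N p A) (ket_bra (max_coherent m))) =
    (\<Sum>k<N. p k * Re (coherent_overlap m (A k)))"
proof -
  have dim: "dim_row (A k) = m" "dim_col (A k) = m" if "k < N" for k
    using assms[OF that] by auto
  have "(\<Sum>i<m. \<Sum>j<m. mat_comb m N p A $$ (i, j)) =
      (\<Sum>i<m. \<Sum>j<m. \<Sum>k<N. complex_of_real (p k) * A k $$ (i, j))"
    by (intro sum.cong refl) (auto simp: mat_comb_def mat_sum_index dim intro!: sum.cong)
  also have "\<dots> = (\<Sum>i<m. \<Sum>k<N. \<Sum>j<m. complex_of_real (p k) * A k $$ (i, j))"
    by (intro sum.cong refl sum.swap)
  also have "\<dots> = (\<Sum>k<N. \<Sum>i<m. \<Sum>j<m. complex_of_real (p k) * A k $$ (i, j))"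
    by (rule sum.swap)
  finally have "coherent_overlap m (mat_comb m N p A) = (\<Sum>k<N. complex_of_real (p k) * coherent_overlap m (A k))"
    by (simp add: coherent_overlap_def sum_distrib_left sum_divide_distrib)
  then show ?thesis
    by (subst hs_inner_max_coherent) (auto simp: mat_comb_def)
qed

lemma assisted_valuesI:
  assumes "pure_decomposition d \<rho> N p \<psi>" "\<And>k. k < N \<Longrightarrow> E k \<in> Ops d m" "Ops d m \<subseteq> MIO d m"
  shows "(\<Sum>k<N. p k * Re (coherent_overlap m (E k (ket_bra (\<psi> k))))) \<in> assisted_values Ops d \<rho> m"
proof -
  have "E k (ket_bra (\<psi> k)) \<in> carrier_mat m m" if "k < N" for k
  proof -
    have "E k \<in> channels d m" using assms(2)[OF that] assms(3) by (auto simp: MIO_def)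
    moreover have "ket_bra (\<psi> k) \<in> carrier_mat d d"
      using assms(1) that by (auto simp: pure_decomposition_def unit_ket_def ket_bra_def)
    ultimately show ?thesis by (auto simp: channels_def)
  qed
  from assisted_value_eq[of N "\<lambda>k. E k (ket_bra (\<psi> k))" m p, OF this]
  show ?thesis using assms(1,2) unfolding assisted_values_def by (auto intro!: exI)
qed

text \<open>All that is retained of the channels. It feeds both the comparison with flat states and
  the bound \<open>d/m\<close> valid for every \<open>m\<close>.\<close>

lemma assisted_values_overlap_bound:
  assumes x: "x \<in> assisted_values Ops d \<rho> m" and Ops: "Ops d m \<subseteq> MIO d m" and m: "1 \<le> m"
  obtains N p \<psi> r where "pure_decomposition d \<rho> N p \<psi>"
    "\<And>k i. k < N \<Longrightarrow> i < d \<Longrightarrow> 0 \<le> r k i \<and> (r k i)\<^sup>2 \<le> 1 / real m"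
    "\<And>k. k < N \<Longrightarrow> (\<Sum>i<d. (r k i)\<^sup>2) \<le> 1"
    "x \<le> (\<Sum>k<N. p k * (\<Sum>i<d. r k i * cmod (\<psi> k $ i))\<^sup>2)"
proof -
  obtain N p \<psi> \<Lambda> where pd: "pure_decomposition d \<rho> N p \<psi>" and \<Lambda>: "\<forall>k<N. \<Lambda> k \<in> Ops d m"
    and x': "x = Re (hs_inner (mat_comb m N p (\<lambda>i. \<Lambda> i (ket_bra (\<psi> i)))) (ket_bra (max_coherent m)))"
    using x by (auto simp: assisted_values_def)
  have p: "0 \<le> p k" and \<psi>: "\<psi> k \<in> carrier_vec d" if "k < N" for k
    using pd that by (auto simp: pure_decomposition_def prob_weights_def unit_ket_def)
  have mio: "\<Lambda> k \<in> MIO d m" if "k < N" for k using \<Lambda> that Ops by auto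
  have "\<Lambda> k (ket_bra (\<psi> k)) \<in> carrier_mat m m" if "k < N" for k
    using mio[OF that] \<psi>[OF that] by (auto simp: MIO_def channels_def ket_bra_def)
  then have x'': "x = (\<Sum>k<N. p k * Re (coherent_overlap m (\<Lambda> k (ket_bra (\<psi> k)))))"
    unfolding x' by (rule assisted_value_eq)
  have "\<forall>k\<in>{..<N}. \<exists>r. (\<forall>i<d. 0 \<le> r i \<and> (r i)\<^sup>2 \<le> 1 / real m) \<and> (\<Sum>i<d. (r i)\<^sup>2) \<le> 1 \<and>
      Re (coherent_overlap m (\<Lambda> k (ket_bra (\<psi> k)))) \<le> (\<Sum>i<d. r i * cmod (\<psi> k $ i))\<^sup>2"
  proof
    fix k assume "k \<in> {..<N}"
    then have k: "k < N" by simp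
    show "\<exists>r. (\<forall>i<d. 0 \<le> r i \<and> (r i)\<^sup>2 \<le> 1 / real m) \<and> (\<Sum>i<d. (r i)\<^sup>2) \<le> 1 \<and>
      Re (coherent_overlap m (\<Lambda> k (ket_bra (\<psi> k)))) \<le> (\<Sum>i<d. r i * cmod (\<psi> k $ i))\<^sup>2"
      unfolding ket_bra_eq_ket_bra2[OF \<psi>[OF k]] by (rule MIO_overlap_le[OF mio[OF k] m])
  qed
  from bchoice[OF this] obtain r where r: "\<And>k. k < N \<Longrightarrow> (\<forall>i<d. 0 \<le> r k i \<and> (r k i)\<^sup>2 \<le> 1 / real m) \<and> (\<Sum>i<d. (r k i)\<^sup>2) \<le> 1 \<and>
      Re (coherent_overlap m (\<Lambda> k (ket_bra (\<psi> k)))) \<le> (\<Sum>i<d. r k i * cmod (\<psi> k $ i))\<^sup>2"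
    by blast
  have "x \<le> (\<Sum>k<N. p k * (\<Sum>i<d. r k i * cmod (\<psi> k $ i))\<^sup>2)"
    unfolding x'' using r p by (intro sum_mono mult_left_mono) auto
  then show thesis using that[OF pd, of r] r by blast
qed

text \<open>The weights \<open>p\<^sub>k h\<^sub>k\<^sup>2 / H\<close> of the flat states are the ones for which the Cauchy-Schwarz
  inequality in the converse direction is an equality.\<close>

lemma assisted_value_le_fidelity:
  assumes x: "x \<in> assisted_values Ops d \<rho> m" and Ops: "Ops d m \<subseteq> MIO d m"
    and m: "m \<in> {1..d}" and \<rho>: "\<rho> \<in> density d"
  shows "\<exists>\<omega>\<in>flat_states d m. x \<le> fidelity \<rho> \<omega>"
proof -
  have m1: "1 \<le> m" using m by simp
  obtain N p \<psi> r where pd: "pure_decomposition d \<rho> N p \<psi>"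
    and r: "\<And>k i. k < N \<Longrightarrow> i < d \<Longrightarrow> 0 \<le> r k i \<and> (r k i)\<^sup>2 \<le> 1 / real m"
    "\<And>k. k < N \<Longrightarrow> (\<Sum>i<d. (r k i)\<^sup>2) \<le> 1"
    "x \<le> (\<Sum>k<N. p k * (\<Sum>i<d. r k i * cmod (\<psi> k $ i))\<^sup>2)"
    by (rule assisted_values_overlap_bound[where Ops = Ops, OF x Ops m1]) (rule that)
  have p: "\<And>k. k < N \<Longrightarrow> 0 \<le> p k" "(\<Sum>k<N. p k) = 1" and unit: "\<And>k. k < N \<Longrightarrow> unit_ket d (\<psi> k)"
    using pd by (auto simp: pure_decomposition_def prob_weights_def)
  \<comment> \<open>Flat kets need norm exactly 1; raising the amplitudes only increases the
    bound.\<close>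
  have "\<forall>k<N. \<exists>s. (\<forall>i<d. r k i \<le> s i \<and> (s i)\<^sup>2 \<le> 1 / real m) \<and> (\<Sum>i<d. (s i)\<^sup>2) = 1"
    using flat_amplitudes_extend[OF r(1,2) m] by metis
  then obtain s where s: "\<And>k i. k < N \<Longrightarrow> i < d \<Longrightarrow> r k i \<le> s k i \<and> (s k i)\<^sup>2 \<le> 1 / real m"
    "\<And>k. k < N \<Longrightarrow> (\<Sum>i<d. (s k i)\<^sup>2) = 1"
    by metis
  define h where "h k = (\<Sum>i<d. s k i * cmod (\<psi> k $ i))" for k
  define H where "H = (\<Sum>k<N. p k * (h k)\<^sup>2)"
  have "(\<Sum>i<d. r k i * cmod (\<psi> k $ i))\<^sup>2 \<le> (h k)\<^sup>2" if k: "k < N" for k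
  proof (rule power_mono)
    show "(\<Sum>i<d. r k i * cmod (\<psi> k $ i)) \<le> h k"
      unfolding h_def using s(1)[OF k] by (intro sum_mono mult_right_mono) auto
    show "0 \<le> (\<Sum>i<d. r k i * cmod (\<psi> k $ i))" using r(1)[OF k] by (intro sum_nonneg) auto
  qed
  then have "(\<Sum>k<N. p k * (\<Sum>i<d. r k i * cmod (\<psi> k $ i))\<^sup>2) \<le> H"
    unfolding H_def using p(1) by (intro sum_mono mult_left_mono) auto
  with r(3) have xH: "x \<le> H" by (rule order_trans)
  have H0: "0 \<le> H" unfolding H_def using p(1) by (intro sum_nonneg) auto
  show ?thesis
  proof (cases "H = 0")
    \<comment> \<open>The value is then at most 0, and any flat state suffices.\<close>
    case True
    obtain \<omega> where "\<omega> \<in> flat_states d m"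
      using fidelity_flat_states_has_max[OF \<rho> m] by (auto simp: has_max_def)
    then show ?thesis using xH True fidelity_nonneg[of \<rho> \<omega>] by (intro bexI[of _ \<omega>]) auto
  next
    case False
    then have Hp: "0 < H" using H0 by simp
    define ph where "ph z = (if z = 0 then 1 else z / complex_of_real (cmod z))" for z
    have ph: "cmod (ph z) = 1" "cnj z * ph z = complex_of_real (cmod z)" for z
    proof -
      show "cmod (ph z) = 1" by (simp add: ph_def norm_divide)
      have "cnj z * z = complex_of_real (cmod z) * complex_of_real (cmod z)"
        by (metis complex_norm_square mult.commute of_real_mult of_real_power power2_eq_square)
      then show "cnj z * ph z = complex_of_real (cmod z)" by (simp add: ph_def)
    qed
    define c where "c k = sqrt (p k) * h k / sqrt H" for k
    \<comment> \<open>Column \<open>k\<close> has the amplitudes \<open>s k\<close>, the phases of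
      \<open>\<psi> k\<close> and squared norm \<open>p k * (h k)^2 / H\<close>.\<close>
    define W where "W = mat d N (\<lambda>(i, k). complex_of_real (c k * s k i) * ph (\<psi> k $ i))"
    have W: "W \<in> carrier_mat d N" by (simp add: W_def)
    have c2: "(c k)\<^sup>2 = p k * (h k)\<^sup>2 / H" if "k < N" for k
      using p(1)[OF that] Hp by (simp add: c_def power_mult_distrib power_divide)
    have W2: "(cmod (W $$ (i, k)))\<^sup>2 = (c k)\<^sup>2 * (s k i)\<^sup>2" if "i < d" "k < N" for i k
      using that by (simp add: W_def norm_mult ph(1) power_mult_distrib)
    have Wcol: "(\<Sum>i<d. (cmod (W $$ (i, k)))\<^sup>2) = (c k)\<^sup>2" if "k < N" for k
      using that s(2) by (simp add: W2 flip: sum_distrib_left)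
    have "flat_cols (1 / real m) W"
      unfolding flat_cols_def
    proof (intro allI impI)
      fix k i assume "k < dim_col W" "i < dim_row W"
      then have ki: "k < N" "i < d" using W by auto
      have "(c k)\<^sup>2 * (s k i)\<^sup>2 \<le> (c k)\<^sup>2 * (1 / real m)"
        using s(1)[OF ki] by (intro mult_left_mono) auto
      then show "(cmod (W $$ (i, k)))\<^sup>2 \<le> 1 / real m * (\<Sum>j<dim_row W. (cmod (W $$ (j, k)))\<^sup>2)"
        using W Wcol[OF ki(1)] W2[OF ki(2,1)] by simp
    qed
    moreover have "mat_trace (W * W\<dagger>) = 1"
    proof -
      have "(\<Sum>k<N. \<Sum>i<d. (cmod (W $$ (i, k)))\<^sup>2) = (\<Sum>k<N. p k * (h k)\<^sup>2 / H)"
        using Wcol c2 by simp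
      also have "\<dots> = 1" using Hp by (simp add: H_def flip: sum_divide_distrib)
      finally show ?thesis unfolding mat_trace_gram_eq_1_iff[OF W] .
    qed
    ultimately have mem: "W * W\<dagger> \<in> flat_states d m"
      unfolding flat_states_iff using flat_gramI[OF W] by blast
    define P where "P = ket_mat d N p \<psi>"
    have P: "P \<in> carrier_mat d N" by (simp add: P_def)
    have "\<rho> = P * P\<dagger>"
      using pd p(1) mat_comb_ket_bra[of N p \<psi> d "\<lambda>k. ket_bra (\<psi> k)"] unit
      by (auto simp: pure_decomposition_def P_def unit_ket_def)
    then have le: "psd d (\<rho> - P * P\<dagger>)"
      using psd_diff_self[OF psd_carrier[OF densityD(1)[OF \<rho>]]] by simp
    have "Re (mat_trace (P\<dagger> * W)) = (\<Sum>k<N. \<Sum>i<d. sqrt (p k) * c k * (s k i * cmod (\<psi> k $ i)))"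
      unfolding mat_trace_adjoint_mult[OF P W]
    proof (intro sum.cong refl)
      fix k i assume "k \<in> {..<N}" "i \<in> {..<d}"
      then have "cnj (P $$ (i, k)) * W $$ (i, k) =
          complex_of_real (sqrt (p k) * (c k * s k i)) * (cnj (\<psi> k $ i) * ph (\<psi> k $ i))"
        by (simp add: P_def ket_mat_def W_def)
      then show "Re (cnj (P $$ (i, k)) * W $$ (i, k)) = sqrt (p k) * c k * (s k i * cmod (\<psi> k $ i))"
        unfolding ph(2) by (simp flip: of_real_mult)
    qed
    \<comment> \<open>Each column contributes \<open>p k * (h k)^2 / sqrt H\<close>, and these add
      up to \<open>H / sqrt H\<close>.\<close>
    also have "\<dots> = (\<Sum>k<N. p k * (h k)\<^sup>2 / sqrt H)"
    proof (intro sum.cong refl)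
      fix k assume "k \<in> {..<N}"
      then have pk: "sqrt (p k) * sqrt (p k) = p k" using p(1)[of k] by simp
      have "(\<Sum>i<d. sqrt (p k) * c k * (s k i * cmod (\<psi> k $ i))) = sqrt (p k) * c k * h k"
        unfolding h_def by (rule sum_distrib_left[symmetric])
      also have "\<dots> = (sqrt (p k) * sqrt (p k)) * (h k)\<^sup>2 / sqrt H"
        unfolding c_def by (simp only: power2_eq_square times_divide_eq_right times_divide_eq_left mult_ac)
      finally show "(\<Sum>i<d. sqrt (p k) * c k * (s k i * cmod (\<psi> k $ i))) = p k * (h k)\<^sup>2 / sqrt H"
        unfolding pk .
    qed
    also have "\<dots> = sqrt H"
      using Hp by (simp add: H_def[symmetric] real_div_sqrt flip: sum_divide_distrib)
    finally have "(sqrt H)\<^sup>2 \<le> fidelity \<rho> (W * W\<dagger>)"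
      using H0 by (intro fidelity_gram_ge[OF densityD(1)[OF \<rho>] W P le]) auto
    then show ?thesis using mem xH H0 by (intro bexI[of _ "W * W\<dagger>"]) auto
  qed
qed

text \<open>Take a flat factor \<open>W\<close> and an optimal \<open>P\<close> from Uhlmann's
  theorem. The columns of \<open>P\<close>, completed to a decomposition of \<open>\<rho>\<close>,
  are the kets; the normalised moduli of the matching column of \<open>W\<close> select the channel
  for each ket. Cauchy-Schwarz over the columns finishes.\<close>

lemma fidelity_le_assisted_value:
  assumes \<omega>: "\<omega> \<in> flat_states d m" and Ops: "SIO d m \<inter> DIO d m \<subseteq> Ops d m" "Ops d m \<subseteq> MIO d m"
    and m: "1 \<le> m" and \<rho>: "\<rho> \<in> density d"
  shows "\<exists>x\<in>assisted_values Ops d \<rho> m. fidelity \<rho> \<omega> \<le> x"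
proof -
  have d: "1 \<le> d" using density_dim_pos[OF \<rho>] by simp
  note psd = densityD(1)[OF \<rho>]
  define N where "N = 2 * d * d"
  obtain W where W: "W \<in> carrier_mat d N" "flat_cols (1 / real m) W" "\<omega> = W * W\<dagger>"
    "mat_trace (W * W\<dagger>) = 1"
    using \<omega> by (auto simp: flat_states_iff flat_gram_def N_def)
  obtain P where P: "P \<in> carrier_mat d N" "psd d (\<rho> - P * P\<dagger>)"
    "Re (mat_trace (P\<dagger> * W)) = sqrt (fidelity \<rho> (W * W\<dagger>))"
    using fidelity_gram_attained[OF psd W(1)] by metis
  define Q where "Q = psd_sqrt (\<rho> - P * P\<dagger>)"
  have Q: "Q \<in> carrier_mat d d" "Q * Q\<dagger> = \<rho> - P * P\<dagger>"
    using psd_sqrt[OF P(2)] psd_carrier psd_adjoint unfolding Q_def by auto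
  \<comment> \<open>The columns of \<open>Q\<close> supply the missing part
    \<open>\<rho> - P P\<dagger>\<close>.\<close>
  define V where "V = mat d (N + d) (\<lambda>(i, k). if k < N then P $$ (i, k) else Q $$ (i, k - N))"
  have V: "V \<in> carrier_mat d (N + d)" by (simp add: V_def)
  have split: "(\<Sum>k<N + n. f k) = (\<Sum>k<N. f k) + (\<Sum>k<n. f (N + k))" for f :: "nat \<Rightarrow> complex" and n
    by (induction n) (auto simp: add.assoc)
  have VV: "V * V\<dagger> = \<rho>"
  proof (rule eq_matI)
    note \<rho>c = psd_carrier[OF psd]
    show "dim_row (V * V\<dagger>) = dim_row \<rho>" "dim_col (V * V\<dagger>) = dim_col \<rho>" using V \<rho>c by auto
    fix i j assume "i < dim_row \<rho>" "j < dim_col \<rho>"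
    then have ij: "i < d" "j < d" using \<rho>c by auto
    have "(V * V\<dagger>) $$ (i, j) = (P * P\<dagger>) $$ (i, j) + (Q * Q\<dagger>) $$ (i, j)"
      unfolding gram_index[OF V ij] gram_index[OF P(1) ij] gram_index[OF Q(1) ij] split
      using ij by (simp add: V_def)
    also have "\<dots> = \<rho> $$ (i, j)" unfolding Q(2) using P(1) \<rho>c ij by simp
    finally show "(V * V\<dagger>) $$ (i, j) = \<rho> $$ (i, j)" .
  qed
  have "mat_trace (V * V\<dagger>) = 1" using VV densityD(2)[OF \<rho>] by simp
  then obtain p \<psi> where pd: "pure_decomposition d \<rho> (N + d) p \<psi>"
    and V\<psi>: "\<And>k i. k < N + d \<Longrightarrow> i < d \<Longrightarrow> V $$ (i, k) = complex_of_real (sqrt (p k)) * \<psi> k $ i"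
    using gram_pure_decomposition[OF V] VV by metis
  have p: "0 \<le> p k" and \<psi>: "\<psi> k \<in> carrier_vec d" if "k < N + d" for k
    using pd that by (auto simp: pure_decomposition_def prob_weights_def unit_ket_def)
  define n where "n k = (\<Sum>i<d. (cmod (W $$ (i, k)))\<^sup>2)" for k
  have n0: "0 \<le> n k" for k by (simp add: n_def sum_nonneg)
  define r where "r k i = cmod (W $$ (i, k)) / sqrt (n k)" for k i
  \<comment> \<open>Kets from \<open>Q\<close>, and those facing a zero column of \<open>W\<close>,
    receive the filler channel.\<close>
  have "\<exists>E. E \<in> SIO d m \<inter> DIO d m \<and> (k < N \<longrightarrow> n k \<noteq> 0 \<longrightarrow>
      (\<Sum>i<d. r k i * cmod (\<psi> k $ i))\<^sup>2 \<le> Re (coherent_overlap m (E (ket_bra (\<psi> k)))))" if k: "k < N + d" for k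
  proof (cases "k < N \<and> n k \<noteq> 0")
    case True
    then have nk: "0 < n k" using n0[of k] by simp
    have r2: "(r k i)\<^sup>2 = (cmod (W $$ (i, k)))\<^sup>2 / n k" for i
      using nk by (simp add: r_def power_divide)
    have "(r k i)\<^sup>2 \<le> 1 / real m" if "i < d" for i
    proof -
      have "(cmod (W $$ (i, k)))\<^sup>2 \<le> 1 / real m * n k"
        using W(1,2) True that by (auto simp: flat_cols_def n_def)
      then show ?thesis unfolding r2 using nk by (simp add: pos_divide_le_eq)
    qed
    moreover have "0 \<le> r k i" for i by (simp add: r_def n0)
    moreover have "(\<Sum>i<d. (r k i)\<^sup>2) = 1"
      unfolding r2 sum_divide_distrib[symmetric] using nk by (simp add: n_def)
    ultimately show ?thesis
      using SIO_overlap_ge[OF m, of d "r k" "vec_index (\<psi> k)"] ket_bra_eq_ket_bra2[OF \<psi>[OF k]] by metis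
  next
    case False
    then show ?thesis using free_op_exists[OF m d] by metis
  qed
  then obtain E where E: "\<And>k. k < N + d \<Longrightarrow> E k \<in> SIO d m \<inter> DIO d m"
    "\<And>k. k < N \<Longrightarrow> n k \<noteq> 0 \<Longrightarrow>
      (\<Sum>i<d. r k i * cmod (\<psi> k $ i))\<^sup>2 \<le> Re (coherent_overlap m (E k (ket_bra (\<psi> k))))"
    by (metis trans_less_add1)
  define v where "v k = Re (coherent_overlap m (E k (ket_bra (\<psi> k))))" for k
  have v0: "0 \<le> v k" if k: "k < N + d" for k
  proof -
    have "E k \<in> channels d m" using E(1)[OF k] by (auto simp: SIO_def)
    moreover have "psd d (ket_bra (\<psi> k))"
    proof -
      have "ket_bra (\<psi> k) = mat d 1 (\<lambda>(i, j). \<psi> k $ i) * (mat d 1 (\<lambda>(i, j). \<psi> k $ i))\<dagger>"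
        using \<psi>[OF k] by (intro eq_matI) (auto simp: ket_bra_def gram_index[of _ d 1])
      then show ?thesis using psd_gram[of "mat d 1 (\<lambda>(i, j). \<psi> k $ i)" d 1] by simp
    qed
    ultimately show ?thesis
      using coherent_overlap_nonneg[OF channel_psd] by (auto simp: v_def less_eq_complex_def)
  qed
  have col_le: "(\<Sum>i<d. Re (cnj (P $$ (i, k)) * W $$ (i, k))) \<le> sqrt (n k) * sqrt (p k * v k)" if k: "k < N" for k
  proof -
    have kd: "k < N + d" using k by simp
    have "(\<Sum>i<d. Re (cnj (P $$ (i, k)) * W $$ (i, k))) \<le> (\<Sum>i<d. cmod (P $$ (i, k)) * cmod (W $$ (i, k)))"
      by (intro sum_mono order_trans[OF complex_Re_le_cmod]) (simp add: norm_mult)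
    also have "\<dots> = (\<Sum>i<d. sqrt (n k) * sqrt (p k) * (r k i * cmod (\<psi> k $ i)))"
    proof (intro sum.cong refl)
      fix i assume "i \<in> {..<d}"
      then have i: "i < d" by simp
      have "P $$ (i, k) = complex_of_real (sqrt (p k)) * \<psi> k $ i"
        using V\<psi>[OF kd i] i k by (simp add: V_def)
      moreover have "cmod (W $$ (i, k)) = sqrt (n k) * r k i"
      proof (cases "n k = 0")
        case True
        then have "W $$ (i, k) = 0" using i by (auto simp: n_def sum_nonneg_eq_0_iff)
        then show ?thesis using True by simp
      qed (simp add: r_def)
      ultimately show "cmod (P $$ (i, k)) * cmod (W $$ (i, k)) = sqrt (n k) * sqrt (p k) * (r k i * cmod (\<psi> k $ i))"
        using p[OF kd] by (simp add: norm_mult mult_ac)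
    qed
    also have "\<dots> = sqrt (n k) * sqrt (p k) * (\<Sum>i<d. r k i * cmod (\<psi> k $ i))"
      by (simp add: sum_distrib_left)
    also have "\<dots> \<le> sqrt (n k) * sqrt (p k * v k)"
    proof (cases "n k = 0")
      case False
      have "(\<Sum>i<d. r k i * cmod (\<psi> k $ i)) \<le> sqrt (v k)"
        using E(2)[OF k False] unfolding v_def by (rule real_le_rsqrt)
      then show ?thesis
        using n0 p[OF kd] by (simp add: real_sqrt_mult mult.assoc mult_left_mono)
    qed simp
    finally show ?thesis .
  qed
  define x where "x = (\<Sum>k<N + d. p k * v k)"
  have n1: "(\<Sum>k<N. n k) = 1"
    using W(4) mat_trace_gram_eq_1_iff[OF W(1)] unfolding n_def by simp
  have "sqrt (fidelity \<rho> \<omega>) \<le> (\<Sum>k<N. sqrt (n k) * sqrt (p k * v k))"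
    unfolding W(3) P(3)[symmetric] mat_trace_adjoint_mult[OF P(1) W(1)] using col_le by (intro sum_mono) auto
  then have "(sqrt (fidelity \<rho> \<omega>))\<^sup>2 \<le> (\<Sum>k<N. sqrt (n k) * sqrt (p k * v k))\<^sup>2"
    by (intro power_mono) (simp_all add: fidelity_nonneg)
  \<comment> \<open>The weights \<open>n k\<close> sum to 1, so the first factor disappears.\<close>
  also have "\<dots> \<le> (\<Sum>k<N. (sqrt (n k))\<^sup>2) * (\<Sum>k<N. (sqrt (p k * v k))\<^sup>2)"
    by (rule cauchy_schwarz_sum)
  also have "\<dots> = (\<Sum>k<N. p k * v k)"
    using n0 p v0 by (simp add: n1)
  also have "\<dots> \<le> x"
    unfolding x_def using p v0 by (intro sum_mono2) auto
  finally have "fidelity \<rho> \<omega> \<le> x" by (simp add: fidelity_nonneg)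
  moreover have "x \<in> assisted_values Ops d \<rho> m"
    unfolding x_def v_def using E(1) Ops(1) by (intro assisted_valuesI[where Ops = Ops, OF pd _ Ops(2)]) blast
  ultimately show ?thesis by blast
qed

text \<open>Lets an upper bound on the values pass to their supremum when \<open>m > d\<close>,
  where attainment has not been established.\<close>

lemma assisted_values_nonempty:
  assumes Ops: "SIO d m \<inter> DIO d m \<subseteq> Ops d m" "Ops d m \<subseteq> MIO d m" and m: "1 \<le> m" and \<rho>: "\<rho> \<in> density d"
  shows "assisted_values Ops d \<rho> m \<noteq> {}"
proof -
  obtain W where W: "W \<in> carrier_mat d (2 * d * d)" "\<rho> = W * W\<dagger>"
    using density_flat_gram_1[OF \<rho>] by (auto simp: flat_gram_def)
  then obtain p \<psi> where pd: "pure_decomposition d \<rho> (2 * d * d) p \<psi>"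
    using gram_pure_decomposition[OF W(1)] densityD(2)[OF \<rho>] by metis
  obtain E where "E \<in> SIO d m \<inter> DIO d m"
    using free_op_exists[OF m] density_dim_pos[OF \<rho>] by (metis One_nat_def Suc_leI)
  then have "E \<in> Ops d m" using Ops(1) by blast
  from assisted_valuesI[where Ops = Ops and E = "\<lambda>_. E", OF pd this Ops(2)] show ?thesis by blast
qed

text \<open>Cauchy-Schwarz with each of the \<open>d\<close> squared amplitudes at most
  \<open>1/m\<close>; it has content for \<open>m > d\<close>.\<close>

lemma assisted_value_le_dim:
  assumes x: "x \<in> assisted_values Ops d \<rho> m" and Ops: "Ops d m \<subseteq> MIO d m" and m: "1 \<le> m"
  shows "x \<le> real d / real m"
proof -
  obtain N p \<psi> r where pd: "pure_decomposition d \<rho> N p \<psi>"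
    and r: "\<And>k i. k < N \<Longrightarrow> i < d \<Longrightarrow> 0 \<le> r k i \<and> (r k i)\<^sup>2 \<le> 1 / real m"
    "x \<le> (\<Sum>k<N. p k * (\<Sum>i<d. r k i * cmod (\<psi> k $ i))\<^sup>2)"
    by (rule assisted_values_overlap_bound[where Ops = Ops, OF x Ops m]) (rule that)
  have p: "\<And>k. k < N \<Longrightarrow> 0 \<le> p k" "(\<Sum>k<N. p k) = 1" and unit: "\<And>k. k < N \<Longrightarrow> unit_ket d (\<psi> k)"
    using pd by (auto simp: pure_decomposition_def prob_weights_def)
  have bound: "(\<Sum>i<d. r k i * cmod (\<psi> k $ i))\<^sup>2 \<le> real d / real m" if k: "k < N" for k
  proof -
    have "(\<Sum>i<d. r k i * cmod (\<psi> k $ i))\<^sup>2 \<le> (\<Sum>i<d. (r k i)\<^sup>2) * (\<Sum>i<d. (cmod (\<psi> k $ i))\<^sup>2)"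
      by (rule cauchy_schwarz_sum)
    also have "\<dots> = (\<Sum>i<d. (r k i)\<^sup>2)" using unit[OF k] by (simp add: unit_ket_sum)
    also have "\<dots> \<le> (\<Sum>i<d. 1 / real m)" using r(1)[OF k] by (intro sum_mono) auto
    finally show ?thesis by simp
  qed
  have "x \<le> (\<Sum>k<N. p k * (real d / real m))"
    by (rule order_trans[OF r(2)]) (intro sum_mono mult_left_mono, auto simp: bound p(1))
  also have "\<dots> = real d / real m" unfolding sum_distrib_right[symmetric] p(2) by simp
  finally show ?thesis .
qed

section \<open>The fidelity formula and the rate\<close>

lemma assisted_fidelity_eq:
  assumes \<rho>: "\<rho> \<in> density d" and Ops: "SIO d m \<inter> DIO d m \<subseteq> Ops d m" "Ops d m \<subseteq> MIO d m" and m: "m \<in> {1..d}"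
  shows "has_max (assisted_values Ops d \<rho> m)"
    "assisted_fidelity Ops d \<rho> m = (SUP \<omega>\<in>flat_states d m. fidelity \<rho> \<omega>)"
proof -
  define M where "M = (SUP \<omega>\<in>flat_states d m. fidelity \<rho> \<omega>)"
  note hm = has_max_Sup[OF fidelity_flat_states_has_max[OF \<rho> m]]
  have M: "M \<in> fidelity \<rho> ` flat_states d m" "\<And>\<omega>. \<omega> \<in> flat_states d m \<Longrightarrow> fidelity \<rho> \<omega> \<le> M"
    using hm by (auto simp: M_def)
  have le: "x \<le> M" if "x \<in> assisted_values Ops d \<rho> m" for x
    using assisted_value_le_fidelity[where Ops = Ops, OF that Ops(2) m \<rho>] M(2) by force
  obtain x where x: "x \<in> assisted_values Ops d \<rho> m" "M \<le> x"
    using M(1) fidelity_le_assisted_value[where Ops = Ops, OF _ Ops _ \<rho>] m by auto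
  then have "x = M" using le by force
  then have mem: "M \<in> assisted_values Ops d \<rho> m" using x(1) by simp
  show "has_max (assisted_values Ops d \<rho> m)" unfolding has_max_def using mem le by blast
  show "assisted_fidelity Ops d \<rho> m = M"
    unfolding assisted_fidelity_def by (rule cSup_eq_maximum[OF mem le])
qed

text \<open>Summing the flatness inequality over the \<open>d\<close> rows and all columns. It
  places the floor of \<open>1/\<tau>\<close> within the range \<open>1..d\<close>.\<close>

lemma flat_gram_ge_inverse_dim:
  assumes "flat_gram d t \<omega>" "mat_trace \<omega> = 1"
  shows "1 \<le> real d * t"
proof -
  obtain W where W: "W \<in> carrier_mat d (2 * d * d)" "flat_cols t W" "\<omega> = W * W\<dagger>"
    using assms by (auto simp: flat_gram_def)
  define n where "n k = (\<Sum>i<d. (cmod (W $$ (i, k)))\<^sup>2)" for k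
  have "1 = (\<Sum>k<2 * d * d. n k)"
    using assms(2) mat_trace_gram_eq_1_iff[OF W(1)] unfolding n_def W(3) by simp
  also have "\<dots> \<le> (\<Sum>k<2 * d * d. \<Sum>i<d. t * n k)"
    unfolding n_def using W(1,2) by (intro sum_mono) (auto simp: flat_cols_def)
  also have "\<dots> = real d * t * (\<Sum>k<2 * d * d. n k)"
    by (simp add: sum_distrib_left mult_ac)
  also have "\<dots> = real d * t" unfolding \<open>1 = (\<Sum>k<2 * d * d. n k)\<close>[symmetric] by simp
  finally show ?thesis .
qed

lemma floor_log_minus_log:
  assumes "0 < t"
  shows "floor_log (- log 2 t) = log 2 (real_of_int \<lfloor>1 / t\<rfloor>)"
  using assms by (simp add: floor_log_def powr_minus_divide)

text \<open>Since both extrema are attained, either side produces one state that is flat at level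
  \<open>1/m\<close> and lies in the ball, and this state witnesses the other side.\<close>

lemma achievable_iff:
  assumes \<rho>: "\<rho> \<in> density d" and Ops: "SIO d m \<inter> DIO d m \<subseteq> Ops d m" "Ops d m \<subseteq> MIO d m"
    and m: "m \<in> {1..d}" and \<epsilon>: "0 \<le> \<epsilon>"
  shows "1 - \<epsilon> \<le> assisted_fidelity Ops d \<rho> m \<longleftrightarrow>
    (INF \<omega>\<in>fidelity_ball d \<epsilon> \<rho>. theta d \<omega>) \<le> 1 / real m"
proof -
  define \<tau> where "\<tau> = (INF \<omega>\<in>fidelity_ball d \<epsilon> \<rho>. theta d \<omega>)"
  note \<tau> = has_min_Inf[OF theta_fidelity_ball_has_min[OF \<rho> \<epsilon>], folded \<tau>_def]
  note F = has_max_Sup[OF fidelity_flat_states_has_max[OF \<rho> m]]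
  show ?thesis
    unfolding assisted_fidelity_eq(2)[where Ops = Ops, OF \<rho> Ops m] \<tau>_def[symmetric]
  proof
    assume le: "1 - \<epsilon> \<le> (SUP \<omega>\<in>flat_states d m. fidelity \<rho> \<omega>)"
    obtain \<omega> where \<omega>: "\<omega> \<in> flat_states d m" "1 - \<epsilon> \<le> fidelity \<rho> \<omega>" using F(1) le by auto
    then have D: "\<omega> \<in> density d" using flat_gram_density by (auto simp: flat_states_iff)
    then have "\<tau> \<le> theta d \<omega>" using \<omega>(2) by (intro \<tau>(2)) (auto simp: fidelity_ball_def)
    also have "\<dots> \<le> 1 / real m" using theta_le_iff[OF D] \<omega>(1) by (simp add: flat_states_iff)
    finally show "\<tau> \<le> 1 / real m" .
  next
    assume le: "\<tau> \<le> 1 / real m"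
    obtain \<omega> where \<omega>: "\<omega> \<in> fidelity_ball d \<epsilon> \<rho>" "\<tau> = theta d \<omega>" using \<tau>(1) by auto
    then have D: "\<omega> \<in> density d" "1 - \<epsilon> \<le> fidelity \<rho> \<omega>" by (auto simp: fidelity_ball_def)
    then have "\<omega> \<in> flat_states d m"
      using theta_le_iff[OF D(1)] le \<omega>(2) densityD(2) by (simp add: flat_states_iff)
    then have "fidelity \<rho> \<omega> \<le> (SUP \<omega>\<in>flat_states d m. fidelity \<rho> \<omega>)" by (intro F(2)) auto
    then show "1 - \<epsilon> \<le> (SUP \<omega>\<in>flat_states d m. fidelity \<rho> \<omega>)" using D(2) by simp
  qed
qed

text \<open>For \<open>m > d\<close> the set of flat states is empty, hence the range
  \<open>1..d\<close>. Unrestricted dimensions need small \<open>\<epsilon>\<close>: for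
  \<open>d = 1\<close> and \<open>\<epsilon> = 1/2\<close> the dimension 2 is already achievable,
  while the formula gives rate 0.\<close>

theorem theorem2:
  fixes d :: nat and \<rho> :: "complex mat" and \<epsilon> :: real
    and Ops :: "nat \<Rightarrow> nat \<Rightarrow> (complex mat \<Rightarrow> complex mat) set"
  assumes "\<rho> \<in> density d"
    and "Ops \<in> {MIO, DIO, SIO, IO}"
  shows "(\<forall>m\<in>{1..d}.
            has_max (assisted_values Ops d \<rho> m) \<and>
            has_max (fidelity \<rho> ` flat_states d m) \<and>
            assisted_fidelity Ops d \<rho> m = (SUP \<omega>\<in>flat_states d m. fidelity \<rho> \<omega>)) \<and>
         (\<forall>\<omega>\<in>density d. has_min (theta_values d \<omega>)) \<and>
         (0 \<le> \<epsilon> \<longrightarrow>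
            has_min (theta d ` fidelity_ball d \<epsilon> \<rho>) \<and>
            has_max (achievable_dims {1..d} Ops d \<rho> \<epsilon>) \<and>
            assisted_rate {1..d} Ops d \<rho> \<epsilon> =
              floor_log (- log 2 (INF \<omega>\<in>fidelity_ball d \<epsilon> \<rho>. theta d \<omega>)) \<and>
            (\<epsilon> < 1 / (real d + 1) \<longrightarrow>
               has_max (achievable_dims {1..} Ops d \<rho> \<epsilon>) \<and>
               assisted_rate {1..} Ops d \<rho> \<epsilon> =
                 floor_log (- log 2 (INF \<omega>\<in>fidelity_ball d \<epsilon> \<rho>. theta d \<omega>))))"
proof -
  note \<rho> = assms(1) and ops = free_ops_sandwich[OF assms(2)]
  define \<tau> where "\<tau> = (INF \<omega>\<in>fidelity_ball d \<epsilon> \<rho>. theta d \<omega>)"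
  have rate: "has_max (achievable_dims {1..d} Ops d \<rho> \<epsilon>)"
    "assisted_rate {1..d} Ops d \<rho> \<epsilon> = floor_log (- log 2 \<tau>)"
    "\<epsilon> < 1 / (real d + 1) \<Longrightarrow> achievable_dims {1..} Ops d \<rho> \<epsilon> = achievable_dims {1..d} Ops d \<rho> \<epsilon>"
    if \<epsilon>: "0 \<le> \<epsilon>"
  proof -
    obtain \<omega> where \<omega>: "\<omega> \<in> density d" "\<tau> = theta d \<omega>"
      using has_min_Inf(1)[OF theta_fidelity_ball_has_min[OF \<rho> \<epsilon>]]
      by (auto simp: \<tau>_def fidelity_ball_def)
    have flat: "flat_gram d \<tau> \<omega>" using theta_le_iff[OF \<omega>(1), of \<tau>] \<omega>(2) by simp
    note tr = densityD(2)[OF \<omega>(1)]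
    have \<tau>: "0 < \<tau>" "\<tau> \<le> 1" "1 / \<tau> \<le> real d"
      using flat_gram_pos[OF flat tr] theta_le_iff[OF \<omega>(1)] density_flat_gram_1[OF \<omega>(1)] \<omega>(2)
        flat_gram_ge_inverse_dim[OF flat tr]
      by (auto simp: pos_divide_le_eq)
    \<comment> \<open>The largest achievable dimension: \<open>\<tau> \<le> 1/m\<close> amounts to
      \<open>m \<le> n\<close>, and \<open>1 \<le> n \<le> d\<close>.\<close>
    define n where "n = nat \<lfloor>1 / \<tau>\<rfloor>"
    have "1 \<le> \<lfloor>1 / \<tau>\<rfloor>" using \<tau> by (simp add: le_floor_iff)
    then have n: "1 \<le> n" "real n = real_of_int \<lfloor>1 / \<tau>\<rfloor>"
      unfolding n_def by (linarith, subst of_nat_nat) linarith+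
    have "n \<le> d" using \<tau>(3) n(2) of_int_floor_le[of "1 / \<tau>"] by linarith
    have "1 - \<epsilon> \<le> assisted_fidelity Ops d \<rho> m \<longleftrightarrow> m \<le> n" if m: "m \<in> {1..d}" for m
    proof -
      have "1 - \<epsilon> \<le> assisted_fidelity Ops d \<rho> m \<longleftrightarrow> \<tau> \<le> 1 / real m"
        unfolding \<tau>_def using achievable_iff[where Ops = Ops, OF \<rho> ops(2,1) m \<epsilon>] .
      also have "\<dots> \<longleftrightarrow> real m \<le> 1 / \<tau>"
        using m \<tau>(1) by (auto simp: field_simps)
      also have "\<dots> \<longleftrightarrow> int m \<le> \<lfloor>1 / \<tau>\<rfloor>" by (simp add: le_floor_iff)
      also have "\<dots> \<longleftrightarrow> m \<le> n" unfolding n_def using \<open>1 \<le> \<lfloor>1 / \<tau>\<rfloor>\<close> by linarith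
      finally show ?thesis .
    qed
    then have dims: "achievable_dims {1..d} Ops d \<rho> \<epsilon> = {1..n}"
      using \<open>n \<le> d\<close> by (auto simp: achievable_dims_def)
    show "has_max (achievable_dims {1..d} Ops d \<rho> \<epsilon>)"
      unfolding dims has_max_def using n(1) by (intro bexI[of _ n]) auto
    have "Max {1..n} = n" using n(1) by (intro Max_eqI) auto
    then show "assisted_rate {1..d} Ops d \<rho> \<epsilon> = floor_log (- log 2 \<tau>)"
      unfolding assisted_rate_def dims floor_log_minus_log[OF \<tau>(1)] n(2)[symmetric] by simp
    \<comment> \<open>Beyond \<open>d\<close> the fidelity is at most \<open>d / (d + 1)\<close>,
      below \<open>1 - \<epsilon>\<close>.\<close>
    assume small: "\<epsilon> < 1 / (real d + 1)"
    have "assisted_fidelity Ops d \<rho> m < 1 - \<epsilon>" if m: "d < m" for m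
    proof -
      have m1: "1 \<le> m" using m by simp
      have "assisted_fidelity Ops d \<rho> m \<le> real d / real m"
        unfolding assisted_fidelity_def
        using assisted_values_nonempty[where Ops = Ops, OF ops(2,1) m1 \<rho>] assisted_value_le_dim[where Ops = Ops, OF _ ops(1) m1]
        by (intro cSup_least) auto
      also have "\<dots> \<le> real d / (real d + 1)" using m by (intro divide_left_mono) auto
      also have "\<dots> = 1 - 1 / (real d + 1)" by (simp add: field_simps)
      also have "\<dots> < 1 - \<epsilon>" using small by simp
      finally show ?thesis .
    qed
    then show "achievable_dims {1..} Ops d \<rho> \<epsilon> = achievable_dims {1..d} Ops d \<rho> \<epsilon>"
      unfolding achievable_dims_def by (force simp: not_less)
  qed
  have rate': "has_max (achievable_dims {1..} Ops d \<rho> \<epsilon>) \<and>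
      assisted_rate {1..} Ops d \<rho> \<epsilon> = floor_log (- log 2 \<tau>)" if "0 \<le> \<epsilon>" "\<epsilon> < 1 / (real d + 1)"
    using rate[OF that(1)] that(2) by (simp add: assisted_rate_def)
  show ?thesis
    unfolding \<tau>_def[symmetric]
    using assisted_fidelity_eq[where Ops = Ops, OF \<rho> ops(2,1)] fidelity_flat_states_has_max[OF \<rho>]
      theta_values_has_min theta_fidelity_ball_has_min[OF \<rho>] rate rate'
    by blast
qed

end
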